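(* For any batch algorithm (in the setting below) using a constant number $B$ of batches whose lengths are fixed in advance (depending only on $T$), there exists $f$ with $\|f\|_k\le\Psi$ such that with probability at least $\frac12$: - for the SE kernel, $R_T=\Omega\Big(T^{\frac{1-\eta}{1-\eta^B}}(\log T)^{\frac{d(\eta-\eta^B)}{2(1-\eta^B)}}\Big)$ with $\eta=\frac12$; - for the Matérn kernel, $R_T=\Omega\Big(T^{\frac{1-\eta}{1-\eta^B}}\Big)$ with $\eta=\frac{\nu}{2\nu+d}$.
   Context: Setting: domain $\mathcal{X}=[0,1]^d$; $f$ lies in the RKHS of kernel $k$ with $\|f\|_k\le\Psi$, where $\Psi>0$ is a fixed constant. At each time $t=1,\dots,T$ a point $x_t$ is selected; time is split into $B$ consecutive batches of lengths $N_1,\dots,N_B$ summing to $T$; noisy observations $y_t=f(x_t)+\epsilon_t$ (i.i.d. $R$-sub-Gaussian noise) of a batch are revealed only at its end. Cumulative regret $R_T=\sum_{t=1}^T(f(x^\ast)-f(x_t))$ with $x^\ast\in\arg\max f$. Kernels: $k_{SE}(x,x')=\exp(-\|x-x'\|^2/(2l^2))$; $k_{\text{Matérn}}(x,x')=\frac{2^{1-\nu}}{\Gamma(\nu)}\big(\frac{\sqrt{2\nu}\|x-x'\|}{l}\big)^\nu B_\nu\big(\frac{\sqrt{2\nu}\|x-x'\|}{l}\big)$; $l,\nu,d$ fixed constants. Asymptotic notation is as $T\to\infty$ with $B$ fixed. *)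

theory Defs
  imports "HOL-Probability.Probability"
begin

definition unit_cube :: "(real ^ 'd) set" where
  "unit_cube = {x. \<forall>i. 0 \<le> x $ i \<and> x $ i \<le> 1}"

definition k_SE :: "real \<Rightarrow> real ^ 'd \<Rightarrow> real ^ 'd \<Rightarrow> real" where
  "k_SE l x x' = exp (- (norm (x - x'))\<^sup>2 / (2 * l\<^sup>2))"

text \<open>Modified Bessel function of the second kind, via its standard integral
  representation K_nu(z) = int_0^infty exp(-z cosh t) cosh(nu t) dt, for z > 0.\<close>
definition besselK :: "real \<Rightarrow> real \<Rightarrow> real" where
  "besselK \<nu> z = (\<integral>t\<in>{0..}. exp (- z * cosh t) * cosh (\<nu> * t) \<partial>lborel)"

text \<open>Matern kernel; at distance 0 it takes its limiting value 1.\<close>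
definition k_matern :: "real \<Rightarrow> real \<Rightarrow> real ^ 'd \<Rightarrow> real ^ 'd \<Rightarrow> real" where
  "k_matern \<nu> l x x' =
     (if x = x' then 1
      else 2 powr (1 - \<nu>) / Gamma \<nu> * (sqrt (2 * \<nu>) * norm (x - x') / l) powr \<nu>
           * besselK \<nu> (sqrt (2 * \<nu>) * norm (x - x') / l))"

section \<open>RKHS norm (Moore--Aronszajn construction)\<close>

text \<open>Elements of the pre-RKHS: finite combinations sum_i a_i k(p_i, .), given as lists of
  (coefficient, centre).\<close>
definition pre_eval :: "('a \<Rightarrow> 'a \<Rightarrow> real) \<Rightarrow> (real \<times> 'a) list \<Rightarrow> 'a \<Rightarrow> real" where
  "pre_eval k g x = (\<Sum>(a, p)\<leftarrow>g. a * k p x)"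

definition pre_norm :: "('a \<Rightarrow> 'a \<Rightarrow> real) \<Rightarrow> (real \<times> 'a) list \<Rightarrow> real" where
  "pre_norm k g = sqrt (\<Sum>(a, p)\<leftarrow>g. \<Sum>(b, q)\<leftarrow>g. a * b * k p q)"

definition pre_diff :: "(real \<times> 'a) list \<Rightarrow> (real \<times> 'a) list \<Rightarrow> (real \<times> 'a) list" where
  "pre_diff g h = g @ map (\<lambda>(b, q). (- b, q)) h"

definition rkhs_has_norm :: "('a \<Rightarrow> 'a \<Rightarrow> real) \<Rightarrow> 'a set \<Rightarrow> ('a \<Rightarrow> real) \<Rightarrow> real \<Rightarrow> bool" where
  "rkhs_has_norm k X f r \<longleftrightarrow>
     (\<exists>g :: nat \<Rightarrow> (real \<times> 'a) list.
        (\<forall>n. snd ` set (g n) \<subseteq> X) \<and>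
        (\<forall>e>0. \<exists>N. \<forall>m\<ge>N. \<forall>n\<ge>N. pre_norm k (pre_diff (g m) (g n)) < e) \<and>
        (\<forall>x\<in>X. (\<lambda>n. pre_eval k (g n) x) \<longlonglongrightarrow> f x) \<and>
        (\<lambda>n. pre_norm k (g n)) \<longlonglongrightarrow> r)"

definition rkhs_ball :: "('a \<Rightarrow> 'a \<Rightarrow> real) \<Rightarrow> 'a set \<Rightarrow> real \<Rightarrow> ('a \<Rightarrow> real) \<Rightarrow> bool" where
  "rkhs_ball k X \<Psi> f \<longleftrightarrow> (\<exists>r\<le>\<Psi>. rkhs_has_norm k X f r)"

text \<open>Batches have lengths N 0, ..., N (B-1) (0-indexed). Time steps are 0-indexed too.
  batch_start N t is the first time step of the batch containing t.\<close>
definition batch_start :: "(nat \<Rightarrow> nat) \<Rightarrow> nat \<Rightarrow> nat" where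
  "batch_start N t = (\<Sum>i<(LEAST j. t < (\<Sum>i<Suc j. N i)). N i)"

text \<open>A (randomised) batch policy pi: at time t, given the internal random seed u and the
  history of (point, observation) pairs, it returns the next query point. The trajectory
  only ever reveals to pi the observations of batches completed before the current batch.
  eps t is the noise at time t.\<close>
primrec trajectory ::
  "(nat \<Rightarrow> real \<Rightarrow> ('x \<times> real) list \<Rightarrow> 'x) \<Rightarrow> (nat \<Rightarrow> nat) \<Rightarrow> ('x \<Rightarrow> real)
     \<Rightarrow> real \<Rightarrow> (nat \<Rightarrow> real) \<Rightarrow> nat \<Rightarrow> ('x \<times> real) list" where
  "trajectory \<pi> N f u eps 0 = []"
| "trajectory \<pi> N f u eps (Suc t) =
     (let h = trajectory \<pi> N f u eps t;
          x = \<pi> t u (take (batch_start N t) h)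
      in h @ [(x, f x + eps t)])"

definition regret ::
  "(nat \<Rightarrow> real \<Rightarrow> ('x \<times> real) list \<Rightarrow> 'x) \<Rightarrow> (nat \<Rightarrow> nat) \<Rightarrow> 'x set \<Rightarrow> ('x \<Rightarrow> real)
     \<Rightarrow> nat \<Rightarrow> real \<Rightarrow> (nat \<Rightarrow> real) \<Rightarrow> real" where
  "regret \<pi> N X f T u eps =
     (\<Sum>t<T. (SUP z\<in>X. f z) - f (fst (trajectory \<pi> N f u eps T ! t)))"

text \<open>Probability space: internal seed u uniform on [0,1], independent of i.i.d. Gaussian
  noise N(0, R^2) at times 0..T-1 (which is R-sub-Gaussian).\<close>
definition bandit_space :: "real \<Rightarrow> nat \<Rightarrow> (real \<times> (nat \<Rightarrow> real)) measure" where
  "bandit_space R T =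
     uniform_measure lborel {0..1::real} \<Otimes>\<^sub>M
     PiM {..<T} (\<lambda>_. density lborel (normal_density 0 R))"

definition batch_regret_lower_bound ::
  "('x \<Rightarrow> 'x \<Rightarrow> real) \<Rightarrow> 'x set \<Rightarrow> real \<Rightarrow> real \<Rightarrow> nat \<Rightarrow> (nat \<Rightarrow> real) \<Rightarrow> bool" where
  "batch_regret_lower_bound k X \<Psi> R B rate \<longleftrightarrow>
     (\<exists>c>0. \<exists>T0. \<forall>T\<ge>T0. \<forall>N :: nat \<Rightarrow> nat. \<forall>\<pi> :: nat \<Rightarrow> real \<Rightarrow> ('x \<times> real) list \<Rightarrow> 'x.
        (\<Sum>i<B. N i) = T \<longrightarrow>
        (\<forall>t u h. \<pi> t u h \<in> X) \<longrightarrow>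
        (\<forall>f. rkhs_ball k X \<Psi> f \<longrightarrow>
             (\<lambda>(u, eps). regret \<pi> N X f T u eps) \<in> borel_measurable (bandit_space R T)) \<longrightarrow>
        (\<exists>f. rkhs_ball k X \<Psi> f \<and>
             prob_space.prob (bandit_space R T)
               {(u, eps) \<in> space (bandit_space R T). regret \<pi> N X f T u eps \<ge> c * rate T}
             \<ge> 1 / 2))"

end

theory Submission
  imports Defs "HOL-Computational_Algebra.Polynomial" "HOL-Real_Asymp.Real_Asymp"
begin

text \<open>A lower bound follows from finite families of functions \<open>f\<^sub>j\<close> in the RKHS ball such that no query
  is nearly optimal for two members, while \<open>\<Sum>\<^sub>j f\<^sub>j\<^sup>2\<close> is uniformly bounded by a multiple of the squared
  optimality gap.  If \<open>s\<close> steps precede a batch, Cauchy--Schwarz against the Gaussian noise gives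
  \<open>\<Sum>\<^sub>j p\<^sub>j\<^sup>2 \<le> 1 + s D\<close>, where \<open>p\<^sub>j\<close> is the probability of small regret under \<open>f\<^sub>j\<close> at the end of the batch and
  \<open>D = sup \<Sum>\<^sub>j (exp (f\<^sub>j\<^sup>2 / R\<^sup>2) - 1)\<close>; so some \<open>p\<^sub>j\<close> is at most \<open>1/2\<close> unless \<open>s D\<close> is of the order of the
  size of the family.  A grid of times at which the scales balance then yields the rate, since some batch
  must cross two consecutive grid points.

  All members of the families are finite combinations of kernel translates.  For the SE kernel they
  are products of one-dimensional bumps obtained from Fejer kernels; \<open>n\<^sup>d\<close> bumps cost a norm
  \<open>exp (O (n log n))\<close>.  For the Matern kernel, written as a mixture of Gaussians over their
  variance, they are high-order finite differences of the kernel at scale \<open>w\<close>, which have height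
  and norm of orders \<open>w powr (2 * \<nu>)\<close> and \<open>w powr \<nu>\<close> and decay polynomially at distances beyond \<open>w\<close>.\<close>

section \<open>Regret of batch policies on finite families\<close>

text \<open>The squares of all members at one query sum to order delta^2, so s queries contribute s
  * delta^2 to the whole family of M members, not to each of them: a member stays hidden while s *
  delta^2 is small against M. Given the threshold a(m), this fixes the largest gap delta(m) that
  stays hidden. The next threshold is chosen so that a(m+1) * delta(m) is a fixed multiple of the
  target rate for every m, and the rate is whatever makes this recursion reach T after B steps. For
  Matern, M is of order w powr (- d) and delta of order w powr nu, hence w is of order a(m) powr (-
  1 / (2 nu + d)) and delta of order a(m) powr (- eta). For SE, M is of order (log T) powr (d / 2):
  sqrt (log T) bumps per coordinate cost a norm exp (O (sqrt (log T) * log log T)), absorbed by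
  amplitudes that from the second batch on are at most T powr (- 1 / 4) up to logarithms. The first
  batch has no data before it, so there a constant amplitude and a family of constant size, above 4,
  are enough. Finite kernel combinations with centres in the cube are chosen because their RKHS norm
  is an explicit double sum.\<close>

text \<open>Cauchy--Schwarz against the centred density: the integral of (shifted density)^2 /
  (centred density) is \<open>Z\<close>, which gives \<open>V\<^sup>2 \<le> Z * S\<close>. Since
  \<open>S \<le> 1\<close>, the factor \<open>Z\<close> can be traded for the summand
  \<open>Z - 1\<close>; this additive form accumulates only linearly over the time steps.\<close>

lemma normal_shift_second_moment:
  fixes R :: real and g :: "real \<Rightarrow> real"
  assumes R: "R > 0" and g[measurable]: "g \<in> borel_measurable borel"
    and g01: "\<And>y. 0 \<le> g y" "\<And>y. g y \<le> 1"
  shows "(\<integral>y. normal_density \<mu> R y * g y \<partial>lborel)\<^sup>2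
         \<le> (\<integral>y. normal_density 0 R y * (g y)\<^sup>2 \<partial>lborel) + (exp (\<mu>\<^sup>2 / R\<^sup>2) - 1)"
proof -
  have int: "integrable lborel (\<lambda>y. normal_density m R y * q y)"
    if [measurable]: "q \<in> borel_measurable borel" and q: "\<And>y. 0 \<le> q y" "\<And>y. q y \<le> 1" for q m
    by (rule Bochner_Integration.integrable_bound[of _ "normal_density m R"])
       (use q R in \<open>auto intro!: mult_left_le\<close>)
  define V where "V = (\<integral>y. normal_density \<mu> R y * g y \<partial>lborel)"
  define S where "S = (\<integral>y. normal_density 0 R y * (g y)\<^sup>2 \<partial>lborel)"
  define Z where "Z = exp (\<mu>\<^sup>2 / R\<^sup>2)"
  have Z1: "Z \<ge> 1" unfolding Z_def by simp
  \<comment> \<open>Completing the square: the densities centred at 0 and at twice the mean multiply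
    to a multiple of the squared density halfway between them.\<close>
  have sq: "(normal_density \<mu> R y)\<^sup>2 = Z * (normal_density 0 R y * normal_density (2*\<mu>) R y)" for y
  proof -
    have e: "(exp (- (y - \<mu>)\<^sup>2 / (2 * R\<^sup>2)))\<^sup>2
        = Z * (exp (- (y - 0)\<^sup>2 / (2 * R\<^sup>2)) * exp (- (y - 2*\<mu>)\<^sup>2 / (2 * R\<^sup>2)))"
    proof -
      have "2 * (- (y - \<mu>)\<^sup>2 / (2 * R\<^sup>2)) = \<mu>\<^sup>2 / R\<^sup>2 + (- (y - 0)\<^sup>2 / (2 * R\<^sup>2) + - (y - 2*\<mu>)\<^sup>2 / (2 * R\<^sup>2))"
        using R by (simp add: field_simps power2_eq_square)
      then show ?thesis
        unfolding Z_def exp_add[symmetric] exp_double[symmetric] by simp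
    qed
    show ?thesis
      unfolding normal_density_def power_mult_distrib e
      by (simp add: power2_eq_square)
  qed
  \<comment> \<open>The integrand of Cauchy--Schwarz, obtained by expanding a square and cancelling
    the positive centred density. The multiplier \<open>V / Z\<close> is the optimal one.\<close>
  have pt: "(2 * V / Z) * (normal_density \<mu> R y * g y)
      \<le> normal_density 0 R y * (g y)\<^sup>2 + (V\<^sup>2 / Z) * normal_density (2*\<mu>) R y" for y
  proof -
    let ?a = "normal_density 0 R y" and ?b = "normal_density \<mu> R y" and ?c = "normal_density (2*\<mu>) R y"
    have a: "?a > 0" by (rule normal_density_pos[OF R])
    have "0 \<le> (?a * g y - V / Z * ?b)\<^sup>2" by simp
    also have "\<dots> = ?a * (?a * (g y)\<^sup>2 + (V\<^sup>2/Z) * ?c - 2 * V / Z * (?b * g y))"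
      using Z1 sq[of y] by (simp add: power2_diff power_mult_distrib field_simps power2_eq_square)
    finally show ?thesis using a by (simp add: zero_le_mult_iff)
  qed
  have I1: "integrable lborel (\<lambda>y. normal_density \<mu> R y * g y)" by (rule int) (use g01 in auto)
  have I2: "integrable lborel (\<lambda>y. normal_density 0 R y * (g y)\<^sup>2)"
    by (rule int) (use g01 in \<open>auto simp: power_le_one\<close>)
  have "(\<integral>y. (2 * V / Z) * (normal_density \<mu> R y * g y) \<partial>lborel)
      \<le> (\<integral>y. normal_density 0 R y * (g y)\<^sup>2 + (V\<^sup>2 / Z) * normal_density (2*\<mu>) R y \<partial>lborel)"
    by (rule integral_mono) (use I1 I2 R pt in auto)
  also have "\<dots> = S + V\<^sup>2 / Z"
    using I2 R by (subst Bochner_Integration.integral_add) (auto simp: S_def)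
  finally have "(2 * V / Z) * V \<le> S + V\<^sup>2 / Z" by (simp add: V_def)
  then have "V\<^sup>2 \<le> Z * S" using Z1 by (simp add: field_simps power2_eq_square)
  also have "S \<le> (\<integral>y. normal_density 0 R y \<partial>lborel)"
    unfolding S_def
    by (rule integral_mono[OF I2]) (use R g01 in \<open>auto intro!: mult_left_le simp: power_le_one\<close>)
  then have "S \<le> 1" using R by simp
  then have "Z * S \<le> S + (Z - 1)" using Z1 mult_left_le[of S "Z - 1"] by (simp add: algebra_simps)
  finally show ?thesis unfolding V_def S_def Z_def .
qed

section \<open>What a query can depend on\<close>

lemma length_trajectory [simp]: "length (trajectory \<pi> N f u eps t) = t"
  by (induction t) (auto simp: Let_def)

lemma take_trajectory:
  "take n (trajectory \<pi> N f u eps t) = trajectory \<pi> N f u eps (min n t)"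
proof (induction t)
  case (Suc t)
  then show ?case
    by (cases "n \<le> t") (auto simp: Let_def min_def not_le le_Suc_eq)
qed simp

lemma trajectory_cong:
  "(\<And>i. i < t \<Longrightarrow> eps i = eps' i) \<Longrightarrow> trajectory \<pi> N f u eps t = trajectory \<pi> N f u eps' t"
  by (induction t) (auto simp: Let_def)

lemma fst_trajectory_nth:
  assumes "t < T"
  shows "fst (trajectory \<pi> N f u eps T ! t)
    = \<pi> t u (take (batch_start N t) (trajectory \<pi> N f u eps t))"
proof -
  have "trajectory \<pi> N f u eps T ! t = take (Suc t) (trajectory \<pi> N f u eps T) ! t" by simp
  also have "\<dots> = trajectory \<pi> N f u eps (Suc t) ! t"
    using assms by (simp add: take_trajectory min_def del: trajectory.simps)
  finally show ?thesis by (simp add: Let_def nth_append)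
qed

lemma batch_start_le:
  assumes "t < (\<Sum>i<Suc m. N i)"
  shows "batch_start N t \<le> (\<Sum>i<m. N i)"
  unfolding batch_start_def
  using Least_le[of "\<lambda>j. t < (\<Sum>i<Suc j. N i)", OF assms]
  by (intro sum_mono2) auto

text \<open>This is where delayed feedback enters: up to the end of batch \<open>m\<close> a query
  sees only observations from before that batch, so two runs that agree there make the same queries,
  even under different functions and noises.\<close>

lemma query_determined_by_past_batches:
  assumes "t < (\<Sum>i<Suc m. N i)" "t < T"
    and eq: "trajectory \<pi> N f u eps (\<Sum>i<m. N i) = trajectory \<pi> N f' u eps' (\<Sum>i<m. N i)"
  shows "fst (trajectory \<pi> N f u eps T ! t) = fst (trajectory \<pi> N f' u eps' T ! t)"
proof -
  let ?s = "\<Sum>i<m. N i"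
  have b: "batch_start N t \<le> ?s" by (rule batch_start_le[OF assms(1)])
  have *: "take (batch_start N t) (trajectory \<pi> N g u e t)
     = take (min (batch_start N t) t) (trajectory \<pi> N g u e ?s)" for g e
    using b by (simp add: take_trajectory min_def)
  show ?thesis by (simp add: fst_trajectory_nth[OF assms(2)] * eq)
qed

section \<open>Probability of an event with the first noise values frozen\<close>

definition splice :: "nat \<Rightarrow> (nat \<Rightarrow> 'a) \<Rightarrow> (nat \<Rightarrow> 'a) \<Rightarrow> nat \<Rightarrow> 'a" where
  "splice a e z = (\<lambda>i. if i < a then e i else z i)"

abbreviation noise :: "real \<Rightarrow> real measure" where
  "noise R \<equiv> density lborel (normal_density 0 R)"

text \<open>A conditional probability given the first \<open>a\<close> noise values, defined for
  every \<open>e\<close> and not merely for almost every one. It can therefore be evaluated at the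
  particular noise that reproduces prescribed observations.\<close>

definition future_prob :: "real \<Rightarrow> nat \<Rightarrow> (nat \<Rightarrow> real) set \<Rightarrow> nat \<Rightarrow> (nat \<Rightarrow> real) \<Rightarrow> real" where
  "future_prob R T E a e = measure (PiM {a..<T} (\<lambda>_. noise R))
     {z \<in> space (PiM {a..<T} (\<lambda>_. noise R)). splice a e z \<in> E}"

lemma splice_measurable:
  assumes "a \<le> T"
  shows "splice a e \<in> measurable (PiM {a..<T} (\<lambda>_. noise R)) (PiM {..<T} (\<lambda>_. noise R))"
proof (rule measurable_PiM_single')
  fix i assume "i \<in> {..<T}"
  then show "(\<lambda>z. splice a e z i) \<in> measurable (PiM {a..<T} (\<lambda>_. noise R)) (noise R)"
    by (cases "i < a") (auto simp: splice_def intro!: measurable_component_singleton)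
next
  show "(\<lambda>z i. splice a e z i) \<in> space (PiM {a..<T} (\<lambda>_. noise R)) \<rightarrow> {..<T} \<rightarrow>\<^sub>E space (noise R)"
    using assms by (auto simp: splice_def space_PiM PiE_def extensional_def)
qed

lemma future_prob_nonneg: "0 \<le> future_prob R T E a e"
  by (simp add: future_prob_def)

lemma future_prob_le_1: "R > 0 \<Longrightarrow> future_prob R T E a e \<le> 1"
  unfolding future_prob_def
  by (intro prob_space.prob_le_1 prob_space_PiM prob_space_normal_density)

lemma future_prob_witness:
  assumes "future_prob R T E a e \<noteq> 0"
  obtains z where "splice a e z \<in> E"
proof -
  have "{z \<in> space (PiM {a..<T} (\<lambda>_. noise R)). splice a e z \<in> E} \<noteq> {}"
    using assms by (auto simp: future_prob_def simp del: Collect_empty_eq)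
  then show ?thesis using that by blast
qed

text \<open>Fubini for the single coordinate \<open>a\<close>. By \<open>emp\<close>, freezing one
  more value amounts to freezing \<open>a\<close> values and setting the next coordinate to
  \<open>v\<close>.\<close>

lemma
  assumes R: "R > 0" and a: "a < T" and E[measurable]: "E \<in> sets (PiM {..<T} (\<lambda>_. noise R))"
  shows future_prob_measurable: "(\<lambda>v. future_prob R T E (Suc a) (e(a := v))) \<in> borel_measurable borel"
    and future_prob_step: "future_prob R T E a e
      = (\<integral>v. normal_density 0 R v * future_prob R T E (Suc a) (e(a := v)) \<partial>lborel)"
proof -
  interpret product_sigma_finite "\<lambda>_::nat. noise R"
    by (intro product_sigma_finite.intro prob_space_imp_sigma_finite prob_space_normal_density R)
  let ?P = "PiM {Suc a..<T} (\<lambda>_. noise R)"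
  interpret P: sigma_finite_measure ?P
    by (intro prob_space_imp_sigma_finite prob_space_PiM prob_space_normal_density R)
  have ins: "insert a {Suc a..<T} = {a..<T}" using a by auto
  have emp: "splice a e (x(a := v)) = splice (Suc a) (e(a := v)) x" for x v
    by (auto simp: splice_def fun_eq_iff less_Suc_eq)
  have fp: "ennreal (future_prob R T E b e') =
     (\<integral>\<^sup>+ z. indicator E (splice b e' z) \<partial>PiM {b..<T} (\<lambda>_. noise R))" if "b \<le> T" for b e'
  proof -
    interpret Q: prob_space "PiM {b..<T} (\<lambda>_. noise R)"
      by (intro prob_space_PiM prob_space_normal_density R)
    have [measurable]: "splice b e' \<in> measurable (PiM {b..<T} (\<lambda>_. noise R)) (PiM {..<T} (\<lambda>_. noise R))"
      by (rule splice_measurable[OF that])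
    have *: "(\<integral>\<^sup>+ z. indicator E (splice b e' z) \<partial>PiM {b..<T} (\<lambda>_. noise R))
       = (\<integral>\<^sup>+ z. indicator {z \<in> space (PiM {b..<T} (\<lambda>_. noise R)). splice b e' z \<in> E} z \<partial>PiM {b..<T} (\<lambda>_. noise R))"
      by (intro nn_integral_cong) (auto simp: indicator_def)
    show ?thesis unfolding future_prob_def *
      by (subst nn_integral_indicator) (auto simp: Q.emeasure_eq_measure)
  qed
  have [measurable]: "splice a e \<in> measurable (PiM (insert a {Suc a..<T}) (\<lambda>_. noise R)) (PiM {..<T} (\<lambda>_. noise R))"
    unfolding ins by (rule splice_measurable) (use a in simp)
  have m1: "(\<lambda>z. indicator E (splice a e z) :: ennreal) \<in> borel_measurable (PiM (insert a {Suc a..<T}) (\<lambda>_. noise R))"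
    by measurable
  have m2: "(\<lambda>(v, x). x(a := v)) \<in> measurable (noise R \<Otimes>\<^sub>M ?P) (PiM (insert a {Suc a..<T}) (\<lambda>_. noise R))"
    unfolding split_beta' by (rule measurable_fun_upd[where J="{Suc a..<T}"]) auto
  have "(\<lambda>w. indicator E (splice a e ((\<lambda>(v, x). x(a := v)) w)) :: ennreal) \<in> borel_measurable (noise R \<Otimes>\<^sub>M ?P)"
    using measurable_compose[OF m2 m1] .
  from P.borel_measurable_nn_integral_fst[OF this]
  have "(\<lambda>v. ennreal (future_prob R T E (Suc a) (e(a := v)))) \<in> borel_measurable (noise R)"
    using a by (simp add: fp emp)
  then have m: "(\<lambda>v. ennreal (future_prob R T E (Suc a) (e(a := v)))) \<in> borel_measurable borel"
    by simp
  have "(\<lambda>v. enn2real (ennreal (future_prob R T E (Suc a) (e(a := v))))) \<in> borel_measurable borel"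
    using m by measurable
  then show M[measurable]: "(\<lambda>v. future_prob R T E (Suc a) (e(a := v))) \<in> borel_measurable borel"
    by (simp add: future_prob_nonneg)
  have "ennreal (future_prob R T E a e) = (\<integral>\<^sup>+ z. indicator E (splice a e z) \<partial>PiM (insert a {Suc a..<T}) (\<lambda>_. noise R))"
    using a by (simp add: fp ins)
  also have "\<dots> = (\<integral>\<^sup>+ v. (\<integral>\<^sup>+ x. indicator E (splice a e (x(a := v))) \<partial>?P) \<partial>noise R)"
    by (rule product_nn_integral_insert_rev) (use m1 in auto)
  also have "\<dots> = (\<integral>\<^sup>+ v. ennreal (future_prob R T E (Suc a) (e(a := v))) \<partial>noise R)"
    using a by (simp add: emp fp)
  also have "\<dots> = (\<integral>\<^sup>+ v. ennreal (normal_density 0 R v * future_prob R T E (Suc a) (e(a := v))) \<partial>lborel)"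
    by (subst nn_integral_density) (auto simp: ennreal_mult future_prob_nonneg)
  finally have eq: "ennreal (future_prob R T E a e) = \<dots>" .
  have "(\<integral>v. normal_density 0 R v * future_prob R T E (Suc a) (e(a := v)) \<partial>lborel)
      = enn2real (ennreal (future_prob R T E a e))"
    unfolding eq by (rule integral_eq_nn_integral) (auto simp: future_prob_nonneg)
  then show "future_prob R T E a e
      = (\<integral>v. normal_density 0 R v * future_prob R T E (Suc a) (e(a := v)) \<partial>lborel)"
    by (simp add: future_prob_nonneg)
qed

text \<open>The policy need not be measurable, so the law of the observations need not exist.  Only the
  regret events are measurable, as sets of noise sequences, and their sections in the next noise
  coordinate are translates of each other once the past observations \<open>h\<close>, and hence the next
  query, are fixed.  The second moments can therefore be propagated backwards one step at a time,
  with a bound that is pointwise in \<open>h\<close>.\<close>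
lemma sum_sq_future_prob_le:
  fixes f :: "'j \<Rightarrow> 'x \<Rightarrow> real"
  assumes R: "R > 0" and J: "finite J" and sT: "s \<le> T"
    and E: "\<And>j. j \<in> J \<Longrightarrow> E j \<in> sets (PiM {..<T} (\<lambda>_. noise R))"
    and pi: "\<And>t u h. \<pi> t u h \<in> X"
    and D: "\<And>x. x \<in> X \<Longrightarrow> (\<Sum>j\<in>J. exp ((f j x)\<^sup>2 / R\<^sup>2) - 1) \<le> D"
    and excl: "\<And>j j' e e'. \<lbrakk>j \<in> J; j' \<in> J; j \<noteq> j';
        trajectory \<pi> N (f j) u e s = trajectory \<pi> N (f j') u e' s; e \<in> E j; e' \<in> E j'\<rbrakk> \<Longrightarrow> False"
  shows "a \<le> s \<Longrightarrow> (\<And>j. j \<in> J \<Longrightarrow> trajectory \<pi> N (f j) u (e j) a = h) \<Longrightarrow>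
    (\<Sum>j\<in>J. (future_prob R T (E j) a (e j))\<^sup>2) \<le> 1 + real (s - a) * D"
proof (induction "s - a" arbitrary: a e h)
  case 0
  then have as: "a = s" by simp
  \<comment> \<open>All members have now produced the same observations \<open>h\<close>, so by
    \<open>excl\<close> at most one of them has a nonempty section, and a single squared probability
    is at most 1.\<close>
  show ?case
  proof (cases "\<exists>j\<in>J. future_prob R T (E j) a (e j) \<noteq> 0")
    case True
    then obtain j where j: "j \<in> J" "future_prob R T (E j) a (e j) \<noteq> 0" by blast
    then obtain z where z: "splice a (e j) z \<in> E j" by (blast elim: future_prob_witness)
    have "future_prob R T (E j') a (e j') = 0" if j': "j' \<in> J" "j' \<noteq> j" for j'
    proof (rule ccontr)
      assume "\<not> ?thesis"
      then obtain z' where z': "splice a (e j') z' \<in> E j'" by (blast elim: future_prob_witness)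
      have tr: "trajectory \<pi> N (f i) u (splice a (e i) y) s = h" if "i \<in> J" for i y
        using 0(3)[OF that] unfolding as by (subst trajectory_cong[of s _ "e i"]) (auto simp: splice_def)
      show False using excl[OF j(1) j'(1) j'(2)[symmetric] _ z z'] tr j(1) j'(1) by simp
    qed
    then have "(\<Sum>j\<in>J. (future_prob R T (E j) a (e j))\<^sup>2) = (\<Sum>i\<in>{j}. (future_prob R T (E i) a (e i))\<^sup>2)"
      using J j by (intro sum.mono_neutral_right) auto
    also have "\<dots> \<le> 1" using future_prob_le_1[OF R] future_prob_nonneg by (simp add: power_le_one)
    finally show ?thesis using as by simp
  qed (use as in simp)
next
  case (Suc n)
  then have a: "a < s" by simp
  then have aT: "a < T" using sT by simp
  define x where "x = \<pi> a u (take (batch_start N a) h)"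
  \<comment> \<open>The next noise is parametrised by the next observation \<open>v\<close>: member
    \<open>j\<close> needs the noise \<open>v - f j x\<close>, and all members continue with the
    common history \<open>h @ [(x, v)]\<close>, as the induction hypothesis demands.\<close>
  define g where "g = (\<lambda>j v. future_prob R T (E j) (Suc a) ((e j)(a := v - f j x)))"
  have gm: "g j \<in> borel_measurable borel" if "j \<in> J" for j
    using measurable_compose[OF _ future_prob_measurable[OF R aT E[OF that]], of "\<lambda>v. v - f j x" borel "e j"]
    by (simp add: g_def)
  have g01: "0 \<le> g j v" "g j v \<le> 1" for j v
    using future_prob_nonneg future_prob_le_1[OF R] by (auto simp: g_def)
  have IH: "(\<Sum>j\<in>J. (g j v)\<^sup>2) \<le> 1 + real (s - Suc a) * D" for v
    unfolding g_def
  proof (rule Suc(1))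
    fix j assume j: "j \<in> J"
    have "trajectory \<pi> N (f j) u ((e j)(a := v - f j x)) a = h"
      using Suc(4)[OF j] by (subst trajectory_cong[of a _ "e j"]) auto
    then show "trajectory \<pi> N (f j) u ((e j)(a := v - f j x)) (Suc a) = h @ [(x, v)]"
      by (simp add: Let_def x_def)
  qed (use Suc(2) a in auto)
  have shift: "future_prob R T (E j) a (e j) = (\<integral>y. normal_density (f j x) R y * g j y \<partial>lborel)"
    if "j \<in> J" for j
  proof -
    have "future_prob R T (E j) a (e j)
        = (\<integral>v. normal_density 0 R v * future_prob R T (E j) (Suc a) ((e j)(a := v)) \<partial>lborel)"
      by (rule future_prob_step[OF R aT E[OF that]])
    \<comment> \<open>The translation moves \<open>f j x\<close> from the noise into the mean of the
      density.\<close>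
    also have "\<dots> = (\<integral>y. normal_density 0 R (- f j x + 1 * y) * future_prob R T (E j) (Suc a) ((e j)(a := - f j x + 1 * y)) \<partial>lborel)"
      by (subst lborel_integral_real_affine[of 1 _ "- f j x"]) auto
    also have "\<dots> = (\<integral>y. normal_density (f j x) R y * g j y \<partial>lborel)"
      by (intro Bochner_Integration.integral_cong) (auto simp: g_def normal_density_def algebra_simps)
    finally show ?thesis .
  qed
  have int: "integrable lborel (\<lambda>y. normal_density 0 R y * (g j y)\<^sup>2)" if "j \<in> J" for j
  proof -
    note gm[OF that, measurable]
    show ?thesis
      by (rule Bochner_Integration.integrable_bound[of _ "normal_density 0 R"])
         (use g01 R in \<open>auto intro!: mult_left_le simp: power_le_one\<close>)
  qed
  have "(\<Sum>j\<in>J. (future_prob R T (E j) a (e j))\<^sup>2)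
      \<le> (\<Sum>j\<in>J. (\<integral>y. normal_density 0 R y * (g j y)\<^sup>2 \<partial>lborel) + (exp ((f j x)\<^sup>2 / R\<^sup>2) - 1))"
    by (intro sum_mono) (simp add: shift normal_shift_second_moment[OF R gm g01])
  also have "\<dots> = (\<integral>y. (\<Sum>j\<in>J. normal_density 0 R y * (g j y)\<^sup>2) \<partial>lborel) + (\<Sum>j\<in>J. exp ((f j x)\<^sup>2 / R\<^sup>2) - 1)"
    using int by (simp add: sum.distrib)
  also have "\<dots> \<le> (\<integral>y. normal_density 0 R y * (1 + real (s - Suc a) * D) \<partial>lborel) + D"
  proof (intro add_mono integral_mono)
    fix y
    show "(\<Sum>j\<in>J. normal_density 0 R y * (g j y)\<^sup>2) \<le> normal_density 0 R y * (1 + real (s - Suc a) * D)"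
      unfolding sum_distrib_left[symmetric] by (intro mult_left_mono IH) auto
  qed (use int R D[of x] pi in \<open>auto simp: x_def\<close>)
  also have "\<dots> = 1 + real (s - a) * D"
    using a R by (simp add: algebra_simps of_nat_diff)
  finally show ?case .
qed


section \<open>Failure of some member in a fixed batch\<close>

lemma prob_space_unit_interval: "prob_space (uniform_measure lborel {0..1::real})"
  by (rule prob_space_uniform_measure) auto

lemma prob_space_bandit_space: "R > 0 \<Longrightarrow> prob_space (bandit_space R T)"
  unfolding bandit_space_def
  by (intro prob_space_pair prob_space_unit_interval prob_space_PiM prob_space_normal_density)

text \<open>Let success mean regret below \<open>r\<close>. Two members cannot both succeed after
  the same observations before batch \<open>m\<close>: their queries until its end agree, and their
  regrets there add up to at least \<open>2 * r\<close>. If each success had probability above 1/2,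
  the bound on the squared probabilities, averaged over the seed, would give card J / 2 <= 1 + s D +
  card J / 4, contrary to \<open>few\<close>.\<close>

lemma batch_bandit_lower_bound:
  fixes f :: "'j \<Rightarrow> 'x \<Rightarrow> real" and N :: "nat \<Rightarrow> nat"
  defines "s \<equiv> \<lambda>m. \<Sum>i<m. N i"
  assumes R: "R > 0" and J: "finite J" and mB: "m < B" and T: "s B = T"
    and pi: "\<And>t u h. \<pi> t u h \<in> X"
    and meas: "\<And>j. j \<in> J \<Longrightarrow>
      (\<lambda>(u, eps). regret \<pi> N X (f j) T u eps) \<in> borel_measurable (bandit_space R T)"
    and bdd: "\<And>j. j \<in> J \<Longrightarrow> bdd_above (f j ` X)"
    and sep: "\<And>j j' x. \<lbrakk>j \<in> J; j' \<in> J; j \<noteq> j'; x \<in> X\<rbrakk> \<Longrightarrow>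
      \<delta> \<le> ((SUP z\<in>X. f j z) - f j x) + ((SUP z\<in>X. f j' z) - f j' x)"
    and D: "\<And>x. x \<in> X \<Longrightarrow> (\<Sum>j\<in>J. exp ((f j x)\<^sup>2 / R\<^sup>2) - 1) \<le> D"
    and few: "4 * (1 + real (s m) * D) < card J"
    and r: "2 * r \<le> real (s (Suc m)) * \<delta>"
  shows "\<exists>j\<in>J. prob_space.prob (bandit_space R T)
    {(u, eps) \<in> space (bandit_space R T). regret \<pi> N X (f j) T u eps \<ge> r} \<ge> 1 / 2"
proof (rule ccontr)
  let ?B = "bandit_space R T"
  let ?U = "uniform_measure lborel {0..1::real}"
  let ?P = "PiM {..<T} (\<lambda>_. noise R)"
  interpret B: prob_space ?B by (rule prob_space_bandit_space[OF R])
  interpret U: prob_space ?U by (rule prob_space_unit_interval)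
  interpret P: prob_space ?P by (intro prob_space_PiM prob_space_normal_density R)
  assume contra: "\<not> ?thesis"
  define A where "A = (\<lambda>j. {w \<in> space ?B. (case w of (u, eps) \<Rightarrow> regret \<pi> N X (f j) T u eps) < r})"
  have Am: "A j \<in> sets ?B" if "j \<in> J" for j
    unfolding A_def using meas[OF that] by measurable
  have compl: "{(u, eps) \<in> space ?B. regret \<pi> N X (f j) T u eps \<ge> r} = space ?B - A j" for j
    by (auto simp: A_def)
  have PA: "B.prob (A j) > 1 / 2" if "j \<in> J" for j
    using contra that B.prob_compl[OF Am[OF that]] unfolding compl by force
  define E where "E = (\<lambda>u j. Pair u -` A j)"
  have Em: "E u j \<in> sets ?P" if "j \<in> J" for u j
    unfolding E_def using sets_Pair1[of "A j" ?U ?P u] Am[OF that] by (simp add: bandit_space_def)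
  define h where "h = (\<lambda>j u. measure ?P (E u j))"
  have ineq: "s m \<le> T" "s (Suc m) \<le> T"
    unfolding T[symmetric] s_def using mB by (intro sum_mono2; auto)+
  have excl: False
    if jj: "j \<in> J" "j' \<in> J" "j \<noteq> j'"
      and tr: "trajectory \<pi> N (f j) u e (s m) = trajectory \<pi> N (f j') u e' (s m)"
      and eE: "e \<in> E u j" "e' \<in> E u j'" for u j j' e e'
  proof -
    let ?x = "\<lambda>t. fst (trajectory \<pi> N (f j) u e T ! t)"
    have xX: "fst (trajectory \<pi> N (f i) u y T ! t) \<in> X" if "t < T" for i y t
      using that pi by (simp add: fst_trajectory_nth)
    have same: "fst (trajectory \<pi> N (f j') u e' T ! t) = ?x t" if "t < s (Suc m)" for t
      using query_determined_by_past_batches[of t N m T \<pi> "f j" u e "f j'" e'] that tr ineq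
      by (simp add: s_def)
    \<comment> \<open>Regret increments are nonnegative, so the regret up to the end of batch
      \<open>m\<close> is below the total regret.\<close>
    have lo: "(\<Sum>t<s (Suc m). (SUP z\<in>X. f i z) - f i (fst (trajectory \<pi> N (f i) u y T ! t))) < r"
      if "i \<in> J" "y \<in> E u i" for i y
    proof -
      have "(\<Sum>t<s (Suc m). (SUP z\<in>X. f i z) - f i (fst (trajectory \<pi> N (f i) u y T ! t)))
          \<le> regret \<pi> N X (f i) T u y"
        unfolding regret_def using ineq xX that by (intro sum_mono2) (auto intro!: cSUP_upper bdd)
      also have "\<dots> < r" using that by (auto simp: E_def A_def)
      finally show ?thesis .
    qed
    have "real (s (Suc m)) * \<delta> \<le> (\<Sum>t<s (Suc m). ((SUP z\<in>X. f j z) - f j (?x t)) + ((SUP z\<in>X. f j' z) - f j' (?x t)))"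
      using sep[OF jj] xX ineq by (intro sum_bounded_below[where A="{..<s (Suc m)}", simplified]) auto
    also have "\<dots> < r + r"
      unfolding sum.distrib using lo[OF jj(1) eE(1)] lo[OF jj(2) eE(2)] same
      by (intro add_strict_mono) auto
    finally show False using r by simp
  qed
  have fp0: "future_prob R T (E u j) 0 e = h j u" if "j \<in> J" for u j e
  proof -
    have "E u j \<subseteq> space ?P" using Em[OF that] sets.sets_into_space by blast
    then have "{z \<in> space ?P. splice 0 e z \<in> E u j} = E u j" by (auto simp: splice_def)
    then show ?thesis unfolding future_prob_def h_def by (simp add: lessThan_atLeast0)
  qed
  have sq: "(\<Sum>j\<in>J. (h j u)\<^sup>2) \<le> 1 + real (s m) * D" for u
  proof -
    have "(\<Sum>j\<in>J. (future_prob R T (E u j) 0 (\<lambda>_. 0))\<^sup>2) \<le> 1 + real (s m - 0) * D"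
      by (rule sum_sq_future_prob_le[OF R J ineq(1) Em pi D, where N=N and h="[]" and u=u])
         (auto dest: excl)
    then show ?thesis by (simp add: fp0)
  qed
  have lin: "(\<Sum>j\<in>J. h j u) \<le> 1 + real (s m) * D + card J / 4" for u
  proof -
    \<comment> \<open>This passes from squares to probabilities at a total cost of card J / 4, half
      of the card J / 2 that the assumption would force.\<close>
    have "h j u \<le> (h j u)\<^sup>2 + 1 / 4" for j
      using zero_le_power2[of "h j u - 1 / 2"] by (simp add: power2_eq_square algebra_simps)
    then have "(\<Sum>j\<in>J. h j u) \<le> (\<Sum>j\<in>J. (h j u)\<^sup>2 + 1 / 4)" by (rule sum_mono)
    then show ?thesis using sq[of u] by (simp add: sum.distrib)
  qed
  have hm: "h j \<in> borel_measurable ?U" if "j \<in> J" for j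
    using P.measurable_emeasure_Pair[of "A j" ?U] Am[OF that]
    unfolding h_def E_def measure_def bandit_space_def by measurable
  have hi: "integrable ?U (h j)" if "j \<in> J" for j
    by (rule U.integrable_const_bound[where B=1]) (use hm[OF that] in \<open>auto simp: h_def\<close>)
  have PAh: "B.prob (A j) = (\<integral>u. h j u \<partial>?U)" if "j \<in> J" for j
  proof -
    have "emeasure ?B (A j) = (\<integral>\<^sup>+ u. emeasure ?P (E u j) \<partial>?U)"
      using Am[OF that] unfolding bandit_space_def E_def
      by (rule P.emeasure_pair_measure_alt)
    also have "\<dots> = (\<integral>\<^sup>+ u. ennreal (h j u) \<partial>?U)"
      by (simp add: h_def P.emeasure_eq_measure)
    finally show ?thesis
      using hm[OF that] by (subst integral_eq_nn_integral) (auto simp: measure_def h_def)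
  qed
  have "card J / 2 = (\<Sum>j\<in>J. 1 / 2 :: real)" by simp
  also have "\<dots> \<le> (\<Sum>j\<in>J. B.prob (A j))" using PA by (intro sum_mono) (auto intro: less_imp_le)
  also have "\<dots> = (\<integral>u. (\<Sum>j\<in>J. h j u) \<partial>?U)" using hi by (simp add: PAh)
  also have "\<dots> \<le> (\<integral>u. 1 + real (s m) * D + card J / 4 \<partial>?U)"
    using hi lin by (intro integral_mono) auto
  also have "\<dots> = 1 + real (s m) * D + card J / 4" using U.prob_space by simp
  finally show False using few by simp
qed

section \<open>Finite kernel combinations and hard families\<close>

lemma pre_norm_pre_diff_self: "pre_norm k (pre_diff g g) = 0"
proof -
  have "(\<Sum>(b, q)\<leftarrow>pre_diff g g. a * b * k p q) = 0" for a p
    unfolding pre_diff_def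
    by (induction g) (auto simp: split_beta' comp_def algebra_simps sum_list_addf)
  then have "(\<Sum>(a, p)\<leftarrow>pre_diff g g. \<Sum>(b, q)\<leftarrow>pre_diff g g. a * b * k p q) = (\<Sum>(a, p)\<leftarrow>pre_diff g g. 0)"
    by (intro arg_cong[where f=sum_list] map_cong) auto
  also have "\<dots> = 0" by (induction "pre_diff g g") auto
  finally show ?thesis by (simp add: pre_norm_def)
qed

text \<open>A constant sequence of lists is the witness: its increments have norm zero, and the
  double sum is the squared norm of the list.\<close>

lemma rkhs_ball_finite_combination:
  fixes a :: "'s \<Rightarrow> real"
  assumes S: "finite S" "c ` S \<subseteq> X" and \<Psi>: "\<Psi> \<ge> 0"
    and norm: "(\<Sum>s\<in>S. \<Sum>t\<in>S. a s * a t * k (c s) (c t)) \<le> \<Psi>\<^sup>2"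
  shows "rkhs_ball k X \<Psi> (\<lambda>x. \<Sum>s\<in>S. a s * k (c s) x)"
proof -
  obtain xs where xs: "set xs = S" "distinct xs" using finite_distinct_list[OF S(1)] by blast
  define g where "g = map (\<lambda>s. (a s, c s)) xs"
  have ev: "pre_eval k g x = (\<Sum>s\<in>S. a s * k (c s) x)" for x
    unfolding pre_eval_def g_def xs(1)[symmetric] using xs(2)
    by (simp add: comp_def sum_list_distinct_conv_sum_set)
  have nr: "pre_norm k g = sqrt (\<Sum>s\<in>S. \<Sum>t\<in>S. a s * a t * k (c s) (c t))"
    unfolding pre_norm_def g_def xs(1)[symmetric] using xs(2)
    by (simp add: comp_def sum_list_distinct_conv_sum_set)
  have "pre_norm k g \<le> \<Psi>"
    unfolding nr using norm \<Psi> by (intro real_le_lsqrt) auto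
  moreover have "rkhs_has_norm k X (\<lambda>x. \<Sum>s\<in>S. a s * k (c s) x) (pre_norm k g)"
  proof -
    have "snd ` set g \<subseteq> X" using S(2) xs(1) by (auto simp: g_def)
    then show ?thesis
      unfolding rkhs_has_norm_def
      by (intro exI[of _ "\<lambda>_. g"]) (simp add: pre_norm_pre_diff_self ev)
  qed
  ultimately show ?thesis unfolding rkhs_ball_def by blast
qed

text \<open>\<open>\<delta>\<close> bounds the sum of two gaps, so no point is closer than
  \<open>\<delta> / 2\<close> to optimal for two members; \<open>V\<close> measures what one query
  can reveal about the whole family. The index type is that of multi-indices because both
  constructions choose bumps coordinate by coordinate.\<close>

definition hard_family ::
  "(real ^ 'd \<Rightarrow> real ^ 'd \<Rightarrow> real) \<Rightarrow> real \<Rightarrow> real \<Rightarrow> real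
    \<Rightarrow> ('d \<Rightarrow> nat) set \<Rightarrow> (('d \<Rightarrow> nat) \<Rightarrow> real ^ 'd \<Rightarrow> real) \<Rightarrow> bool" where
  "hard_family k \<Psi> \<delta> V J f \<longleftrightarrow> finite J \<and>
    (\<forall>j\<in>J. rkhs_ball k unit_cube \<Psi> (f j) \<and> bdd_above (f j ` unit_cube)) \<and>
    (\<forall>j\<in>J. \<forall>j'\<in>J. \<forall>x\<in>unit_cube. j \<noteq> j' \<longrightarrow>
      \<delta> \<le> ((SUP z\<in>unit_cube. f j z) - f j x) + ((SUP z\<in>unit_cube. f j' z) - f j' x)) \<and>
    (\<forall>x\<in>unit_cube. (\<Sum>j\<in>J. (f j x)\<^sup>2) \<le> V)"

lemma hard_familyD:
  assumes "hard_family k \<Psi> \<delta> V J f"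
  shows "finite J" "j \<in> J \<Longrightarrow> rkhs_ball k unit_cube \<Psi> (f j)" "j \<in> J \<Longrightarrow> bdd_above (f j ` unit_cube)"
    "j \<in> J \<Longrightarrow> j' \<in> J \<Longrightarrow> x \<in> unit_cube \<Longrightarrow> j \<noteq> j' \<Longrightarrow>
      \<delta> \<le> ((SUP z\<in>unit_cube. f j z) - f j x) + ((SUP z\<in>unit_cube. f j' z) - f j' x)"
    "x \<in> unit_cube \<Longrightarrow> (\<Sum>j\<in>J. (f j x)\<^sup>2) \<le> V"
  using assms unfolding hard_family_def by simp_all

lemma exp_minus_one_le: "0 \<le> u \<Longrightarrow> exp u - 1 \<le> u * exp (u::real)"
  using exp_ge_add_one_self[of "-u"] by (simp add: exp_minus field_simps)

text \<open>The thresholds \<open>a\<close> form a grid of times.  In the first batch whose end passes its threshold,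
  the previous batches were too short to identify a member of a family at scale \<open>\<delta> m\<close>, while
  the batch is long enough for a large regret at that scale.\<close>
lemma batch_regret_lower_boundI:
  fixes k :: "real ^ 'd \<Rightarrow> real ^ 'd \<Rightarrow> real" and R c :: real and T0 B :: nat
  assumes R: "R > 0" and B: "B \<ge> 1" and c: "c > 0"
    and scales: "\<And>T. T \<ge> T0 \<Longrightarrow> \<exists>a \<delta> V. a 0 = 0 \<and> a B \<le> real T \<and>
      (\<forall>m<B. 0 \<le> V m \<and> V m \<le> 1 \<and> 0 \<le> \<delta> m \<and> 2 * (c * rate T) \<le> a (Suc m) * \<delta> m \<and>
         (\<exists>J f. hard_family k \<Psi> (\<delta> m) (V m) J f \<and>
            4 * (1 + a m * (exp (1 / R\<^sup>2) / R\<^sup>2 * V m)) < real (card J)))"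
  shows "batch_regret_lower_bound k unit_cube \<Psi> R B rate"
  unfolding batch_regret_lower_bound_def
proof (rule exI[of _ c], rule conjI[OF c], rule exI[of _ T0], intro allI impI)
  fix T :: nat and N :: "nat \<Rightarrow> nat" and \<pi> :: "nat \<Rightarrow> real \<Rightarrow> ((real ^ 'd) \<times> real) list \<Rightarrow> real ^ 'd"
  assume T: "T0 \<le> T" and NT: "(\<Sum>i<B. N i) = T" and pi: "\<forall>t u h. \<pi> t u h \<in> unit_cube"
    and meas: "\<forall>f. rkhs_ball k unit_cube \<Psi> f \<longrightarrow>
      (\<lambda>(u, eps). regret \<pi> N unit_cube f T u eps) \<in> borel_measurable (bandit_space R T)"
  obtain a \<delta> V where a: "a 0 = 0" "a B \<le> real T" and
    sc: "\<And>m. m < B \<Longrightarrow> 0 \<le> V m \<and> V m \<le> 1 \<and> 0 \<le> \<delta> m \<and> 2 * (c * rate T) \<le> a (Suc m) * \<delta> m \<and>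
         (\<exists>J f. hard_family k \<Psi> (\<delta> m) (V m) J f \<and>
            4 * (1 + a m * (exp (1 / R\<^sup>2) / R\<^sup>2 * V m)) < real (card J))"
    using scales[OF T] by blast
  let ?s = "\<lambda>m. \<Sum>i<m. N i"
  define P where "P = (\<lambda>m. a (Suc m) \<le> real (?s (Suc m)))"
  have "P (B - 1)" using B a(2) NT unfolding P_def by simp
  \<comment> \<open>It exists because the last threshold is at most \<open>T\<close>. The preceding
    batch end missed its own threshold, so at most \<open>a m\<close> steps come before batch
    \<open>m\<close>; for \<open>m = 0\<close> this is \<open>a 0 = 0\<close>.\<close>
  define m where "m = (LEAST m. P m)"
  have Pm: "P m" unfolding m_def by (rule LeastI) fact
  have mB: "m < B" using Least_le[of P, OF \<open>P (B - 1)\<close>] B unfolding m_def by simp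
  have am: "real (?s m) \<le> a m"
  proof (cases m)
    case (Suc m')
    then have "\<not> P m'" using not_less_Least[of m' P] by (simp add: m_def)
    then show ?thesis by (simp add: P_def Suc)
  qed (use a in simp)
  define \<beta> where "\<beta> = exp (1 / R\<^sup>2) / R\<^sup>2 * V m"
  have \<beta>: "\<beta> \<ge> 0" using sc[OF mB] by (simp add: \<beta>_def)
  obtain J f where hf: "hard_family k \<Psi> (\<delta> m) (V m) J f" and card: "4 * (1 + a m * \<beta>) < real (card J)"
    using sc[OF mB] unfolding \<beta>_def by blast
  have D: "(\<Sum>j\<in>J. exp ((f j x)\<^sup>2 / R\<^sup>2) - 1) \<le> \<beta>" if x: "x \<in> unit_cube" for x
  proof -
    have fin: "finite J" and sum: "(\<Sum>j\<in>J. (f j x)\<^sup>2) \<le> V m" using hard_familyD[OF hf] x by auto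
    \<comment> \<open>Each square is at most \<open>V m\<close>, hence at most 1, and on that range
      exp - 1 lies below a linear function.\<close>
    have "exp ((f j x)\<^sup>2 / R\<^sup>2) - 1 \<le> (f j x)\<^sup>2 * (exp (1 / R\<^sup>2) / R\<^sup>2)" if j: "j \<in> J" for j
    proof -
      have "(f j x)\<^sup>2 \<le> (\<Sum>j\<in>J. (f j x)\<^sup>2)" using fin j by (intro member_le_sum) auto
      then have "(f j x)\<^sup>2 \<le> 1" using sum sc[OF mB] by linarith
      then have "(f j x)\<^sup>2 / R\<^sup>2 * exp ((f j x)\<^sup>2 / R\<^sup>2) \<le> (f j x)\<^sup>2 / R\<^sup>2 * exp (1 / R\<^sup>2)"
        using R by (intro mult_left_mono) (auto simp: divide_right_mono)
      then show ?thesis using exp_minus_one_le[of "(f j x)\<^sup>2 / R\<^sup>2"] by simp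
    qed
    then have "(\<Sum>j\<in>J. exp ((f j x)\<^sup>2 / R\<^sup>2) - 1) \<le> (\<Sum>j\<in>J. (f j x)\<^sup>2 * (exp (1 / R\<^sup>2) / R\<^sup>2))"
      by (rule sum_mono)
    also have "\<dots> \<le> V m * (exp (1 / R\<^sup>2) / R\<^sup>2)"
      unfolding sum_distrib_right[symmetric] using sum by (intro mult_right_mono) auto
    finally show ?thesis by (simp add: \<beta>_def mult.commute)
  qed
  have "\<exists>j\<in>J. prob_space.prob (bandit_space R T)
    {(u, eps) \<in> space (bandit_space R T). regret \<pi> N unit_cube (f j) T u eps \<ge> c * rate T} \<ge> 1 / 2"
  proof (rule batch_bandit_lower_bound[where D=\<beta> and \<delta>="\<delta> m" and m=m])
    have "4 * (1 + real (?s m) * \<beta>) \<le> 4 * (1 + a m * \<beta>)"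
      by (intro mult_left_mono add_left_mono mult_right_mono am \<beta>) simp
    then show "4 * (1 + real (?s m) * \<beta>) < real (card J)" using card by (rule le_less_trans)
    have "2 * (c * rate T) \<le> a (Suc m) * \<delta> m" using sc[OF mB] by simp
    also have "\<dots> \<le> real (?s (Suc m)) * \<delta> m"
      using Pm sc[OF mB] unfolding P_def by (intro mult_right_mono) auto
    finally show "2 * (c * rate T) \<le> real (?s (Suc m)) * \<delta> m" .
  next
    fix j assume j: "j \<in> J"
    show "(\<lambda>(u, eps). regret \<pi> N unit_cube (f j) T u eps) \<in> borel_measurable (bandit_space R T)"
      using hard_familyD(2)[OF hf j] meas by blast
    show "bdd_above (f j ` unit_cube)" by (rule hard_familyD(3)[OF hf j])
    fix j' and x :: "real ^ 'd" assume "j' \<in> J" "j \<noteq> j'" "x \<in> unit_cube"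
    then show "\<delta> m \<le> ((SUP z\<in>unit_cube. f j z) - f j x) + ((SUP z\<in>unit_cube. f j' z) - f j' x)"
      using hard_familyD(4)[OF hf j] by simp
  next
    show "finite J" by (rule hard_familyD(1)[OF hf])
  next
    show "\<pi> t u h \<in> unit_cube" for t u h using pi by blast
  qed (fact R mB NT D)+
  then obtain j where "j \<in> J" and "1 / 2 \<le> prob_space.prob (bandit_space R T)
    {(u, eps) \<in> space (bandit_space R T). regret \<pi> N unit_cube (f j) T u eps \<ge> c * rate T}" by blast
  moreover from this(1) have "rkhs_ball k unit_cube \<Psi> (f j)" by (rule hard_familyD(2)[OF hf])
  ultimately show "\<exists>f. rkhs_ball k unit_cube \<Psi> f \<and> 1 / 2 \<le> prob_space.prob (bandit_space R T)
      {(u, eps). (u, eps) \<in> space (bandit_space R T) \<and> c * rate T \<le> regret \<pi> N unit_cube f T u eps}"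
    by (intro exI[of _ "f j"] conjI)
qed

section \<open>Bump families for the SE kernel\<close>

text \<open>The squared modulus of the sum of exp (i k theta) over k < n. The factor 1 / n^2 makes
  the peak 1 and lets the n equispaced translates sum to 1.\<close>

definition fejer :: "nat \<Rightarrow> real \<Rightarrow> real" where
  "fejer n \<theta> = ((\<Sum>k<n. cos (real k * \<theta>))\<^sup>2 + (\<Sum>k<n. sin (real k * \<theta>))\<^sup>2) / (real n)\<^sup>2"

lemma fejer_nonneg: "0 \<le> fejer n \<theta>"
  by (simp add: fejer_def)

lemma fejer_0: "n > 0 \<Longrightarrow> fejer n 0 = 1"
  by (simp add: fejer_def)

lemma fejer_double_sum:
  "fejer n \<theta> = (\<Sum>k<n. \<Sum>l<n. cos ((real k - real l) * \<theta>)) / (real n)\<^sup>2"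
  unfolding fejer_def power2_eq_square[of "sum _ _"] sum_product
  by (simp add: sum.distrib[symmetric] cos_diff left_diff_distrib)

lemma fejer_minus_2pi: "fejer n (\<theta> - 2 * pi) = fejer n \<theta>"
proof -
  have "cos (real k * (\<theta> - 2 * pi)) = cos (real k * \<theta>)"
    "sin (real k * (\<theta> - 2 * pi)) = sin (real k * \<theta>)" for k
    using cos_int_2pin[of "int k"] sin_int_2pin[of "int k"]
    by (simp_all add: right_diff_distrib cos_diff sin_diff mult.commute mult.left_commute)
  then show ?thesis by (simp add: fejer_def)
qed

text \<open>Real part of a geometric sum in an n-th root of unity \<open>w\<close>; since n does not
  divide the frequency, \<open>w\<close> is not 1.\<close>

lemma sum_cos_equispaced:
  fixes m :: int
  assumes "m \<noteq> 0" "\<bar>m\<bar> < int n"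
  shows "(\<Sum>j<n. cos (m * (\<theta> - 2 * pi * real j / real n))) = 0"
proof -
  have n: "n > 0" using assms by auto
  define w where "w = cis (- (2 * pi * m / n))"
  have w1: "w \<noteq> 1"
  proof
    assume "w = 1"
    then have "cos (2 * pi * m / n) = 1" by (auto simp: w_def complex_eq_iff)
    then obtain i :: int where "2 * pi * m / n = real_of_int i * 2 * pi" unfolding cos_one_2pi_int by blast
    then have "real_of_int m = real_of_int (i * int n)" using n by (simp add: field_simps)
    then have "m = i * int n" by linarith
    with assms show False using n by (cases "i = 0") (auto simp: abs_mult)
  qed
  have wn: "w ^ n = 1"
  proof -
    have "real n * (- (2 * pi * m / n)) = 2 * pi * real_of_int (- m)" using n by (simp add: field_simps)
    then have "w ^ n = cis (2 * pi * real_of_int (- m))" unfolding w_def Complex.DeMoivre by simp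
    also have "\<dots> = 1" by (rule cis_multiple_2pi) auto
    finally show ?thesis .
  qed
  have "(\<Sum>j<n. cis (m * (\<theta> - 2 * pi * real j / real n))) = cis (m * \<theta>) * (\<Sum>j<n. w ^ j)"
    unfolding sum_distrib_left w_def Complex.DeMoivre cis_mult
    by (intro sum.cong refl arg_cong[where f=cis]) (simp add: field_simps)
  also have "(\<Sum>j<n. w ^ j) = 0" using w1 wn by (simp add: geometric_sum)
  finally have "Re (\<Sum>j<n. cis (m * (\<theta> - 2 * pi * real j / real n))) = 0" by simp
  then show ?thesis by simp
qed

text \<open>After summation over the translates only the pairs k = l survive: n pairs, each
  contributing n.\<close>

lemma sum_fejer:
  assumes n: "n > 0"
  shows "(\<Sum>j<n. fejer n (\<theta> - 2 * pi * real j / real n)) = 1"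
proof -
  have swap: "(\<Sum>j<n. \<Sum>k<n. \<Sum>l<n. g j k l) = (\<Sum>k<n. \<Sum>l<n. \<Sum>j<n. g j k l)"
    for g :: "nat \<Rightarrow> nat \<Rightarrow> nat \<Rightarrow> real"
    by (rule trans[OF sum.swap]) (intro sum.cong refl sum.swap)
  have "(\<Sum>j<n. fejer n (\<theta> - 2 * pi * real j / real n))
      = (\<Sum>k<n. \<Sum>l<n. \<Sum>j<n. cos ((real k - real l) * (\<theta> - 2 * pi * real j / real n))) / (real n)\<^sup>2"
    unfolding fejer_double_sum sum_divide_distrib[symmetric]
    by (subst swap) (rule refl)
  also have "\<dots> = (\<Sum>k<n. \<Sum>l<n. if l = k then real n else 0) / (real n)\<^sup>2"
  proof (intro arg_cong2[where f="(/)"] refl sum.cong)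
    fix k l assume "k \<in> {..<n}" "l \<in> {..<n}"
    then show "(\<Sum>j<n. cos ((real k - real l) * (\<theta> - 2 * pi * real j / real n)))
        = (if l = k then real n else 0)"
      using sum_cos_equispaced[of "int k - int l" n \<theta>] by auto
  qed
  also have "\<dots> = 1" using n by (simp add: power2_eq_square)
  finally show ?thesis .
qed

section \<open>Polynomials with controlled coefficient sums\<close>

text \<open>The coefficient sum is tracked because it becomes, up to a constant, that of a
  combination of kernel translates, where it bounds the RKHS norm: the SE kernel is at most
  1.\<close>

definition poly_l1 :: "real set \<Rightarrow> (real \<Rightarrow> real) \<Rightarrow> nat \<Rightarrow> real \<Rightarrow> (real \<Rightarrow> real) \<Rightarrow> bool" where
  "poly_l1 S q n A \<phi> \<longleftrightarrow>
    (\<exists>a. (\<Sum>i\<le>n. \<bar>a i\<bar>) \<le> A \<and> (\<forall>v\<in>S. \<phi> v = (\<Sum>i\<le>n. a i * q v ^ i)))"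

lemma poly_l1_mono:
  assumes "poly_l1 S q n A \<phi>" "n \<le> m" "A \<le> B"
  shows "poly_l1 S q m B \<phi>"
proof -
  obtain a where a: "(\<Sum>i\<le>n. \<bar>a i\<bar>) \<le> A" "\<forall>v\<in>S. \<phi> v = (\<Sum>i\<le>n. a i * q v ^ i)"
    using assms(1) by (auto simp: poly_l1_def)
  let ?b = "\<lambda>i. if i \<le> n then a i else 0"
  have "(\<Sum>i\<le>m. \<bar>?b i\<bar>) = (\<Sum>i\<le>n. \<bar>a i\<bar>)"
    using assms(2) by (intro sum.mono_neutral_cong_right) auto
  moreover have "(\<Sum>i\<le>m. ?b i * q v ^ i) = (\<Sum>i\<le>n. a i * q v ^ i)" for v
    using assms(2) by (intro sum.mono_neutral_cong_right) auto
  ultimately show ?thesis using a assms(3) unfolding poly_l1_def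
    by (intro exI[of _ ?b]) auto
qed

lemma poly_l1_lincomb:
  assumes "poly_l1 S q n A \<phi>" "poly_l1 S q n B \<psi>"
  shows "poly_l1 S q n (\<bar>c\<bar> * A + \<bar>d\<bar> * B) (\<lambda>v. c * \<phi> v + d * \<psi> v)"
proof -
  obtain a where a: "(\<Sum>i\<le>n. \<bar>a i\<bar>) \<le> A" "\<forall>v\<in>S. \<phi> v = (\<Sum>i\<le>n. a i * q v ^ i)"
    using assms(1) by (auto simp: poly_l1_def)
  obtain b where b: "(\<Sum>i\<le>n. \<bar>b i\<bar>) \<le> B" "\<forall>v\<in>S. \<psi> v = (\<Sum>i\<le>n. b i * q v ^ i)"
    using assms(2) by (auto simp: poly_l1_def)
  have "(\<Sum>i\<le>n. \<bar>c * a i + d * b i\<bar>) \<le> (\<Sum>i\<le>n. \<bar>c\<bar> * \<bar>a i\<bar> + \<bar>d\<bar> * \<bar>b i\<bar>)"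
    by (intro sum_mono order_trans[OF abs_triangle_ineq]) (simp add: abs_mult)
  also have "\<dots> \<le> \<bar>c\<bar> * A + \<bar>d\<bar> * B"
    unfolding sum.distrib sum_distrib_left[symmetric] using a b by (intro add_mono mult_left_mono) auto
  finally show ?thesis unfolding poly_l1_def using a b
    by (intro exI[of _ "\<lambda>i. c * a i + d * b i"])
       (auto simp: sum_distrib_left sum.distrib[symmetric] algebra_simps)
qed

lemma poly_l1_sum:
  assumes "finite I" "\<And>i. i \<in> I \<Longrightarrow> poly_l1 S q n A (\<phi> i)"
  shows "poly_l1 S q n ((\<Sum>i\<in>I. \<bar>c i\<bar>) * A) (\<lambda>v. \<Sum>i\<in>I. c i * \<phi> i v)"
  using assms
proof (induction I)
  case empty
  then show ?case unfolding poly_l1_def by (intro exI[of _ "\<lambda>_. 0"]) auto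
next
  case (insert i I)
  then have "poly_l1 S q n A (\<phi> i)" "poly_l1 S q n ((\<Sum>i\<in>I. \<bar>c i\<bar>) * A) (\<lambda>v. \<Sum>i\<in>I. c i * \<phi> i v)"
    by auto
  from poly_l1_lincomb[OF this, of "c i" 1] show ?case
    using insert by (simp add: algebra_simps)
qed

lemma poly_l1_mult:
  assumes "poly_l1 S q n A \<phi>"
  shows "poly_l1 S q (Suc n) A (\<lambda>v. q v * \<phi> v)"
proof -
  obtain a where a: "(\<Sum>i\<le>n. \<bar>a i\<bar>) \<le> A" "\<forall>v\<in>S. \<phi> v = (\<Sum>i\<le>n. a i * q v ^ i)"
    using assms(1) by (auto simp: poly_l1_def)
  then show ?thesis unfolding poly_l1_def
    by (intro exI[of _ "\<lambda>i. case i of 0 \<Rightarrow> 0 | Suc i \<Rightarrow> a i"])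
       (auto simp: sum.atMost_Suc_shift sum_distrib_left algebra_simps simp del: sum.atMost_Suc)
qed

text \<open>Chebyshev polynomials of (q - 1) / H. Each step of their three-term recurrence enlarges
  the coefficient bound by the factor 4 / H + 1.\<close>

lemma poly_l1_cos_multiple:
  assumes H: "H > 0" and cos: "\<And>v. v \<in> S \<Longrightarrow> cos (\<theta> v) = (q v - 1) / H"
  shows "poly_l1 S q m ((4 / H + 1) ^ m) (\<lambda>v. cos (real m * \<theta> v))"
proof (induction m rule: induct_nat_012)
  case 0
  show ?case unfolding poly_l1_def by (intro exI[of _ "\<lambda>_. 1"]) auto
next
  case 1
  have "\<forall>v\<in>S. cos (\<theta> v) = - (1 / H) + (1 / H) * q v" using cos by (auto simp: diff_divide_distrib)
  moreover have "1 / H + 1 / H \<le> 4 / H + 1" using H by (simp add: field_simps)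
  ultimately show ?case unfolding poly_l1_def using H
    by (intro exI[of _ "\<lambda>i. if i = 0 then - (1 / H) else 1 / H"]) auto
next
  case (ge2 m)
  let ?K = "4 / H + 1"
  define P where "P = ?K ^ Suc m"
  note ge2 = ge2[folded P_def]
  have K: "?K \<ge> 1" using H by simp
  have "poly_l1 S q (Suc (Suc m)) (\<bar>2 / H\<bar> * P + \<bar>- (2 / H)\<bar> * P)
     (\<lambda>v. 2 / H * (q v * cos (real (Suc m) * \<theta> v)) + - (2 / H) * cos (real (Suc m) * \<theta> v))"
    by (intro poly_l1_lincomb poly_l1_mult ge2(2)) (rule poly_l1_mono[OF ge2(2)], auto)
  from poly_l1_lincomb[OF this poly_l1_mono[OF ge2(1), of "Suc (Suc m)" "?K ^ m"], of 1 "-1"]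
  have "poly_l1 S q (Suc (Suc m)) (2 / H * P + 2 / H * P + ?K ^ m)
     (\<lambda>v. 2 / H * (q v * cos (real (Suc m) * \<theta> v)) + - (2 / H) * cos (real (Suc m) * \<theta> v)
          - cos (real m * \<theta> v))"
    using H by simp
  moreover have "2 / H * P + 2 / H * P + ?K ^ m \<le> ?K ^ Suc (Suc m)"
  proof -
    have "?K ^ m \<le> P" unfolding P_def using K by (intro power_increasing) auto
    then have "2 / H * P + 2 / H * P + ?K ^ m \<le> ?K * P" by (simp add: algebra_simps)
    then show ?thesis by (simp add: P_def)
  qed
  ultimately have *: "poly_l1 S q (Suc (Suc m)) (?K ^ Suc (Suc m))
     (\<lambda>v. 2 / H * (q v * cos (real (Suc m) * \<theta> v)) + - (2 / H) * cos (real (Suc m) * \<theta> v)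
          - cos (real m * \<theta> v))"
    using poly_l1_mono by blast
  have "cos (real (Suc (Suc m)) * \<theta> v) = 2 / H * (q v * cos (real (Suc m) * \<theta> v))
      + - (2 / H) * cos (real (Suc m) * \<theta> v) - cos (real m * \<theta> v)" if "v \<in> S" for v
  proof -
    have "cos (real (Suc (Suc m)) * \<theta> v) + cos (real m * \<theta> v) = 2 * cos (\<theta> v) * cos (real (Suc m) * \<theta> v)"
      using cos_times_cos[of "real (Suc m) * \<theta> v" "\<theta> v"] by (simp add: algebra_simps)
    then show ?thesis by (simp add: cos[OF that] diff_divide_distrib algebra_simps)
  qed
  with * show ?case unfolding poly_l1_def by simp
qed


text \<open>Completing the square: the Gaussian centred at i / n is the one centred at 0, times the
  i-th power of \<open>exp (v / (real n * l\<^sup>2))\<close>, times a constant. Undoing that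
  constant by \<open>w\<close> costs a bounded factor because the centres stay in [0,1].\<close>

lemma gaussian_poly_l1:
  fixes l :: real
  assumes n: "n > 0" and l: "l > 0"
    and \<phi>: "poly_l1 S (\<lambda>v. exp (v / (real n * l\<^sup>2))) n A \<phi>"
  obtains a where "(\<Sum>i\<le>n. \<bar>a i\<bar>) \<le> exp (1 / (2 * l\<^sup>2)) * A"
    "\<And>v. v \<in> S \<Longrightarrow> exp (- v\<^sup>2 / (2 * l\<^sup>2)) * \<phi> v
       = (\<Sum>i\<le>n. a i * exp (- (real i / real n - v)\<^sup>2 / (2 * l\<^sup>2)))"
proof -
  obtain b where b: "(\<Sum>i\<le>n. \<bar>b i\<bar>) \<le> A"
    "\<And>v. v \<in> S \<Longrightarrow> \<phi> v = (\<Sum>i\<le>n. b i * exp (v / (real n * l\<^sup>2)) ^ i)"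
    using \<phi> by (auto simp: poly_l1_def)
  define w where "w = (\<lambda>i. exp ((real i / real n)\<^sup>2 / (2 * l\<^sup>2)))"
  have "(\<Sum>i\<le>n. \<bar>b i * w i\<bar>) \<le> (\<Sum>i\<le>n. exp (1 / (2 * l\<^sup>2)) * \<bar>b i\<bar>)"
  proof (intro sum_mono)
    fix i assume "i \<in> {..n}"
    then have "(real i / real n)\<^sup>2 \<le> 1" using n by (intro power_le_one) auto
    then have "w i \<le> exp (1 / (2 * l\<^sup>2))" unfolding w_def by (simp add: divide_right_mono)
    then show "\<bar>b i * w i\<bar> \<le> exp (1 / (2 * l\<^sup>2)) * \<bar>b i\<bar>"
      by (simp add: abs_mult w_def mult.commute mult_left_mono)
  qed
  also have "\<dots> \<le> exp (1 / (2 * l\<^sup>2)) * A"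
    unfolding sum_distrib_left[symmetric] using b(1) by (intro mult_left_mono) auto
  finally have 1: "(\<Sum>i\<le>n. \<bar>b i * w i\<bar>) \<le> exp (1 / (2 * l\<^sup>2)) * A" .
  have "exp (- v\<^sup>2 / (2 * l\<^sup>2)) * \<phi> v
       = (\<Sum>i\<le>n. (b i * w i) * exp (- (real i / real n - v)\<^sup>2 / (2 * l\<^sup>2)))" if "v \<in> S" for v
    unfolding b(2)[OF that] sum_distrib_left
  proof (intro sum.cong refl)
    fix i
    have "- v\<^sup>2 / (2 * l\<^sup>2) + real i * (v / (real n * l\<^sup>2))
        = (real i / real n)\<^sup>2 / (2 * l\<^sup>2) + - (real i / real n - v)\<^sup>2 / (2 * l\<^sup>2)"
      using n l by (simp add: field_simps power2_eq_square)
    then have "exp (- v\<^sup>2 / (2 * l\<^sup>2)) * exp (v / (real n * l\<^sup>2)) ^ i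
        = w i * exp (- (real i / real n - v)\<^sup>2 / (2 * l\<^sup>2))"
      unfolding w_def exp_of_nat_mult[symmetric] exp_add[symmetric] by simp
    then show "exp (- v\<^sup>2 / (2 * l\<^sup>2)) * (b i * exp (v / (real n * l\<^sup>2)) ^ i)
        = b i * w i * exp (- (real i / real n - v)\<^sup>2 / (2 * l\<^sup>2))"
      by (simp add: mult.left_commute mult.assoc)
  qed
  with 1 show thesis by (rule that)
qed

section \<open>Bumps on the unit interval\<close>

text \<open>Nonnegativity and a total of at most 1, with \<open>\<tau>\<close> close to 1, keep two
  bumps from being near their peaks at the same point. All clauses are stable under products over
  coordinates, with \<open>A\<close> and \<open>\<tau>\<close> replaced by their powers.\<close>

definition gaussian_bumps ::
  "real \<Rightarrow> real \<Rightarrow> nat \<Rightarrow> real \<Rightarrow> nat set \<Rightarrow> (nat \<Rightarrow> nat \<Rightarrow> real) \<Rightarrow> bool" where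
  "gaussian_bumps l \<tau> n A J a \<longleftrightarrow>
    (let \<phi> = \<lambda>j v. \<Sum>i\<le>n. a j i * exp (- (real i / real n - v)\<^sup>2 / (2 * l\<^sup>2)) in
      (\<forall>j\<in>J. (\<Sum>i\<le>n. \<bar>a j i\<bar>) \<le> A) \<and> (\<forall>j\<in>J. \<forall>v\<in>{0..1}. 0 \<le> \<phi> j v) \<and>
      (\<forall>v\<in>{0..1}. (\<Sum>j\<in>J. \<phi> j v) \<le> 1) \<and> (\<forall>j\<in>J. \<exists>v\<in>{0..1}. \<tau> \<le> \<phi> j v))"

text \<open>Linear combinations of Gaussians on the grid \<open>i/n\<close> are the Gaussian centred at \<open>0\<close> times the
  polynomials in \<open>exp (v / (n l\<^sup>2))\<close>. Affinely rescaling that exponential to \<open>cos \<theta>\<close> turns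
  symmetrized Fejer kernels into such polynomials.\<close>
lemma gaussian_bumps_exist:
  fixes l \<tau> :: real
  assumes l: "l > 0" and \<tau>: "0 < \<tau>" "\<tau> < 1"
  shows "\<exists>c>0. \<forall>N>0. \<exists>J a. finite J \<and> c * real N \<le> real (card J) \<and>
    gaussian_bumps l \<tau> (4*N) (2 * exp (1 / (2 * l\<^sup>2)) * (16 * real N * l\<^sup>2 + 1) ^ (4*N)) J a"
proof -
  \<comment> \<open>A peak at angle cosine at most \<open>w0\<close> has v <= exp (1 / l^2) * w0;
    this choice keeps the Gaussian factor exp (- v^2 / (2 l^2)) there at least
    \<open>\<tau>\<close>.\<close>
  define w0 where "w0 = min 1 (sqrt (2 * l\<^sup>2 * (1 - \<tau>)) / exp (1 / l\<^sup>2))"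
  have w0: "0 < w0" "w0 \<le> 1" using \<tau> l by (auto simp: w0_def)
  show ?thesis
  proof (intro exI[of _ "2 * w0 / pi"] conjI allI impI)
    show "2 * w0 / pi > 0" using w0 by simp
  next
    fix N :: nat assume N: "N > 0"
    \<comment> \<open>With a multiple of 4 the node \<open>t N\<close> is exactly pi / 2, whose
      cosine 0 corresponds to v = 0.\<close>
    define n where "n = 4 * N"
    have n: "n > 0" using N by (simp add: n_def)
    define u where "u = 1 / (real n * l\<^sup>2)"
    have u: "u > 0" "u \<le> 1 / l\<^sup>2" using n l by (auto simp: u_def field_simps)
    define H where "H = exp u - 1"
    have Hu: "H \<ge> u" unfolding H_def using exp_ge_add_one_self[of u] by linarith
    then have H: "H > 0" using u by simp
    define q where "q = (\<lambda>v. exp (v / (real n * l\<^sup>2)))"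
    \<comment> \<open>The affine rescaling of the exponential that sends v = 0 to 0 and v = 1 to 1,
      so the angle stays in [0, pi / 2].\<close>
    define W where "W = (\<lambda>v. (q v - 1) / H)"
    have qu: "q v = exp (v * u)" for v by (simp add: q_def u_def)
    have W01: "0 \<le> W v \<and> W v \<le> 1" if "v \<in> {0..1}" for v
      using that u H by (auto simp: W_def qu H_def mult_left_le_one_le)
    define \<theta> where "\<theta> = (\<lambda>v. arccos (W v))"
    have cos\<theta>: "cos (\<theta> v) = (q v - 1) / H" if "v \<in> {0..1}" for v
      using W01[OF that] by (simp add: \<theta>_def W_def)
    define t where "t = (\<lambda>j. 2 * pi * real j / real n)"
    \<comment> \<open>Adding the mirror image leaves only cosines of multiples of the angle, which
      are polynomials in its cosine.\<close>
    define G where "G = (\<lambda>j v. fejer n (\<theta> v - t j) + fejer n (\<theta> v + t j))"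
    define r where "r = nat \<lfloor>2 * real N * w0 / pi\<rfloor>"
    have r: "real r \<le> 2 * real N * w0 / pi" "2 * real N * w0 / pi < real r + 1"
      using w0 by (auto simp: r_def)
    have "real r < real N"
    proof -
      have "2 * real N * w0 \<le> 2 * real N * 1" using w0 by (intro mult_left_mono) auto
      also have "\<dots> < real N * pi" using N pi_gt3 by simp
      finally have "2 * real N * w0 / pi < real N" by (simp add: field_simps)
      then show ?thesis using r by linarith
    qed
    then have rN: "r < N" by simp
    \<comment> \<open>The nodes within \<open>w0\<close> below pi / 2. Their cosines are small, so
      the peaks sit near v = 0, where the Gaussian envelope has hardly decayed; still they are a
      fixed fraction of all nodes.\<close>
    define J where "J = {N - r..N}"
    have fJ: "finite J" by (simp add: J_def)
    have cardJ: "card J = Suc r" using rN by (simp add: J_def)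
    have G_nonneg: "0 \<le> G j v" for j v by (simp add: G_def fejer_nonneg)
    have Gsum: "(\<Sum>j\<in>J. G j v) \<le> 1" for v
    proof -
      \<comment> \<open>By periodicity the mirror image of node j is node n - j. Original and
        mirrored nodes are disjoint, so the sum is a part of the full partition of unity.\<close>
      have refl: "fejer n (\<theta> v + t j) = fejer n (\<theta> v - t (n - j))" if "j \<in> J" for j
      proof -
        have "j \<le> n" using that by (simp add: J_def n_def)
        then have "\<theta> v - t (n - j) = (\<theta> v + t j) - 2 * pi"
          using n by (simp add: t_def of_nat_diff field_simps)
        then show ?thesis by (simp only: fejer_minus_2pi)
      qed
      have inj: "inj_on (\<lambda>j. n - j) J" by (auto simp: inj_on_def J_def n_def)
      have disj: "J \<inter> (\<lambda>j. n - j) ` J = {}" using N by (auto simp: J_def n_def)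
      have sub: "J \<union> (\<lambda>j. n - j) ` J \<subseteq> {..<n}" using rN by (auto simp: J_def n_def)
      have "(\<Sum>j\<in>J. G j v) = (\<Sum>j\<in>J \<union> (\<lambda>j. n - j) ` J. fejer n (\<theta> v - t j))"
        using disj fJ by (simp add: G_def sum.distrib refl sum.union_disjoint sum.reindex[OF inj] comp_def)
      also have "\<dots> \<le> (\<Sum>j<n. fejer n (\<theta> v - t j))"
        using sub by (intro sum_mono2) (auto simp: fejer_nonneg)
      also have "\<dots> = 1" using sum_fejer[OF n] by (simp add: t_def)
      finally show ?thesis .
    qed
    have Gpoly: "poly_l1 {0..1} q n (2 * (4 / H + 1) ^ n) (G j)" for j
    proof -
      define m where "m = (\<lambda>k l. if l \<le> k then k - l else l - k :: nat)"
      have cm: "cos ((real k - real l) * x) = cos (real (m k l) * x)" for k l x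
      proof (cases "l \<le> k")
        case False
        then have "(real k - real l) * x = - (real (m k l) * x)"
          by (simp add: m_def of_nat_diff algebra_simps)
        then show ?thesis by (simp only: cos_minus)
      qed (simp add: m_def of_nat_diff)
      have "G j v = (\<Sum>(k, l)\<in>{..<n}\<times>{..<n}. 2 * cos (real (m k l) * t j) / (real n)\<^sup>2 * cos (real (m k l) * \<theta> v))" for v
      proof -
        have "G j v = (\<Sum>(k, l)\<in>{..<n}\<times>{..<n}. (cos (real (m k l) * (\<theta> v - t j)) + cos (real (m k l) * (\<theta> v + t j))) / (real n)\<^sup>2)"
          unfolding G_def fejer_double_sum cm
          by (simp add: sum.cartesian_product sum.distrib add_divide_distrib sum_divide_distrib split_beta')
        also have "\<dots> = (\<Sum>(k, l)\<in>{..<n}\<times>{..<n}. 2 * cos (real (m k l) * t j) / (real n)\<^sup>2 * cos (real (m k l) * \<theta> v))"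
          by (intro sum.cong refl) (auto simp: distrib_left right_diff_distrib cos_add cos_diff)
        finally show ?thesis .
      qed
      then have Geq: "G j = (\<lambda>v. \<Sum>p\<in>{..<n}\<times>{..<n}. 2 * cos (real (m (fst p) (snd p)) * t j) / (real n)\<^sup>2
            * cos (real (m (fst p) (snd p)) * \<theta> v))"
        by (simp add: fun_eq_iff split_beta')
      have "poly_l1 {0..1} q n ((\<Sum>p\<in>{..<n}\<times>{..<n}. \<bar>2 * cos (real (m (fst p) (snd p)) * t j) / (real n)\<^sup>2\<bar>) * (4 / H + 1) ^ n) (G j)"
        unfolding Geq
      proof (rule poly_l1_sum)
        fix p assume "p \<in> {..<n}\<times>{..<n}"
        then have "m (fst p) (snd p) \<le> n" by (auto simp: m_def)
        then show "poly_l1 {0..1} q n ((4 / H + 1) ^ n) (\<lambda>v. cos (real (m (fst p) (snd p)) * \<theta> v))"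
          using H by (intro poly_l1_mono[OF poly_l1_cos_multiple[OF H cos\<theta>]] power_increasing) auto
      qed simp
      moreover have "(\<Sum>p\<in>{..<n}\<times>{..<n}. \<bar>2 * cos (real (m (fst p) (snd p)) * t j) / (real n)\<^sup>2\<bar>)
          \<le> (\<Sum>p\<in>{..<n}\<times>{..<n}. 2 / (real n)\<^sup>2)"
        by (intro sum_mono) (auto simp: abs_mult divide_right_mono)
      then have "(\<Sum>p\<in>{..<n}\<times>{..<n}. \<bar>2 * cos (real (m (fst p) (snd p)) * t j) / (real n)\<^sup>2\<bar>) \<le> 2"
        using n by (simp add: power2_eq_square)
      then have "(\<Sum>p\<in>{..<n}\<times>{..<n}. \<bar>2 * cos (real (m (fst p) (snd p)) * t j) / (real n)\<^sup>2\<bar>) * (4 / H + 1) ^ n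
          \<le> 2 * (4 / H + 1) ^ n" using H by (intro mult_right_mono) auto
      ultimately show ?thesis by (rule poly_l1_mono[OF _ order_refl])
    qed
    have "\<exists>a. \<forall>j. (\<Sum>i\<le>n. \<bar>a j i\<bar>) \<le> exp (1 / (2 * l\<^sup>2)) * (2 * (4 / H + 1) ^ n) \<and>
       (\<forall>v\<in>{0..1}. exp (- v\<^sup>2 / (2 * l\<^sup>2)) * G j v
         = (\<Sum>i\<le>n. a j i * exp (- (real i / real n - v)\<^sup>2 / (2 * l\<^sup>2))))"
    proof (intro choice allI)
      fix j
      show "\<exists>a. (\<Sum>i\<le>n. \<bar>a i\<bar>) \<le> exp (1 / (2 * l\<^sup>2)) * (2 * (4 / H + 1) ^ n) \<and>
       (\<forall>v\<in>{0..1}. exp (- v\<^sup>2 / (2 * l\<^sup>2)) * G j v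
         = (\<Sum>i\<le>n. a i * exp (- (real i / real n - v)\<^sup>2 / (2 * l\<^sup>2))))"
        by (rule gaussian_poly_l1[OF n l Gpoly[of j, unfolded q_def]]) (intro exI conjI ballI)
    qed
    then obtain a where a0: "\<forall>j. (\<Sum>i\<le>n. \<bar>a j i\<bar>) \<le> exp (1 / (2 * l\<^sup>2)) * (2 * (4 / H + 1) ^ n) \<and>
       (\<forall>v\<in>{0..1}. exp (- v\<^sup>2 / (2 * l\<^sup>2)) * G j v
         = (\<Sum>i\<le>n. a j i * exp (- (real i / real n - v)\<^sup>2 / (2 * l\<^sup>2))))" ..
    have a: "\<And>j. (\<Sum>i\<le>n. \<bar>a j i\<bar>) \<le> exp (1 / (2 * l\<^sup>2)) * (2 * (4 / H + 1) ^ n)"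
      "\<And>j v. v \<in> {0..1} \<Longrightarrow> (\<Sum>i\<le>n. a j i * exp (- (real i / real n - v)\<^sup>2 / (2 * l\<^sup>2)))
         = exp (- v\<^sup>2 / (2 * l\<^sup>2)) * G j v"
      using a0 by simp_all
    \<comment> \<open>\<open>H\<close> is at least 1 / (n l^2), so the base of the Chebyshev bound
      is only linear in \<open>N\<close>; this yields the cost exp (O (N log N)).\<close>
    have "4 / H \<le> 4 / u" using Hu u by (intro divide_left_mono) auto
    also have "\<dots> = 16 * real N * l\<^sup>2" using N l by (simp add: u_def n_def)
    finally have "(4 / H + 1) ^ n \<le> (16 * real N * l\<^sup>2 + 1) ^ n" using H by (intro power_mono) auto
    then have "exp (1 / (2 * l\<^sup>2)) * (2 * (4 / H + 1) ^ n) \<le> 2 * exp (1 / (2 * l\<^sup>2)) * (16 * real N * l\<^sup>2 + 1) ^ n"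
      by simp
    then have abound: "(\<Sum>i\<le>n. \<bar>a j i\<bar>) \<le> 2 * exp (1 / (2 * l\<^sup>2)) * (16 * real N * l\<^sup>2 + 1) ^ n" for j
      using a(1)[of j] by linarith
    have sum1: "(\<Sum>j\<in>J. \<Sum>i\<le>n. a j i * exp (- (real i / real n - v)\<^sup>2 / (2 * l\<^sup>2))) \<le> 1" if v: "v \<in> {0..1}" for v
    proof -
      have "(\<Sum>j\<in>J. \<Sum>i\<le>n. a j i * exp (- (real i / real n - v)\<^sup>2 / (2 * l\<^sup>2))) = exp (- v\<^sup>2 / (2 * l\<^sup>2)) * (\<Sum>j\<in>J. G j v)"
        unfolding a(2)[OF v] sum_distrib_left ..
      also have "\<dots> \<le> 1" using Gsum by (intro mult_le_one) (auto intro!: sum_nonneg G_nonneg)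
      finally show ?thesis .
    qed
    have peak: "\<exists>v\<in>{0..1}. \<tau> \<le> (\<Sum>i\<le>n. a j i * exp (- (real i / real n - v)\<^sup>2 / (2 * l\<^sup>2)))" if j: "j \<in> J" for j
    proof -
      define y where "y = cos (t j)"
      have tj: "pi / 2 - t j = pi * (real N - real j) / (2 * real N)"
        using N by (simp add: t_def n_def field_simps)
      have jN: "0 \<le> real N - real j" "real N - real j \<le> real r"
        using j rN by (auto simp: J_def)
      have s0: "0 \<le> pi / 2 - t j" unfolding tj using jN by simp
      have "pi / 2 - t j \<le> pi * real r / (2 * real N)"
        unfolding tj using jN by (intro divide_right_mono mult_left_mono) auto
      also have "\<dots> \<le> w0" using r(1) N by (simp add: field_simps)
      finally have s1: "pi / 2 - t j \<le> w0" .
      have t0: "0 \<le> t j" by (simp add: t_def)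
      have y: "0 \<le> y" "y \<le> w0"
      proof -
        have "y = sin (pi / 2 - t j)" by (simp add: y_def sin_diff)
        then show "0 \<le> y" "y \<le> w0" using s0 s1 t0 sin_x_le_x[OF s0] by (auto intro!: sin_ge_zero)
      qed
      \<comment> \<open>The solution of W v = cos (t j): the angle at \<open>v\<close> is the node
        itself, where the first Fejer term is 1.\<close>
      define v where "v = ln (1 + H * y) / u"
      have Hy: "0 \<le> H * y" using H y by simp
      have v0: "0 \<le> v" using Hy u by (simp add: v_def)
      have "H * y \<le> H" using y w0 H by (intro mult_left_le) auto
      moreover have "1 + H = exp u" by (simp add: H_def)
      ultimately have "1 + H * y \<le> exp u" by linarith
      then have "ln (1 + H * y) \<le> u" using Hy by (metis add_pos_nonneg ln_exp ln_le_cancel_iff exp_gt_zero zero_less_one)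
      then have v1: "v \<le> 1" using u by (simp add: v_def)
      have Wv: "W v = y" using Hy u H by (simp add: W_def qu v_def)
      have "\<theta> v = t j" unfolding \<theta>_def Wv y_def using t0 s0 pi_gt_zero by (intro arccos_cos) auto
      then have G1: "1 \<le> G j v" using fejer_0[OF n] fejer_nonneg[of n "t j + t j"] by (simp add: G_def)
      have "ln (1 + H * y) \<le> H * y" by (rule ln_add_one_self_le_self[OF Hy])
      also have "\<dots> \<le> (u * exp u) * w0"
      proof (intro mult_mono)
        show "H \<le> u * exp u" using exp_minus_one_le[of u] u by (simp add: H_def)
      qed (use y u in auto)
      finally have "v \<le> exp u * w0" using u by (simp add: v_def field_simps)
      also have "\<dots> \<le> exp (1 / l\<^sup>2) * (sqrt (2 * l\<^sup>2 * (1 - \<tau>)) / exp (1 / l\<^sup>2))"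
        using u w0 by (intro mult_mono) (auto simp: w0_def)
      finally have "v \<le> sqrt (2 * l\<^sup>2 * (1 - \<tau>))" by simp
      then have "v\<^sup>2 \<le> (sqrt (2 * l\<^sup>2 * (1 - \<tau>)))\<^sup>2" using v0 by (rule power_mono)
      also have "\<dots> = 2 * l\<^sup>2 * (1 - \<tau>)" using \<tau> by simp
      finally have "v\<^sup>2 / (2 * l\<^sup>2) \<le> 1 - \<tau>" using l by (simp add: field_simps)
      then have "\<tau> \<le> exp (- v\<^sup>2 / (2 * l\<^sup>2))" using exp_ge_add_one_self[of "- v\<^sup>2 / (2 * l\<^sup>2)"] by simp
      also have "\<dots> \<le> exp (- v\<^sup>2 / (2 * l\<^sup>2)) * G j v" using G1 by simp
      finally show ?thesis using a(2)[of v j] v0 v1 by (intro bexI[of _ v]) auto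
    qed
    have c: "2 * w0 / pi * real N \<le> real (card J)" using r(2) by (simp add: cardJ mult.commute mult.left_commute)
    have nn: "0 \<le> (\<Sum>i\<le>n. a j i * exp (- (real i / real n - v)\<^sup>2 / (2 * l\<^sup>2)))" if "v \<in> {0..1}" for v j
      unfolding a(2)[OF that] using G_nonneg by simp
    have "gaussian_bumps l \<tau> n (2 * exp (1 / (2 * l\<^sup>2)) * (16 * real N * l\<^sup>2 + 1) ^ n) J a"
      unfolding gaussian_bumps_def Let_def using abound nn sum1 peak by blast
    with c fJ show "\<exists>J a. finite J \<and> 2 * w0 / pi * real N \<le> real (card J) \<and>
        gaussian_bumps l \<tau> (4*N) (2 * exp (1 / (2 * l\<^sup>2)) * (16 * real N * l\<^sup>2 + 1) ^ (4*N)) J a"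
      unfolding n_def[symmetric] by blast
  qed
qed

section \<open>Products of bumps on the cube\<close>

lemma k_SE_eq_prod:
  "k_SE l x y = (\<Prod>i\<in>UNIV. exp (- (x $ i - y $ i)\<^sup>2 / (2 * l\<^sup>2)))"
proof -
  have "(norm (x - y))\<^sup>2 = (\<Sum>i\<in>UNIV. (x $ i - y $ i)\<^sup>2)"
    unfolding power2_norm_eq_inner inner_vec_def by (simp add: power2_eq_square)
  then show ?thesis
    by (simp add: k_SE_def exp_sum[symmetric] sum_negf sum_divide_distrib)
qed

text \<open>The product bumps, scaled by eps, are nonnegative with sum at most eps, and
  \<open>\<tau>\<close> is chosen so that each peak is at least 3 eps / 4. Two gaps at one point
  then add up to at least 2 * 3 eps / 4 - eps = eps / 2, and f^2 <= eps * f bounds the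
  squares.\<close>

lemma se_hard_family:
  fixes l \<Psi> :: real
  assumes l: "l > 0" and \<Psi>: "\<Psi> > 0"
  shows "\<exists>c>0. \<forall>N>0. \<forall>\<epsilon>>0.
    \<epsilon> * (2 * exp (1 / (2 * l\<^sup>2)) * (16 * real N * l\<^sup>2 + 1) ^ (4*N)) ^ CARD('d) \<le> \<Psi> \<longrightarrow>
    (\<exists>J f. hard_family (k_SE l :: real ^ 'd \<Rightarrow> real ^ 'd \<Rightarrow> real) \<Psi> (\<epsilon> / 2) (\<epsilon>\<^sup>2) J f \<and>
      (c * real N) ^ CARD('d) \<le> real (card J))"
proof -
  define \<tau> :: real where "\<tau> = (3 / 4) powr (1 / CARD('d))"
  have \<tau>: "0 < \<tau>" "\<tau> < 1" "\<tau> ^ CARD('d) = 3 / 4"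
    using powr_less_mono'[of "3/4::real" 0 "1 / CARD('d)"]
    by (simp_all add: \<tau>_def powr_realpow[symmetric] powr_powr)
  obtain c where c: "c > 0" and bumps: "\<forall>N>0. \<exists>J a. finite J \<and> c * real N \<le> real (card J) \<and>
    gaussian_bumps l \<tau> (4*N) (2 * exp (1 / (2 * l\<^sup>2)) * (16 * real N * l\<^sup>2 + 1) ^ (4*N)) J a"
    using gaussian_bumps_exist[OF l \<tau>(1,2)] by (elim exE conjE)
  show ?thesis
  proof (rule exI[of _ c], intro conjI[OF c] allI impI)
    fix N :: nat and \<epsilon> :: real
    define n where "n = 4 * N"
    define A where "A = 2 * exp (1 / (2 * l\<^sup>2)) * (16 * real N * l\<^sup>2 + 1) ^ n"
    assume N: "N > 0" and \<epsilon>: "\<epsilon> > 0"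
      and small: "\<epsilon> * (2 * exp (1 / (2 * l\<^sup>2)) * (16 * real N * l\<^sup>2 + 1) ^ (4*N)) ^ CARD('d) \<le> \<Psi>"
    note small = small[folded n_def, folded A_def]
    obtain J1 a where J1: "finite J1" "c * real N \<le> real (card J1)"
      and fam: "gaussian_bumps l \<tau> n A J1 a"
      using bumps[rule_format, OF N] unfolding n_def[symmetric] A_def[symmetric] by (elim exE conjE)
    define \<phi> where "\<phi> = (\<lambda>j v. \<Sum>i\<le>n. a j i * exp (- (real i / real n - v)\<^sup>2 / (2 * l\<^sup>2)))"
    have fam': "(\<forall>j\<in>J1. (\<Sum>i\<le>n. \<bar>a j i\<bar>) \<le> A) \<and> (\<forall>j\<in>J1. \<forall>v\<in>{0..1}. 0 \<le> \<phi> j v) \<and>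
      (\<forall>v\<in>{0..1}. (\<Sum>j\<in>J1. \<phi> j v) \<le> 1) \<and> (\<forall>j\<in>J1. \<exists>v\<in>{0..1}. \<tau> \<le> \<phi> j v)"
      using fam unfolding gaussian_bumps_def Let_def \<phi>_def .
    note a1 = fam'[THEN conjunct1, THEN bspec]
      and nn = fam'[THEN conjunct2, THEN conjunct1, THEN bspec, THEN bspec]
      and sum1 = fam'[THEN conjunct2, THEN conjunct2, THEN conjunct1, THEN bspec]
      and peak = fam'[THEN conjunct2, THEN conjunct2, THEN conjunct2, THEN bspec]
    define J :: "('d \<Rightarrow> nat) set" where "J = PiE UNIV (\<lambda>_. J1)"
    define f :: "('d \<Rightarrow> nat) \<Rightarrow> real ^ 'd \<Rightarrow> real" where "f = (\<lambda>j x. \<epsilon> * (\<Prod>i\<in>UNIV. \<phi> (j i) (x $ i)))"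
    have finJ: "finite J" unfolding J_def using J1 by (intro finite_PiE) auto
    have jJ: "j i \<in> J1" if "j \<in> J" for j i using that by (auto simp: J_def)
    have cube: "x $ i \<in> {0..1}" if "x \<in> unit_cube" for x :: "real ^ 'd" and i
      using that by (auto simp: unit_cube_def)
    have fnn: "0 \<le> f j x" if "j \<in> J" "x \<in> unit_cube" for j x
      unfolding f_def
      using \<epsilon> nn[OF jJ[OF that(1)] cube[OF that(2)]] by (intro mult_nonneg_nonneg prod_nonneg) auto
    have fsum: "(\<Sum>j\<in>J. f j x) \<le> \<epsilon>" if x: "x \<in> unit_cube" for x
    proof -
      have "(\<Sum>j\<in>J. f j x) = \<epsilon> * (\<Prod>i\<in>UNIV. \<Sum>j\<in>J1. \<phi> j (x $ i))"
        unfolding f_def sum_distrib_left[symmetric] J_def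
        by (subst prod_sum_PiE) (use J1 in auto)
      also have "\<dots> \<le> \<epsilon> * 1"
        using \<epsilon> sum_nonneg[OF nn[OF _ cube[OF x]]] sum1[OF cube[OF x]]
        by (intro mult_left_mono prod_le_1) auto
      finally show ?thesis by simp
    qed
    have fle: "f j x \<le> \<epsilon>" if "j \<in> J" "x \<in> unit_cube" for j x
      using member_le_sum[of j J "\<lambda>j. f j x"] fsum[OF that(2)] fnn that finJ by force
    have bdd: "bdd_above (f j ` unit_cube)" if "j \<in> J" for j
      using fle[OF that] by (intro bdd_aboveI[of _ \<epsilon>]) auto
    have sup: "3 / 4 * \<epsilon> \<le> (SUP z\<in>unit_cube. f j z)" if j: "j \<in> J" for j
    proof -
      have "\<forall>i. \<exists>v\<in>{0..1}. \<tau> \<le> \<phi> (j i) v" using peak jJ[OF j] by blast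
      then obtain v where v: "\<And>i. v i \<in> {0..1}" "\<And>i. \<tau> \<le> \<phi> (j i) (v i)" by metis
      define x :: "real ^ 'd" where "x = (\<chi> i. v i)"
      have x: "x \<in> unit_cube" using v(1) by (auto simp: x_def unit_cube_def)
      have "3 / 4 = (\<Prod>i\<in>(UNIV :: 'd set). \<tau>)" by (simp add: \<tau>)
      also have "\<dots> \<le> (\<Prod>i\<in>UNIV. \<phi> (j i) (x $ i))"
        using v(2) \<tau> by (intro prod_mono) (auto simp: x_def)
      finally have "\<epsilon> * (3 / 4) \<le> f j x" unfolding f_def using \<epsilon> by (intro mult_left_mono) auto
      also have "\<dots> \<le> (SUP z\<in>unit_cube. f j z)" by (rule cSUP_upper[OF x bdd[OF j]])
      finally show ?thesis by simp
    qed
    have rkhs: "rkhs_ball (k_SE l) unit_cube \<Psi> (f j)" if j: "j \<in> J" for j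
    proof -
      define S :: "('d \<Rightarrow> nat) set" where "S = PiE UNIV (\<lambda>_. {..n})"
      define b where "b = (\<lambda>s :: 'd \<Rightarrow> nat. \<epsilon> * (\<Prod>i\<in>UNIV. a (j i) (s i)))"
      define p :: "('d \<Rightarrow> nat) \<Rightarrow> real ^ 'd" where "p = (\<lambda>s. \<chi> i. real (s i) / real n)"
      have finS: "finite S" unfolding S_def by (intro finite_PiE) auto
      have eq: "f j = (\<lambda>x. \<Sum>s\<in>S. b s * k_SE l (p s) x)"
      proof
        fix x
        show "f j x = (\<Sum>s\<in>S. b s * k_SE l (p s) x)"
          unfolding f_def \<phi>_def S_def b_def k_SE_eq_prod p_def
          by (subst prod_sum_PiE) (auto simp: sum_distrib_left prod.distrib mult.assoc)
      qed
      have "(\<Sum>s\<in>S. \<bar>b s\<bar>) = \<epsilon> * (\<Prod>i\<in>UNIV. \<Sum>k\<le>n. \<bar>a (j i) k\<bar>)"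
        unfolding S_def b_def
        by (subst prod_sum_PiE) (use \<epsilon> in \<open>auto simp: sum_distrib_left abs_mult abs_prod\<close>)
      also have "\<dots> \<le> \<epsilon> * (\<Prod>i\<in>(UNIV :: 'd set). A)"
        using \<epsilon> a1 jJ[OF j] by (intro mult_left_mono prod_mono) (auto intro: sum_nonneg)
      also have "\<dots> \<le> \<Psi>" using small by simp
      finally have bS: "(\<Sum>s\<in>S. \<bar>b s\<bar>) \<le> \<Psi>" .
      \<comment> \<open>Kernel values are at most 1, so the norm is bounded by the coefficient sum,
        which factors over the coordinates.\<close>
      have "(\<Sum>s\<in>S. \<Sum>t\<in>S. b s * b t * k_SE l (p s) (p t)) \<le> (\<Sum>s\<in>S. \<Sum>t\<in>S. \<bar>b s\<bar> * \<bar>b t\<bar>)"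
      proof (intro sum_mono)
        fix s t
        have "b s * b t * k_SE l (p s) (p t) \<le> \<bar>b s * b t * k_SE l (p s) (p t)\<bar>" by simp
        also have "\<dots> \<le> \<bar>b s\<bar> * \<bar>b t\<bar>" by (simp add: abs_mult k_SE_def mult_left_le)
        finally show "b s * b t * k_SE l (p s) (p t) \<le> \<bar>b s\<bar> * \<bar>b t\<bar>" .
      qed
      also have "\<dots> = (\<Sum>s\<in>S. \<bar>b s\<bar>)\<^sup>2" by (simp add: power2_eq_square sum_product)
      also have "\<dots> \<le> \<Psi>\<^sup>2" using bS by (intro power_mono) (auto intro: sum_nonneg)
      finally have norm: "(\<Sum>s\<in>S. \<Sum>t\<in>S. b s * b t * k_SE l (p s) (p t)) \<le> \<Psi>\<^sup>2" .
      have "p ` S \<subseteq> unit_cube"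
      proof
        fix x assume "x \<in> p ` S"
        then obtain s where s: "s \<in> S" "x = p s" by blast
        have "real (s i) \<le> real n" for i using s(1) by (auto simp: S_def)
        then show "x \<in> unit_cube" using N by (auto simp: s(2) p_def unit_cube_def n_def)
      qed
      then show ?thesis unfolding eq
        by (intro rkhs_ball_finite_combination finS norm) (use \<Psi> in auto)
    qed
    have sep: "\<epsilon> / 2 \<le> ((SUP z\<in>unit_cube. f j z) - f j x) + ((SUP z\<in>unit_cube. f j' z) - f j' x)"
      if jj: "j \<in> J" "j' \<in> J" "x \<in> unit_cube" "j \<noteq> j'" for j j' x
    proof -
      have "f j x + f j' x = (\<Sum>i\<in>{j, j'}. f i x)" using jj by simp
      also have "\<dots> \<le> (\<Sum>i\<in>J. f i x)" using jj finJ fnn by (intro sum_mono2) auto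
      finally show ?thesis using fsum[OF jj(3)] sup[OF jj(1)] sup[OF jj(2)] by linarith
    qed
    have sq: "(\<Sum>j\<in>J. (f j x)\<^sup>2) \<le> \<epsilon>\<^sup>2" if x: "x \<in> unit_cube" for x
    proof -
      have "(\<Sum>j\<in>J. (f j x)\<^sup>2) \<le> (\<Sum>j\<in>J. \<epsilon> * f j x)"
        unfolding power2_eq_square using fnn fle x by (intro sum_mono mult_right_mono) auto
      also have "\<dots> \<le> \<epsilon> * \<epsilon>" unfolding sum_distrib_left[symmetric] using fsum[OF x] \<epsilon> by simp
      finally show ?thesis by (simp add: power2_eq_square)
    qed
    have "card J = card J1 ^ CARD('d)" unfolding J_def by (subst card_PiE) auto
    then have "(c * real N) ^ CARD('d) \<le> real (card J)" using J1 c by (simp add: power_mono)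
    moreover have "hard_family (k_SE l) \<Psi> (\<epsilon> / 2) (\<epsilon>\<^sup>2) J f"
      unfolding hard_family_def by (intro conjI ballI impI finJ rkhs bdd sep sq)
    ultimately show "\<exists>J f. hard_family (k_SE l :: real ^ 'd \<Rightarrow> real ^ 'd \<Rightarrow> real) \<Psi> (\<epsilon> / 2) (\<epsilon>\<^sup>2) J f \<and>
      (c * real N) ^ CARD('d) \<le> real (card J)" by blast
  qed
qed

section \<open>Bump families for the Matern kernel\<close>

lemma lborel_set_integral_eq_integral:
  fixes f :: "real \<Rightarrow> real"
  assumes "f absolutely_integrable_on S" "S \<in> sets borel" "f \<in> borel_measurable borel"
  shows "(LINT t:S|lborel. f t) = integral S f"
proof -
  have "(\<lambda>t. indicator S t *\<^sub>R f t) \<in> borel_measurable lborel"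
    using assms by measurable
  from integral_completion[OF this] show ?thesis
    using set_lebesgue_integral_eq_integral(2)[OF assms(1)]
    by (simp add: set_lebesgue_integral_def)
qed

lemma has_integral_remove_point:
  fixes f :: "real \<Rightarrow> real"
  assumes "(f has_integral y) S" "T \<subseteq> S" "S - T \<subseteq> {x}"
  shows "(f has_integral y) T"
proof (rule has_integral_spike_set_eq[THEN iffD1, OF _ _ assms(1)])
  show "negligible {t \<in> S - T. f t \<noteq> 0}"
    by (rule negligible_subset[of "{x}"]) (use assms(3) in auto)
  show "negligible {t \<in> T - S. f t \<noteq> 0}"
    by (rule negligible_subset[of "{x}"]) (use assms(2) in auto)
qed

lemma Gamma_integral_real_greaterThan:
  assumes "(\<nu> :: real) > 0"
  shows "((\<lambda>t. t powr (\<nu> - 1) / exp t) has_integral Gamma \<nu>) {0<..}"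
  using Gamma_integral_real[OF assms] by (rule has_integral_remove_point[where x=0]) auto

lemma gamma_gaussian_absolutely_integrable:
  fixes \<nu> a :: real
  assumes "\<nu> > 0" "a \<ge> 0"
  shows "(\<lambda>t. t powr (\<nu> - 1) * exp (- t) * exp (- a / t)) absolutely_integrable_on {0<..}"
proof (rule measurable_bounded_by_integrable_imp_absolutely_integrable)
  show "(\<lambda>t. t powr (\<nu> - 1) * exp (- t) * exp (- a / t)) \<in> borel_measurable (lebesgue_on {0<..})"
    by (intro continuous_imp_measurable_on_sets_lebesgue continuous_intros) auto
  show "(\<lambda>t. t powr (\<nu> - 1) / exp t) integrable_on {0<..}"
    using Gamma_integral_real_greaterThan[OF assms(1)] by blast
  fix t :: real assume t: "t \<in> {0<..}"
  then have "exp (- a / t) \<le> 1" using assms by simp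
  then show "norm (t powr (\<nu> - 1) * exp (- t) * exp (- a / t)) \<le> t powr (\<nu> - 1) / exp t"
    by (simp add: abs_mult exp_minus divide_inverse mult_left_le)
qed auto

text \<open>The substitution t = (z / 2) exp s turns the integrand into a multiple of exp (- z cosh
  s) exp (nu s). Since \<open>besselK\<close> integrates over s >= 0 only, the half-line is cut at z
  / 2 and the lower part reflected; the factors exp (nu s) and exp (- nu s) add up to 2 cosh (nu
  s).\<close>

lemma besselK_has_integral:
  fixes \<nu> z :: real
  assumes \<nu>: "\<nu> > 0" and z: "z > 0"
  shows "((\<lambda>t. t powr (\<nu> - 1) * exp (- t) * exp (- (z\<^sup>2 / 4) / t)) has_integral
      2 * (z / 2) powr \<nu> * besselK \<nu> z) {0<..}"
proof -
  define h where "h = (\<lambda>t. t powr (\<nu> - 1) * exp (- t) * exp (- (z\<^sup>2 / 4) / t))"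
  have ai: "h absolutely_integrable_on {0<..}"
    unfolding h_def by (rule gamma_gaussian_absolutely_integrable) (use \<nu> in auto)
  have ev: "(z / 2 * exp s) * h (z / 2 * exp s) = (z / 2) powr \<nu> * (exp (- z * cosh s) * exp (\<nu> * s))" for s
  proof -
    have "(z / 2 * exp s) * (z / 2 * exp s) powr (\<nu> - 1) = (z / 2 * exp s) powr \<nu>"
      using z powr_mult_base[of "z / 2 * exp s" "\<nu> - 1"] by simp
    also have "\<dots> = (z / 2) powr \<nu> * exp (\<nu> * s)"
      using z by (subst powr_mult) (auto simp: powr_def[of "exp s"])
    finally have 1: "(z / 2 * exp s) * (z / 2 * exp s) powr (\<nu> - 1) = (z / 2) powr \<nu> * exp (\<nu> * s)" .
    have "- (z / 2 * exp s) + - (z\<^sup>2 / 4) / (z / 2 * exp s) = - z * cosh s"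
      using z by (simp add: cosh_def field_simps power2_eq_square exp_minus)
    then have 2: "exp (- (z / 2 * exp s)) * exp (- (z\<^sup>2 / 4) / (z / 2 * exp s)) = exp (- z * cosh s)"
      unfolding exp_add[symmetric] by simp
    have "(z / 2 * exp s) * h (z / 2 * exp s) = ((z / 2 * exp s) * (z / 2 * exp s) powr (\<nu> - 1)) *
        (exp (- (z / 2 * exp s)) * exp (- (z\<^sup>2 / 4) / (z / 2 * exp s)))"
      by (simp add: h_def)
    then show ?thesis unfolding 1 2 by simp
  qed
  have img1: "(\<lambda>s. z / 2 * exp s) ` {0..} = {z / 2..}"
  proof (intro equalityI subsetI)
    fix t assume "t \<in> {z / 2..}"
    then have "t = z / 2 * exp (ln (t / (z / 2)))" "0 \<le> ln (t / (z / 2))" using z by (auto simp: ln_ge_zero)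
    then show "t \<in> (\<lambda>s. z / 2 * exp s) ` {0..}" by blast
  qed (use z in auto)
  have img2: "(\<lambda>s. z / 2 * exp (- s)) ` {0..} = {0<..z / 2}"
  proof (intro equalityI subsetI)
    fix t assume "t \<in> {0<..z / 2}"
    then have "t = z / 2 * exp (- (- ln (t / (z / 2))))" "0 \<le> - ln (t / (z / 2))" using z by (auto simp: ln_le_zero_iff)
    then show "t \<in> (\<lambda>s. z / 2 * exp (- s)) ` {0..}" by blast
  qed (use z in auto)
  have ai1: "h absolutely_integrable_on {z / 2..}" and ai2: "h absolutely_integrable_on {0<..z / 2}"
    using z by (auto intro: set_integrable_subset[OF ai])
  define F1 where "F1 = (\<lambda>s. (z / 2) powr \<nu> * (exp (- z * cosh s) * exp (\<nu> * s)))"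
  define F2 where "F2 = (\<lambda>s. (z / 2) powr \<nu> * (exp (- z * cosh s) * exp (- (\<nu> * s))))"
  have 1: "F1 absolutely_integrable_on {0..} \<and> integral {0..} F1 = integral {z / 2..} h"
  proof -
    have "(\<lambda>s. \<bar>z / 2 * exp s\<bar> * h (z / 2 * exp s)) absolutely_integrable_on {0..} \<and>
      integral {0..} (\<lambda>s. \<bar>z / 2 * exp s\<bar> * h (z / 2 * exp s)) = integral {z / 2..} h"
      by (subst has_absolute_integral_change_of_variables_1')
         (use z ai1 img1 in \<open>auto intro!: derivative_eq_intros simp: inj_on_def\<close>)
    moreover have eq: "(\<lambda>s. \<bar>z / 2 * exp s\<bar> * h (z / 2 * exp s)) = F1"
      using z ev by (auto simp: F1_def abs_mult)
    ultimately show ?thesis unfolding eq by blast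
  qed
  have 2: "F2 absolutely_integrable_on {0..} \<and> integral {0..} F2 = integral {0<..z / 2} h"
  proof -
    have "(\<lambda>s. \<bar>- (z / 2 * exp (- s))\<bar> * h (z / 2 * exp (- s))) absolutely_integrable_on {0..} \<and>
      integral {0..} (\<lambda>s. \<bar>- (z / 2 * exp (- s))\<bar> * h (z / 2 * exp (- s))) = integral {0<..z / 2} h"
      by (subst has_absolute_integral_change_of_variables_1')
         (use z ai2 img2 in \<open>auto intro!: derivative_eq_intros simp: inj_on_def\<close>)
    moreover have eq: "(\<lambda>s. \<bar>- (z / 2 * exp (- s))\<bar> * h (z / 2 * exp (- s))) = F2"
      using z ev[of "- s" for s] by (auto simp: F2_def abs_mult)
    ultimately show ?thesis unfolding eq by blast
  qed
  define b where "b = (\<lambda>s. exp (- z * cosh s) * cosh (\<nu> * s))"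
  have bF: "b = (\<lambda>s. (F1 s + F2 s) * (1 / (2 * (z / 2) powr \<nu>)))"
    using z by (auto simp: b_def F1_def F2_def cosh_def field_simps fun_eq_iff)
  have bai: "b absolutely_integrable_on {0..}"
    unfolding bF by (intro set_integrable_mult_left set_integral_add) (use 1 2 in auto)
  have "besselK \<nu> z = integral {0..} b"
    unfolding besselK_def b_def[symmetric]
    by (rule lborel_set_integral_eq_integral[OF bai]) (auto simp: b_def cosh_def)
  also have "\<dots> = (integral {0..} F1 + integral {0..} F2) * (1 / (2 * (z / 2) powr \<nu>))"
    unfolding bF using 1 2
    by (simp add: Henstock_Kurzweil_Integration.integral_add set_lebesgue_integral_eq_integral(1))
  finally have K: "2 * (z / 2) powr \<nu> * besselK \<nu> z = integral {0<..z / 2} h + integral {z / 2..} h"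
    using z 1 2 by simp
  have "(h has_integral (integral {0<..z / 2} h + integral {z / 2..} h)) ({0<..z / 2} \<union> {z / 2..})"
    using ai1 ai2 by (intro has_integral_Un integrable_integral set_lebesgue_integral_eq_integral(1))
      (auto intro: negligible_subset[of "{z / 2}"])
  also have "{0<..z / 2} \<union> {z / 2..} = {0<..}" using z by auto
  finally show ?thesis unfolding K h_def .
qed

text \<open>With z = sqrt (2 nu) r / l the exponent z^2 / 4 is nu r^2 / (2 l^2). Estimates for
  combinations of Matern kernels thereby reduce to estimates for the same combinations of Gaussians
  at each fixed \<open>t\<close>.\<close>

lemma matern_has_integral:
  fixes \<nu> l :: real and x y :: "real ^ 'd"
  assumes \<nu>: "\<nu> > 0" and l: "l > 0"
  shows "((\<lambda>t. t powr (\<nu> - 1) * exp (- t) * exp (- (\<nu> / (2 * l\<^sup>2) * (norm (x - y))\<^sup>2) / t))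
    has_integral Gamma \<nu> * k_matern \<nu> l x y) {0<..}"
proof (cases "x = y")
  case True
  have "(\<lambda>t. t powr (\<nu> - 1) * exp (- t) * exp (- (\<nu> / (2 * l\<^sup>2) * (norm (x - y))\<^sup>2) / t))
      = (\<lambda>t. t powr (\<nu> - 1) / exp t)"
    using True by (auto simp: exp_minus field_simps)
  moreover have "Gamma \<nu> * k_matern \<nu> l x y = Gamma \<nu>" using True by (simp add: k_matern_def)
  ultimately show ?thesis using Gamma_integral_real_greaterThan[OF \<nu>] by (simp only:)
next
  case False
  define z where "z = sqrt (2 * \<nu>) * norm (x - y) / l"
  have z: "z > 0" using False \<nu> l by (simp add: z_def)
  have z2: "z\<^sup>2 / 4 = \<nu> / (2 * l\<^sup>2) * (norm (x - y))\<^sup>2"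
    using \<nu> by (simp add: z_def power_mult_distrib power_divide)
  have "Gamma \<nu> > 0" using \<nu> by (rule Gamma_real_pos)
  then have "Gamma \<nu> * k_matern \<nu> l x y = 2 powr (1 - \<nu>) * z powr \<nu> * besselK \<nu> z"
    using False by (simp add: k_matern_def z_def)
  also have "\<dots> = 2 * (z / 2) powr \<nu> * besselK \<nu> z"
    using z by (simp add: powr_diff powr_divide)
  finally show ?thesis using besselK_has_integral[OF \<nu> z] unfolding z2 by simp
qed

section \<open>Finite differences of Gaussians\<close>

lemma power_times_exp_minus_le:
  fixes u :: real
  assumes "u \<ge> 0"
  shows "u ^ n * exp (- u) \<le> fact n"
proof -
  have "u ^ n / fact n \<le> exp u"
    using sum_le_suminf[OF summable_exp[of u], of "{n}"] assms
    by (simp add: exp_def divide_inverse mult.commute)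
  then show ?thesis by (simp add: exp_minus field_simps)
qed

text \<open>Half of the Gaussian is spent on the polynomial and the other half is kept as
  decay.\<close>

lemma poly_times_gaussian_bounded:
  fixes p :: "real poly"
  shows "\<exists>C. \<forall>x. \<bar>poly p x * exp (- x\<^sup>2)\<bar> \<le> C * exp (- x\<^sup>2 / 2)"
proof -
  have mon: "\<bar>x\<bar> ^ i * exp (- x\<^sup>2 / 2) \<le> 1 + 2 ^ i * fact i" for x :: real and i
  proof -
    have "\<bar>x\<bar> ^ i \<le> 1 + (x\<^sup>2) ^ i"
    proof (cases "\<bar>x\<bar> \<le> 1")
      case True
      then have "\<bar>x\<bar> ^ i \<le> 1" by (intro power_le_one) auto
      moreover have "0 \<le> (x\<^sup>2) ^ i" by simp
      ultimately show ?thesis by linarith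
    next
      case False
      then have "\<bar>x\<bar> ^ i \<le> \<bar>x\<bar> ^ (2 * i)" by (intro power_increasing) auto
      also have "\<dots> = (x\<^sup>2) ^ i" by (simp add: power_mult)
      finally show ?thesis by linarith
    qed
    then have "\<bar>x\<bar> ^ i * exp (- x\<^sup>2 / 2) \<le> (1 + (x\<^sup>2) ^ i) * exp (- x\<^sup>2 / 2)"
      by (intro mult_right_mono) auto
    also have "\<dots> = exp (- x\<^sup>2 / 2) + 2 ^ i * ((x\<^sup>2 / 2) ^ i * exp (- (x\<^sup>2 / 2)))"
      by (simp add: power_divide algebra_simps)
    also have "\<dots> \<le> 1 + 2 ^ i * fact i"
      by (intro add_mono mult_left_mono power_times_exp_minus_le) auto
    finally show ?thesis .
  qed
  show ?thesis
  proof (intro exI allI)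
    fix x :: real
    have "\<bar>poly p x\<bar> \<le> (\<Sum>i\<le>degree p. \<bar>coeff p i\<bar> * \<bar>x\<bar> ^ i)"
      unfolding poly_altdef by (rule order_trans[OF sum_abs]) (simp add: abs_mult power_abs)
    then have "\<bar>poly p x\<bar> * exp (- x\<^sup>2 / 2) \<le> (\<Sum>i\<le>degree p. \<bar>coeff p i\<bar> * \<bar>x\<bar> ^ i) * exp (- x\<^sup>2 / 2)"
      by (intro mult_right_mono) auto
    also have "\<dots> \<le> (\<Sum>i\<le>degree p. \<bar>coeff p i\<bar> * (1 + 2 ^ i * fact i))"
      unfolding sum_distrib_right mult.assoc by (intro sum_mono mult_left_mono mon) auto
    finally have "\<bar>poly p x\<bar> * exp (- x\<^sup>2 / 2) * exp (- x\<^sup>2 / 2)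
        \<le> (\<Sum>i\<le>degree p. \<bar>coeff p i\<bar> * (1 + 2 ^ i * fact i)) * exp (- x\<^sup>2 / 2)"
      by (intro mult_right_mono) auto
    then show "\<bar>poly p x * exp (- x\<^sup>2)\<bar> \<le> (\<Sum>i\<le>degree p. \<bar>coeff p i\<bar> * (1 + 2 ^ i * fact i)) * exp (- x\<^sup>2 / 2)"
      by (simp add: abs_mult mult.assoc exp_add[symmetric])
  qed
qed

text \<open>The Hermite polynomials up to sign: the n-th derivative of exp (- x^2) is this
  polynomial times exp (- x^2).\<close>

primrec gauss_deriv_poly :: "nat \<Rightarrow> real poly" where
  "gauss_deriv_poly 0 = 1"
| "gauss_deriv_poly (Suc n) = pderiv (gauss_deriv_poly n) - [:0, 2:] * gauss_deriv_poly n"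

lemma gauss_deriv:
  "((\<lambda>x. poly (gauss_deriv_poly n) x * exp (- x\<^sup>2)) has_real_derivative
    poly (gauss_deriv_poly (Suc n)) x * exp (- x\<^sup>2)) (at x)"
  by (auto intro!: derivative_eq_intros poly_DERIV simp: algebra_simps)

text \<open>The n-fold forward difference; each further differencing contributes one mean value
  step. \<open>\<bar>c 0\<bar> = 1\<close> is carried along because it later keeps the norm of the
  stencil away from zero (\<open>gaussian_gram_ge_half\<close>).\<close>

lemma difference_stencil:
  "\<exists>c :: nat \<Rightarrow> real. \<bar>c 0\<bar> = 1 \<and> (\<forall>f x \<delta>. \<delta> > 0 \<longrightarrow>
     (\<forall>m<n. \<forall>y. (f m has_real_derivative f (Suc m) y) (at y)) \<longrightarrow>
     (\<exists>\<xi>. x \<le> \<xi> \<and> \<xi> \<le> x + real n * \<delta> \<and> (\<Sum>a\<le>n. c a * f 0 (x + real a * \<delta>)) = \<delta> ^ n * f n \<xi>))"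
proof (induction n)
  case 0
  show ?case by (rule exI[of _ "\<lambda>_. 1"]) auto
next
  case (Suc n)
  then obtain c where c0: "\<bar>c 0\<bar> = (1::real)" and c: "\<And>f x \<delta>. \<delta> > 0 \<Longrightarrow>
     (\<forall>m<n. \<forall>y. (f m has_real_derivative f (Suc m) y) (at y)) \<Longrightarrow>
     (\<exists>\<xi>. x \<le> \<xi> \<and> \<xi> \<le> x + real n * \<delta> \<and> (\<Sum>a\<le>n. c a * f 0 (x + real a * \<delta>)) = \<delta> ^ n * f n \<xi>)"
    by auto
  define c' where "c' = (\<lambda>a. (if a = 0 then 0 else c (a - 1)) - (if a \<le> n then c a else 0))"
  show ?case
  proof (intro exI[of _ c'] conjI allI impI)
    show "\<bar>c' 0\<bar> = 1" using c0 by (simp add: c'_def)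
    fix f :: "nat \<Rightarrow> real \<Rightarrow> real" and x \<delta> :: real
    assume \<delta>: "\<delta> > 0" and f: "\<forall>m<Suc n. \<forall>y. (f m has_real_derivative f (Suc m) y) (at y)"
    have shift: "((\<lambda>y. f m (y + \<delta>)) has_real_derivative f (Suc m) (y + \<delta>)) (at y)" if "m < n" for m y
      using f that DERIV_shift[of "f m" "f (Suc m) (y + \<delta>)" y \<delta>] by simp
    define g where "g = (\<lambda>m y. f m (y + \<delta>) - f m y)"
    have "\<forall>m<n. \<forall>y. (g m has_real_derivative g (Suc m) y) (at y)"
      unfolding g_def using f shift by (auto intro!: DERIV_diff)
    from c[OF \<delta> this, of x] obtain \<xi> where \<xi>: "x \<le> \<xi>" "\<xi> \<le> x + real n * \<delta>"
      "(\<Sum>a\<le>n. c a * g 0 (x + real a * \<delta>)) = \<delta> ^ n * g n \<xi>" by blast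
    obtain \<zeta> where \<zeta>: "\<xi> < \<zeta>" "\<zeta> < \<xi> + \<delta>" "f n (\<xi> + \<delta>) - f n \<xi> = (\<xi> + \<delta> - \<xi>) * f (Suc n) \<zeta>"
      using MVT2[of \<xi> "\<xi> + \<delta>" "f n" "f (Suc n)"] \<delta> f by auto
    have "(\<Sum>a\<le>Suc n. c' a * f 0 (x + real a * \<delta>))
        = (\<Sum>a\<le>Suc n. (if a = 0 then 0 else c (a - 1)) * f 0 (x + real a * \<delta>))
          - (\<Sum>a\<le>Suc n. (if a \<le> n then c a else 0) * f 0 (x + real a * \<delta>))"
      by (simp add: c'_def left_diff_distrib sum_subtractf)
    also have "(\<Sum>a\<le>Suc n. (if a = 0 then 0 else c (a - 1)) * f 0 (x + real a * \<delta>))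
        = (\<Sum>a\<le>n. c a * f 0 (x + real a * \<delta> + \<delta>))"
      by (subst sum.atMost_Suc_shift) (simp add: algebra_simps)
    also have "(\<Sum>a\<le>Suc n. (if a \<le> n then c a else 0) * f 0 (x + real a * \<delta>))
        = (\<Sum>a\<le>n. c a * f 0 (x + real a * \<delta>))"
      by simp
    finally have "(\<Sum>a\<le>Suc n. c' a * f 0 (x + real a * \<delta>)) = (\<Sum>a\<le>n. c a * g 0 (x + real a * \<delta>))"
      by (simp add: g_def right_diff_distrib sum_subtractf)
    also have "\<dots> = \<delta> ^ Suc n * f (Suc n) \<zeta>"
      using \<xi>(3) \<zeta>(3) by (simp add: g_def)
    finally show "\<exists>\<xi>. x \<le> \<xi> \<and> \<xi> \<le> x + real (Suc n) * \<delta> \<and>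
        (\<Sum>a\<le>Suc n. c' a * f 0 (x + real a * \<delta>)) = \<delta> ^ Suc n * f (Suc n) \<xi>"
      using \<xi> \<zeta> by (intro exI[of _ \<zeta>]) (auto simp: algebra_simps)
  qed
qed

text \<open>\<open>s\<close> is the squared distance orthogonal to the stencil. With Y = w^2 + v^2 +
  s, smoothness at scale sqrt t gives (w^2 / t)^q, which is the claim for t > Y. For t <= Y the
  Gaussian tail turns this into (w^2 / Y)^q when the distance dominates w; otherwise w^2 / Y is
  bounded below and the sum of the coefficients is a sufficient bound.\<close>

lemma gaussian_stencil_bound:
  fixes \<kappa> :: real and q :: nat
  assumes \<kappa>: "\<kappa> > 0"
  shows "\<exists>c C. \<bar>c 0\<bar> = 1 \<and> C > 0 \<and> (\<forall>v s t w. t > 0 \<longrightarrow> w > 0 \<longrightarrow> s \<ge> 0 \<longrightarrow>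
    \<bar>exp (- (\<kappa> * s) / t) * (\<Sum>a\<le>2*q. c a * exp (- (\<kappa> * (v + real a * w)\<^sup>2) / t))\<bar>
      \<le> C * (w\<^sup>2 / (w\<^sup>2 + v\<^sup>2 + s)) ^ q * (if t \<le> w\<^sup>2 + v\<^sup>2 + s then 1 else ((w\<^sup>2 + v\<^sup>2 + s) / t) ^ q))"
proof -
  obtain c :: "nat \<Rightarrow> real" where c0: "\<bar>c 0\<bar> = 1" and c: "\<And>f x \<delta>. \<delta> > 0 \<Longrightarrow>
     (\<And>m y. m < 2*q \<Longrightarrow> (f m has_real_derivative f (Suc m) y) (at y)) \<Longrightarrow>
     (\<exists>\<xi>. x \<le> \<xi> \<and> \<xi> \<le> x + real (2*q) * \<delta> \<and> (\<Sum>a\<le>2*q. c a * f 0 (x + real a * \<delta>)) = \<delta> ^ (2*q) * f (2*q) \<xi>)"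
    using difference_stencil[of "2*q"] by blast
  define G where "G = (\<lambda>n x. poly (gauss_deriv_poly n) x * exp (- x\<^sup>2))"
  obtain C1 where C1: "\<And>x. \<bar>G (2*q) x\<bar> \<le> C1 * exp (- x\<^sup>2 / 2)"
    using poly_times_gaussian_bounded[of "gauss_deriv_poly (2*q)"] by (auto simp: G_def)
  have C1nn: "0 \<le> C1" using C1[of 0] by (simp add: order_trans[OF abs_ge_zero])
  define A where "A = (\<Sum>a\<le>2*q. \<bar>c a\<bar>)"
  have A: "0 \<le> A" by (simp add: A_def sum_nonneg)
  define C where "C = C1 * \<kappa> ^ q + C1 * 16 ^ q * fact q + A * (1 + 16 * (real q)\<^sup>2) ^ q + 1"
  have parts: "0 \<le> C1 * \<kappa> ^ q" "0 \<le> C1 * 16 ^ q * fact q" "0 \<le> A * (1 + 16 * (real q)\<^sup>2) ^ q"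
    using C1nn \<kappa> A by auto
  have C: "C1 * \<kappa> ^ q \<le> C" "C1 * 16 ^ q * fact q \<le> C" "A * (1 + 16 * (real q)\<^sup>2) ^ q \<le> C" "0 < C"
    using parts unfolding C_def by linarith+
  have main: "\<bar>exp (- (\<kappa> * s) / t) * (\<Sum>a\<le>2*q. c a * exp (- (\<kappa> * (v + real a * w)\<^sup>2) / t))\<bar>
      \<le> C * (w\<^sup>2 / (w\<^sup>2 + v\<^sup>2 + s)) ^ q * (if t \<le> w\<^sup>2 + v\<^sup>2 + s then 1 else ((w\<^sup>2 + v\<^sup>2 + s) / t) ^ q)"
    if t: "t > 0" and w: "w > 0" and s: "s \<ge> 0" for v s t w :: real
  proof -
    define D where "D = exp (- (\<kappa> * s) / t) * (\<Sum>a\<le>2*q. c a * exp (- (\<kappa> * (v + real a * w)\<^sup>2) / t))"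
    define Y where "Y = w\<^sup>2 + v\<^sup>2 + s"
    have Y: "Y > 0" using w s by (simp add: Y_def add_pos_nonneg)
    \<comment> \<open>Rescales to the fixed Gaussian exp (- x^2); further below,
      \<open>\<theta>\<close> is the intermediate point in the original units.\<close>
    define r where "r = sqrt (\<kappa> / t)"
    have r: "r > 0" "r\<^sup>2 = \<kappa> / t" using \<kappa> t by (auto simp: r_def)
    have "\<exists>\<xi>. r * v \<le> \<xi> \<and> \<xi> \<le> r * v + real (2*q) * (r * w) \<and>
      (\<Sum>a\<le>2*q. c a * G 0 (r * v + real a * (r * w))) = (r * w) ^ (2*q) * G (2*q) \<xi>"
      by (rule c) (use r w gauss_deriv in \<open>auto simp: G_def\<close>)
    then obtain \<xi> where \<xi>: "r * v \<le> \<xi>" "\<xi> \<le> r * v + real (2*q) * (r * w)"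
      and eq: "(\<Sum>a\<le>2*q. c a * G 0 (r * v + real a * (r * w))) = (r * w) ^ (2*q) * G (2*q) \<xi>" by blast
    have G0: "G 0 (r * v + real a * (r * w)) = exp (- (\<kappa> * (v + real a * w)\<^sup>2) / t)" for a
    proof -
      have "(r * v + real a * (r * w))\<^sup>2 = r\<^sup>2 * (v + real a * w)\<^sup>2" by (simp add: power2_eq_square algebra_simps)
      then show ?thesis by (simp add: G_def r)
    qed
    have rw: "(r * w) ^ (2*q) = (\<kappa> * w\<^sup>2 / t) ^ q"
      by (simp add: power_mult power_mult_distrib r)
    have Deq: "D = exp (- (\<kappa> * s) / t) * ((\<kappa> * w\<^sup>2 / t) ^ q * G (2*q) \<xi>)"
      unfolding D_def using eq by (simp add: G0 rw)
    have pos: "0 \<le> (\<kappa> * w\<^sup>2 / t) ^ q" using \<kappa> t by simp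
    define \<theta> where "\<theta> = \<xi> / r"
    have \<theta>: "v \<le> \<theta>" "\<theta> \<le> v + 2 * real q * w" "\<xi>\<^sup>2 = \<kappa> * \<theta>\<^sup>2 / t"
      using \<xi> r by (auto simp: \<theta>_def field_simps power_divide)
    have "\<bar>D\<bar> = exp (- (\<kappa> * s) / t) * ((\<kappa> * w\<^sup>2 / t) ^ q * \<bar>G (2*q) \<xi>\<bar>)"
      unfolding Deq using pos by (simp add: abs_mult)
    \<comment> \<open>Half of the orthogonal decay is given up so that both exponents carry the
      factor 1 / 2 and combine.\<close>
    also have "\<dots> \<le> exp (- (\<kappa> * s) / (2 * t)) * ((\<kappa> * w\<^sup>2 / t) ^ q * (C1 * exp (- \<xi>\<^sup>2 / 2)))"
      using \<kappa> s t pos C1 by (intro mult_mono mult_left_mono) (auto simp: field_simps)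
    also have "\<dots> = C1 * ((\<kappa> * w\<^sup>2 / t) ^ q * exp (- (\<kappa> * (\<theta>\<^sup>2 + s)) / (2 * t)))"
    proof -
      have "- (\<kappa> * (\<theta>\<^sup>2 + s)) / (2 * t) = - (\<kappa> * s) / (2 * t) + - \<xi>\<^sup>2 / 2"
        using t by (simp add: \<theta> field_simps)
      then have "exp (- (\<kappa> * (\<theta>\<^sup>2 + s)) / (2 * t)) = exp (- (\<kappa> * s) / (2 * t)) * exp (- \<xi>\<^sup>2 / 2)"
        by (simp only: exp_add)
      then show ?thesis by (simp only: ac_simps)
    qed
    finally have D1: "\<bar>D\<bar> \<le> C1 * ((\<kappa> * w\<^sup>2 / t) ^ q * exp (- (\<kappa> * (\<theta>\<^sup>2 + s)) / (2 * t)))" .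
    have Dt: "\<bar>D\<bar> \<le> C * (w\<^sup>2 / t) ^ q"
    proof -
      have "C1 * ((\<kappa> * w\<^sup>2 / t) ^ q * exp (- (\<kappa> * (\<theta>\<^sup>2 + s)) / (2 * t))) \<le> C1 * ((\<kappa> * w\<^sup>2 / t) ^ q * 1)"
        using C1nn pos \<kappa> s t by (intro mult_left_mono) auto
      also have "\<dots> = (C1 * \<kappa> ^ q) * (w\<^sup>2 / t) ^ q" by (simp add: power_mult_distrib power_divide)
      also have "\<dots> \<le> C * (w\<^sup>2 / t) ^ q" using C t by (intro mult_right_mono) auto
      finally show ?thesis using D1 by linarith
    qed
    \<comment> \<open>The intermediate point is within 2 q w of v. Past the threshold 16 q^2 w^2 the
      square of this displacement is at most a quarter of v^2 + s, so theta^2 + s keeps at least a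
      quarter of v^2 + s.\<close>
    have DY: "\<bar>D\<bar> \<le> C * (w\<^sup>2 / Y) ^ q"
    proof (cases "16 * (real q)\<^sup>2 * w\<^sup>2 \<le> v\<^sup>2 + s")
      case True
      show ?thesis
      proof (cases "q = 0")
        case True
        then show ?thesis using Dt by simp
      next
        case False
        define m where "m = v\<^sup>2 + s"
        have q1: "(real q)\<^sup>2 \<ge> 1" using False by (simp add: one_le_power)
        have "1 * w\<^sup>2 \<le> 16 * (real q)\<^sup>2 * w\<^sup>2" using q1 by (intro mult_right_mono) auto
        then have wm: "w\<^sup>2 \<le> m" using True by (simp add: m_def)
        have m: "m > 0" using wm w by (meson less_le_trans zero_less_power)
        have "(\<theta> - v)\<^sup>2 \<le> (2 * real q * w)\<^sup>2" using \<theta> by (intro power_mono) auto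
        then have "(\<theta> - v)\<^sup>2 \<le> m / 4" using True by (simp add: m_def power_mult_distrib)
        moreover have "0 \<le> (2 * \<theta> - v)\<^sup>2" by simp
        then have "v\<^sup>2 / 2 - (\<theta> - v)\<^sup>2 \<le> \<theta>\<^sup>2" by (simp add: power2_eq_square algebra_simps)
        ultimately have ms: "m / 4 \<le> \<theta>\<^sup>2 + s" using s by (simp add: m_def)
        define u where "u = \<kappa> * m / (8 * t)"
        have u: "u \<ge> 0" using \<kappa> m t by (simp add: u_def)
        have uq: "(\<kappa> * w\<^sup>2 / t) ^ q = (8 * (w\<^sup>2 / m)) ^ q * u ^ q"
          unfolding power_mult_distrib[symmetric] using m t by (simp add: u_def mult.commute)
        have "exp (- (\<kappa> * (\<theta>\<^sup>2 + s)) / (2 * t)) \<le> exp (- u)"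
        proof -
          have "\<kappa> * (m / 4) / (2 * t) \<le> \<kappa> * (\<theta>\<^sup>2 + s) / (2 * t)"
            using ms \<kappa> t by (intro divide_right_mono mult_left_mono) auto
          then show ?thesis by (simp add: u_def)
        qed
        then have "C1 * ((\<kappa> * w\<^sup>2 / t) ^ q * exp (- (\<kappa> * (\<theta>\<^sup>2 + s)) / (2 * t))) \<le> C1 * ((\<kappa> * w\<^sup>2 / t) ^ q * exp (- u))"
          using C1nn pos by (intro mult_left_mono) auto
        also have "C1 * ((\<kappa> * w\<^sup>2 / t) ^ q * exp (- u)) \<le> C1 * ((8 * (w\<^sup>2 / m)) ^ q * fact q)"
          unfolding uq mult.assoc using C1nn m power_times_exp_minus_le[OF u] by (intro mult_left_mono) auto
        also have "\<dots> \<le> C1 * ((16 * (w\<^sup>2 / Y)) ^ q * fact q)"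
        proof -
          have "Y \<le> 2 * m" using wm by (simp add: Y_def m_def)
          then have "w\<^sup>2 / (2 * m) \<le> w\<^sup>2 / Y" using Y by (intro divide_left_mono) (use m in auto)
          then have "8 * (w\<^sup>2 / m) \<le> 16 * (w\<^sup>2 / Y)" by simp
          then show ?thesis using C1nn m by (intro mult_left_mono mult_right_mono power_mono) auto
        qed
        also have "\<dots> = (C1 * 16 ^ q * fact q) * (w\<^sup>2 / Y) ^ q" by (simp add: power_mult_distrib power_divide)
        also have "\<dots> \<le> C * (w\<^sup>2 / Y) ^ q" using C Y by (intro mult_right_mono) auto
        finally show ?thesis using D1 by linarith
      qed
    next
      case False
      have "\<bar>D\<bar> \<le> 1 * A"
        unfolding D_def abs_mult A_def
      proof (intro mult_mono)
        show "\<bar>exp (- (\<kappa> * s) / t)\<bar> \<le> 1" using \<kappa> s t by simp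
        have "\<bar>c a * exp (- (\<kappa> * (v + real a * w)\<^sup>2) / t)\<bar> \<le> \<bar>c a\<bar>" for a
          using \<kappa> t by (simp add: abs_mult mult_left_le)
        then show "\<bar>\<Sum>a\<le>2*q. c a * exp (- (\<kappa> * (v + real a * w)\<^sup>2) / t)\<bar> \<le> (\<Sum>a\<le>2*q. \<bar>c a\<bar>)"
          by (intro order_trans[OF sum_abs] sum_mono)
      qed auto
      also have "1 * A \<le> A * ((1 + 16 * (real q)\<^sup>2) * (w\<^sup>2 / Y)) ^ q"
      proof -
        have "Y \<le> (1 + 16 * (real q)\<^sup>2) * w\<^sup>2" using False by (simp add: Y_def algebra_simps)
        then have "1 \<le> (1 + 16 * (real q)\<^sup>2) * (w\<^sup>2 / Y)" using Y by (simp add: field_simps)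
        then show ?thesis using A by (simp add: mult_le_cancel_left1 one_le_power)
      qed
      also have "\<dots> = (A * (1 + 16 * (real q)\<^sup>2) ^ q) * (w\<^sup>2 / Y) ^ q"
        by (simp add: power_mult_distrib power_divide)
      also have "\<dots> \<le> C * (w\<^sup>2 / Y) ^ q" using C Y by (intro mult_right_mono) auto
      finally show ?thesis .
    qed
    have "(w\<^sup>2 / Y) ^ q * (Y / t) ^ q = (w\<^sup>2 / t) ^ q"
      unfolding power_mult_distrib[symmetric] using Y by simp
    then show ?thesis
      using DY Dt unfolding D_def[symmetric] Y_def[symmetric] by (simp add: mult.assoc)
  qed
  show ?thesis using c0 C(4) main by blast
qed

section \<open>Height, decay and norm of Matern stencils\<close>

text \<open>Convergence at 0 comes from nu > 0 and at infinity from nu < q; hence differences of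
  order above 2 nu are taken.\<close>

lemma has_integral_powr_truncated:
  fixes \<nu> b :: real and q :: nat
  assumes \<nu>: "\<nu> > 0" "\<nu> < real q" and b: "b > 0"
  shows "((\<lambda>t. t powr (\<nu> - 1) * (if t \<le> b then 1 else (b / t) ^ q)) has_integral
    (1 / \<nu> + 1 / (real q - \<nu>)) * b powr \<nu>) {0<..}"
proof -
  define M where "M = (\<lambda>t. t powr (\<nu> - 1) * (if t \<le> b then 1 else (b / t) ^ q))"
  have "((\<lambda>t. t powr (\<nu> - 1)) has_integral (b powr \<nu> / \<nu>)) {0..b}"
    using has_integral_powr_from_0[of "\<nu> - 1" b] \<nu> b by simp
  then have 1: "(M has_integral (b powr \<nu> / \<nu>)) {0..b}"
    by (rule has_integral_eq[rotated]) (auto simp: M_def)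
  have "((\<lambda>t. t powr (\<nu> - 1 - real q)) has_integral (b powr (\<nu> - real q) / (real q - \<nu>))) {b..}"
  proof -
    have "- (b powr (\<nu> - 1 - real q + 1)) / (\<nu> - 1 - real q + 1) = b powr (\<nu> - real q) / (real q - \<nu>)"
      using \<nu> by (simp add: divide_simps algebra_simps)
    then show ?thesis
      using has_integral_powr_to_inf[of "\<nu> - 1 - real q" b] \<nu> b by simp
  qed
  from has_integral_mult_right[OF this, of "b ^ q"]
  have "((\<lambda>t. b ^ q * t powr (\<nu> - 1 - real q)) has_integral (b powr \<nu> / (real q - \<nu>))) {b..}"
    using b by (simp add: powr_diff powr_realpow)
  then have 2: "(M has_integral (b powr \<nu> / (real q - \<nu>))) {b..}"
    by (rule has_integral_eq[rotated])
       (use b in \<open>auto simp: M_def powr_diff powr_realpow power_divide not_le ac_simps\<close>)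
  have "(M has_integral (b powr \<nu> / \<nu> + b powr \<nu> / (real q - \<nu>))) ({0..b} \<union> {b..})"
    using b by (intro has_integral_Un 1 2) (auto intro: negligible_subset[of "{b}"])
  also have "{0..b} \<union> {b..} = {0..}" using b by auto
  finally have 3: "(M has_integral (b powr \<nu> / \<nu> + b powr \<nu> / (real q - \<nu>))) {0..}" .
  have "(M has_integral (b powr \<nu> / \<nu> + b powr \<nu> / (real q - \<nu>))) {0<..}"
    using 3 by (rule has_integral_remove_point[where x=0]) auto
  then show ?thesis by (simp add: M_def algebra_simps)
qed

lemma norm_axis_shift:
  fixes p x :: "real ^ 'd"
  shows "(norm (p + r *\<^sub>R axis i 1 - x))\<^sup>2
    = ((p $ i - x $ i) + r)\<^sup>2 + ((norm (p - x))\<^sup>2 - (p $ i - x $ i)\<^sup>2)"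
proof -
  have n2: "(norm z)\<^sup>2 = (z $ i)\<^sup>2 + (\<Sum>j\<in>UNIV - {i}. (z $ j)\<^sup>2)" for z :: "real ^ 'd"
    unfolding power2_norm_eq_inner inner_vec_def
    by (subst sum.remove[of UNIV i]) (auto simp: power2_eq_square)
  have "(\<Sum>j\<in>UNIV - {i}. ((p + r *\<^sub>R axis i 1 - x) $ j)\<^sup>2) = (\<Sum>j\<in>UNIV - {i}. ((p - x) $ j)\<^sup>2)"
    by (intro sum.cong) (auto simp: axis_def)
  then show ?thesis unfolding n2 by (simp add: axis_def algebra_simps)
qed

text \<open>Integrating the Gaussian bound over \<open>t\<close>, with b = w^2 + |p - x|^2, gives
  (w^2 / b)^q * b powr nu. Factoring out the height w powr (2 nu) leaves the decay factor (w^2 / b)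
  powr (q - nu).\<close>

lemma matern_stencil_bound:
  fixes \<nu> l :: real and q :: nat
  assumes \<nu>: "\<nu> > 0" "\<nu> < real q" and l: "l > 0"
  shows "\<exists>c C. \<bar>c 0\<bar> = 1 \<and> C > 0 \<and> (\<forall>i w. \<forall>p x :: real ^ 'd. w > 0 \<longrightarrow>
    \<bar>\<Sum>a\<le>2*q. c a * k_matern \<nu> l (p + (real a * w) *\<^sub>R axis i 1) x\<bar>
      \<le> C * w powr (2 * \<nu>) * (w\<^sup>2 / (w\<^sup>2 + (norm (p - x))\<^sup>2)) powr (real q - \<nu>))"
proof -
  define \<kappa> where "\<kappa> = \<nu> / (2 * l\<^sup>2)"
  have \<kappa>: "\<kappa> > 0" using \<nu> l by (simp add: \<kappa>_def)
  obtain c C where c0: "\<bar>c 0\<bar> = 1" and C: "C > 0" and bound: "\<And>v s t w. t > 0 \<Longrightarrow> w > 0 \<Longrightarrow> s \<ge> 0 \<Longrightarrow>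
    \<bar>exp (- (\<kappa> * s) / t) * (\<Sum>a\<le>2*q. c a * exp (- (\<kappa> * (v + real a * w)\<^sup>2) / t))\<bar>
      \<le> C * (w\<^sup>2 / (w\<^sup>2 + v\<^sup>2 + s)) ^ q * (if t \<le> w\<^sup>2 + v\<^sup>2 + s then 1 else ((w\<^sup>2 + v\<^sup>2 + s) / t) ^ q)"
    using gaussian_stencil_bound[OF \<kappa>, of q] by blast
  have G: "Gamma \<nu> > 0" using \<nu>(1) by (rule Gamma_real_pos)
  define K where "K = C * (1 / \<nu> + 1 / (real q - \<nu>)) / Gamma \<nu>"
  have K: "K > 0" using C G \<nu> by (auto simp: K_def intro!: divide_pos_pos mult_pos_pos add_pos_pos)
  have main: "\<bar>\<Sum>a\<le>2*q. c a * k_matern \<nu> l (p + (real a * w) *\<^sub>R axis i 1) x\<bar>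
      \<le> K * w powr (2 * \<nu>) * (w\<^sup>2 / (w\<^sup>2 + (norm (p - x))\<^sup>2)) powr (real q - \<nu>)"
    if w: "w > 0" for i w and p x :: "real ^ 'd"
  proof -
    define v where "v = p $ i - x $ i"
    define s where "s = (norm (p - x))\<^sup>2 - v\<^sup>2"
    have s: "s \<ge> 0"
      using component_le_norm_cart[of "p - x" i] by (simp add: s_def v_def abs_le_square_iff[symmetric])
    define b where "b = w\<^sup>2 + (norm (p - x))\<^sup>2"
    have b: "b > 0" using w by (simp add: b_def add_pos_nonneg)
    have bv: "w\<^sup>2 + v\<^sup>2 + s = b" by (simp add: b_def s_def)
    define F where "F = (\<Sum>a\<le>2*q. c a * k_matern \<nu> l (p + (real a * w) *\<^sub>R axis i 1) x)"
    define h where "h = (\<lambda>t. \<Sum>a\<le>2*q. c a * (t powr (\<nu> - 1) * exp (- t) *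
        exp (- (\<kappa> * (norm (p + (real a * w) *\<^sub>R axis i 1 - x))\<^sup>2) / t)))"
    have int: "(h has_integral Gamma \<nu> * F) {0<..}"
    proof -
      have "(h has_integral (\<Sum>a\<le>2*q. c a * (Gamma \<nu> * k_matern \<nu> l (p + (real a * w) *\<^sub>R axis i 1) x))) {0<..}"
        unfolding h_def \<kappa>_def
        by (intro has_integral_sum has_integral_mult_right matern_has_integral \<nu> l) auto
      then show ?thesis by (simp add: F_def sum_distrib_left mult.left_commute)
    qed
    have hD: "h t = t powr (\<nu> - 1) * exp (- t) *
        (exp (- (\<kappa> * s) / t) * (\<Sum>a\<le>2*q. c a * exp (- (\<kappa> * (v + real a * w)\<^sup>2) / t)))" if "t > 0" for t
      unfolding h_def sum_distrib_left
    proof (intro sum.cong refl)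
      fix a
      have "- (\<kappa> * (norm (p + (real a * w) *\<^sub>R axis i 1 - x))\<^sup>2) / t
          = - (\<kappa> * s) / t + - (\<kappa> * (v + real a * w)\<^sup>2) / t"
        unfolding norm_axis_shift v_def[symmetric] s_def[symmetric] by (simp add: algebra_simps add_divide_distrib diff_divide_distrib)
      then have "exp (- (\<kappa> * (norm (p + (real a * w) *\<^sub>R axis i 1 - x))\<^sup>2) / t)
          = exp (- (\<kappa> * s) / t) * exp (- (\<kappa> * (v + real a * w)\<^sup>2) / t)"
        by (simp only: exp_add)
      then show "c a * (t powr (\<nu> - 1) * exp (- t) * exp (- (\<kappa> * (norm (p + (real a * w) *\<^sub>R axis i 1 - x))\<^sup>2) / t))
        = t powr (\<nu> - 1) * exp (- t) * (exp (- (\<kappa> * s) / t) * (c a * exp (- (\<kappa> * (v + real a * w)\<^sup>2) / t)))"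
        by (simp only: ac_simps)
    qed
    have hb: "norm (h t) \<le> C * (w\<^sup>2 / b) ^ q * (t powr (\<nu> - 1) * (if t \<le> b then 1 else (b / t) ^ q))"
      if t: "t \<in> {0<..}" for t
    proof -
      have t0: "t > 0" using t by simp
      let ?D = "exp (- (\<kappa> * s) / t) * (\<Sum>a\<le>2*q. c a * exp (- (\<kappa> * (v + real a * w)\<^sup>2) / t))"
      have "norm (h t) = t powr (\<nu> - 1) * exp (- t) * \<bar>?D\<bar>"
        unfolding hD[OF t0] by (simp add: abs_mult)
      also have "\<dots> \<le> t powr (\<nu> - 1) * 1 * (C * (w\<^sup>2 / b) ^ q * (if t \<le> b then 1 else (b / t) ^ q))"
        using bound[OF t0 w s, of v] t0 unfolding bv by (intro mult_mono) auto
      finally show ?thesis by (simp add: mult.left_commute mult.assoc)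
    qed
    have int': "((\<lambda>t. C * (w\<^sup>2 / b) ^ q * (t powr (\<nu> - 1) * (if t \<le> b then 1 else (b / t) ^ q))) has_integral
        C * (w\<^sup>2 / b) ^ q * ((1 / \<nu> + 1 / (real q - \<nu>)) * b powr \<nu>)) {0<..}"
      by (intro has_integral_mult_right has_integral_powr_truncated \<nu> b)
    from integral_norm_bound_integral[OF has_integral_integrable[OF int] has_integral_integrable[OF int'] hb]
    have "\<bar>Gamma \<nu> * F\<bar> \<le> C * (w\<^sup>2 / b) ^ q * ((1 / \<nu> + 1 / (real q - \<nu>)) * b powr \<nu>)"
      unfolding integral_unique[OF int] integral_unique[OF int'] by simp
    then have "\<bar>F\<bar> \<le> C * (w\<^sup>2 / b) ^ q * ((1 / \<nu> + 1 / (real q - \<nu>)) * b powr \<nu>) / Gamma \<nu>"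
      using G by (simp add: abs_mult pos_le_divide_eq mult.commute)
    also have "\<dots> = K * ((w\<^sup>2 / b) ^ q * b powr \<nu>)" by (simp add: K_def)
    also have "(w\<^sup>2 / b) ^ q * b powr \<nu> = w powr (2 * \<nu>) * (w\<^sup>2 / b) powr (real q - \<nu>)"
    proof -
      have "w\<^sup>2 = w powr 2" using w by simp
      then have "(w\<^sup>2) powr \<nu> = w powr (2 * \<nu>)" by (simp only: powr_powr)
      then have 1: "(w\<^sup>2 / b) powr \<nu> = w powr (2 * \<nu>) / b powr \<nu>" using w b by (simp only: powr_divide)
      have "(w\<^sup>2 / b) powr (real q - \<nu>) = (w\<^sup>2 / b) ^ q / (w\<^sup>2 / b) powr \<nu>"
        unfolding powr_diff using w b by (subst powr_realpow) auto
      then show ?thesis unfolding 1 using w b by simp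
    qed
    finally show ?thesis by (simp add: F_def b_def mult.assoc)
  qed
  show ?thesis using c0 K main by blast
qed

text \<open>Expanding the square in the exponent leaves exp (2 beta a b), whose power series makes
  the form a sum of squares with nonnegative weights.\<close>

lemma gaussian_gram_nonneg:
  fixes u :: "nat \<Rightarrow> real" and \<beta> :: real
  assumes \<beta>: "\<beta> \<ge> 0"
  shows "0 \<le> (\<Sum>a\<le>n. \<Sum>b\<le>n. u a * u b * exp (- (\<beta> * (real a - real b)\<^sup>2)))"
proof -
  define y where "y = (\<lambda>a. u a * exp (- (\<beta> * (real a)\<^sup>2)))"
  have eq: "u a * u b * exp (- (\<beta> * (real a - real b)\<^sup>2)) = y a * y b * exp (2 * \<beta> * real a * real b)" for a b
  proof -
    have "- (\<beta> * (real a - real b)\<^sup>2) = - (\<beta> * (real a)\<^sup>2) + - (\<beta> * (real b)\<^sup>2) + 2 * \<beta> * real a * real b"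
      by (simp add: power2_eq_square algebra_simps)
    then have "exp (- (\<beta> * (real a - real b)\<^sup>2))
        = exp (- (\<beta> * (real a)\<^sup>2)) * exp (- (\<beta> * (real b)\<^sup>2)) * exp (2 * \<beta> * real a * real b)"
      by (simp only: exp_add)
    then show ?thesis by (simp add: y_def)
  qed
  have series: "(\<lambda>m. \<Sum>a\<le>n. \<Sum>b\<le>n. y a * y b * ((2 * \<beta> * real a * real b) ^ m /\<^sub>R fact m)) sums
      (\<Sum>a\<le>n. \<Sum>b\<le>n. y a * y b * exp (2 * \<beta> * real a * real b))"
    by (intro sums_sum sums_mult exp_converges)
  have terms: "0 \<le> (\<Sum>a\<le>n. \<Sum>b\<le>n. y a * y b * ((2 * \<beta> * real a * real b) ^ m /\<^sub>R fact m))" for m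
  proof -
    have "(\<Sum>a\<le>n. \<Sum>b\<le>n. y a * y b * ((2 * \<beta> * real a * real b) ^ m /\<^sub>R fact m))
        = (2 * \<beta>) ^ m / fact m * (\<Sum>a\<le>n. y a * real a ^ m)\<^sup>2"
      unfolding power2_eq_square sum_product unfolding sum_distrib_left
      by (intro sum.cong refl) (simp add: power_mult_distrib divide_inverse)
    then show ?thesis using \<beta> by simp
  qed
  have "0 \<le> (\<Sum>a\<le>n. \<Sum>b\<le>n. y a * y b * exp (2 * \<beta> * real a * real b))"
    by (rule sums_le[OF terms sums_zero series])
  then show ?thesis by (simp add: eq)
qed

text \<open>For large beta the Gram matrix is nearly the identity: the diagonal gives at least (u
  0)^2 = 1, the rest is at most \<open>S * exp (- \<beta>)\<close> in absolute value.\<close>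

lemma gaussian_gram_ge_half:
  fixes u :: "nat \<Rightarrow> real"
  assumes u0: "\<bar>u 0\<bar> = 1"
  shows "\<exists>\<beta>\<^sub>0>0. \<forall>\<beta>\<ge>\<beta>\<^sub>0. 1 / 2 \<le> (\<Sum>a\<le>n. \<Sum>b\<le>n. u a * u b * exp (- (\<beta> * (real a - real b)\<^sup>2)))"
proof -
  define S where "S = (\<Sum>a\<le>n. \<Sum>b\<le>n. \<bar>u a\<bar> * \<bar>u b\<bar>)"
  have S: "0 \<le> S" by (auto simp: S_def intro!: sum_nonneg)
  show ?thesis
  proof (intro exI[of _ "2 * S + 1"] conjI allI impI)
    fix \<beta> assume \<beta>: "2 * S + 1 \<le> \<beta>"
    have bnd: "(if a = b then (u a)\<^sup>2 else 0) - \<bar>u a\<bar> * \<bar>u b\<bar> * exp (- \<beta>)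
        \<le> u a * u b * exp (- (\<beta> * (real a - real b)\<^sup>2))" for a b
    proof (cases "a = b")
      case True
      then show ?thesis by (simp add: power2_eq_square)
    next
      case False
      have "(1::real) \<le> (real a - real b)\<^sup>2"
      proof -
        have "1 \<le> \<bar>real a - real b\<bar>" using False by linarith
        then show ?thesis using abs_le_square_iff[of 1 "real a - real b"] by simp
      qed
      then have "\<beta> * 1 \<le> \<beta> * (real a - real b)\<^sup>2" using \<beta> S by (intro mult_left_mono) auto
      then have "exp (- (\<beta> * (real a - real b)\<^sup>2)) \<le> exp (- \<beta>)" by simp
      then have "\<bar>u a * u b\<bar> * exp (- (\<beta> * (real a - real b)\<^sup>2)) \<le> \<bar>u a * u b\<bar> * exp (- \<beta>)"
        by (intro mult_left_mono) auto
      moreover have "- (\<bar>u a * u b\<bar> * exp (- (\<beta> * (real a - real b)\<^sup>2)))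
          \<le> u a * u b * exp (- (\<beta> * (real a - real b)\<^sup>2))"
        by (metis abs_ge_minus_self abs_mult abs_exp_cancel minus_le_iff)
      ultimately show ?thesis using False by (simp add: abs_mult)
    qed
    have "S * exp (- \<beta>) \<le> 1 / 2"
    proof -
      have "2 * S \<le> exp \<beta>" using \<beta> exp_ge_add_one_self[of \<beta>] by linarith
      then show ?thesis by (simp add: exp_minus field_simps)
    qed
    have "1 \<le> (\<Sum>a\<le>n. (u a)\<^sup>2)"
    proof -
      have "(u 0)\<^sup>2 = 1" using u0 by (metis power2_abs one_power2)
      then show ?thesis using member_le_sum[of 0 "{..n}" "\<lambda>a. (u a)\<^sup>2"] by simp
    qed
    then have "1 / 2 \<le> (\<Sum>a\<le>n. (u a)\<^sup>2) - S * exp (- \<beta>)"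
      using \<open>S * exp (- \<beta>) \<le> 1 / 2\<close> by linarith
    also have "\<dots> = (\<Sum>a\<le>n. \<Sum>b\<le>n. (if a = b then (u a)\<^sup>2 else 0) - \<bar>u a\<bar> * \<bar>u b\<bar> * exp (- \<beta>))"
      by (simp add: S_def sum_subtractf sum_distrib_right)
    also have "\<dots> \<le> (\<Sum>a\<le>n. \<Sum>b\<le>n. u a * u b * exp (- (\<beta> * (real a - real b)\<^sup>2)))"
      by (intro sum_mono bnd)
    finally show "1 / 2 \<le> (\<Sum>a\<le>n. \<Sum>b\<le>n. u a * u b * exp (- (\<beta> * (real a - real b)\<^sup>2)))" .
  qed (use S in auto)
qed

text \<open>In the mixture the Gaussian form is nonnegative for every t > 0 and at least 1/2 for t
  <= t0 w^2, where distinct nodes are nearly orthogonal. Integrating t powr (nu - 1) over that range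
  produces w powr (2 nu); w <= 1 keeps exp (- t) bounded below on it.\<close>

lemma matern_stencil_norm_lower:
  fixes \<nu> l :: real and c :: "nat \<Rightarrow> real"
  assumes \<nu>: "\<nu> > 0" and l: "l > 0" and c0: "\<bar>c 0\<bar> = 1"
  shows "\<exists>m>0. \<forall>i w. \<forall>p :: real ^ 'd. 0 < w \<longrightarrow> w \<le> 1 \<longrightarrow>
    m * w powr (2 * \<nu>) \<le> (\<Sum>a\<le>n. \<Sum>b\<le>n. c a * c b *
      k_matern \<nu> l (p + (real a * w) *\<^sub>R axis i 1) (p + (real b * w) *\<^sub>R axis i 1))"
proof -
  define \<kappa> where "\<kappa> = \<nu> / (2 * l\<^sup>2)"
  have \<kappa>: "\<kappa> > 0" using \<nu> l by (simp add: \<kappa>_def)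
  have G: "Gamma \<nu> > 0" using \<nu>(1) by (rule Gamma_real_pos)
  define Q where "Q = (\<lambda>\<beta>. \<Sum>a\<le>n. \<Sum>b\<le>n. c a * c b * exp (- (\<beta> * (real a - real b)\<^sup>2)))"
  obtain \<beta>0 where \<beta>0: "\<beta>0 > 0" "\<And>\<beta>. \<beta> \<ge> \<beta>0 \<Longrightarrow> 1 / 2 \<le> Q \<beta>"
    using gaussian_gram_ge_half[of c n, OF c0] unfolding Q_def by blast
  define t0 where "t0 = \<kappa> / \<beta>0"
  have t0: "t0 > 0" using \<kappa> \<beta>0 by (simp add: t0_def)
  define m where "m = exp (- t0) / 2 * (t0 powr \<nu> / \<nu>) / Gamma \<nu>"
  have m: "m > 0" using t0 \<nu> G by (simp add: m_def)
  have main: "m * w powr (2 * \<nu>) \<le> (\<Sum>a\<le>n. \<Sum>b\<le>n. c a * c b *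
      k_matern \<nu> l (p + (real a * w) *\<^sub>R axis i 1) (p + (real b * w) *\<^sub>R axis i 1))"
    if w: "0 < w" "w \<le> 1" for i w and p :: "real ^ 'd"
  proof -
    define pt where "pt = (\<lambda>a. p + (real a * w) *\<^sub>R axis i 1)"
    have dist: "(norm (pt a - pt b))\<^sup>2 = w\<^sup>2 * (real a - real b)\<^sup>2" for a b
    proof -
      have "pt a - pt b = ((real a - real b) * w) *\<^sub>R axis i 1"
        by (simp add: pt_def left_diff_distrib scaleR_diff_left)
      then show ?thesis by (simp add: power_mult_distrib)
    qed
    define F where "F = (\<Sum>a\<le>n. \<Sum>b\<le>n. c a * c b * k_matern \<nu> l (pt a) (pt b))"
    define h where "h = (\<lambda>t. \<Sum>a\<le>n. \<Sum>b\<le>n. c a * c b * (t powr (\<nu> - 1) * exp (- t) *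
        exp (- (\<kappa> * (norm (pt a - pt b))\<^sup>2) / t)))"
    have int: "(h has_integral Gamma \<nu> * F) {0<..}"
    proof -
      have "(h has_integral (\<Sum>a\<le>n. \<Sum>b\<le>n. c a * c b * (Gamma \<nu> * k_matern \<nu> l (pt a) (pt b)))) {0<..}"
        unfolding h_def \<kappa>_def
        by (intro has_integral_sum has_integral_mult_right matern_has_integral \<nu> l) auto
      then show ?thesis by (simp add: F_def sum_distrib_left mult.left_commute)
    qed
    have hQ: "h t = t powr (\<nu> - 1) * exp (- t) * Q (\<kappa> * w\<^sup>2 / t)" for t
      unfolding h_def Q_def sum_distrib_left dist
      by (intro sum.cong refl) (simp add: ac_simps)
    define b where "b = t0 * w\<^sup>2"
    have b: "b > 0" using t0 w by (simp add: b_def)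
    have w2: "w\<^sup>2 \<le> 1" using w by (intro power_le_one) auto
    then have bt0: "b \<le> t0" using t0 by (simp add: b_def mult_left_le)
    have "((\<lambda>t. t powr (\<nu> - 1)) has_integral (b powr \<nu> / \<nu>)) {0..b}"
      using has_integral_powr_from_0[of "\<nu> - 1" b] \<nu> b by simp
    then have "((\<lambda>t. t powr (\<nu> - 1)) has_integral (b powr \<nu> / \<nu>)) {0<..b}"
      by (rule has_integral_remove_point[where x=0]) auto
    from has_integral_mult_right[OF this, of "exp (- t0) / 2"]
    have low: "((\<lambda>t. if t \<in> {0<..b} then exp (- t0) / 2 * t powr (\<nu> - 1) else 0) has_integral
        exp (- t0) / 2 * (b powr \<nu> / \<nu>)) {0<..}"
      by (subst has_integral_restrict) auto
    have le: "(if t \<in> {0<..b} then exp (- t0) / 2 * t powr (\<nu> - 1) else 0) \<le> h t" if t: "t \<in> {0<..}" for t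
    proof (cases "t \<le> b")
      case True
      have "\<beta>0 = \<kappa> * w\<^sup>2 / b" using \<kappa> \<beta>0 w by (simp add: b_def t0_def)
      also have "\<dots> \<le> \<kappa> * w\<^sup>2 / t" using True t \<kappa> b by (intro divide_left_mono) auto
      finally have "1 / 2 \<le> Q (\<kappa> * w\<^sup>2 / t)" by (rule \<beta>0(2))
      moreover have "exp (- t0) \<le> exp (- t)" using True bt0 by simp
      ultimately have "t powr (\<nu> - 1) * exp (- t0) * (1 / 2) \<le> t powr (\<nu> - 1) * exp (- t) * Q (\<kappa> * w\<^sup>2 / t)"
        by (intro mult_mono mult_left_mono) auto
      then show ?thesis using True t by (simp add: hQ ac_simps)
    next
      case False
      have "0 \<le> Q (\<kappa> * w\<^sup>2 / t)" unfolding Q_def using \<kappa> t by (intro gaussian_gram_nonneg) auto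
      then show ?thesis using False by (simp add: hQ)
    qed
    have "exp (- t0) / 2 * (b powr \<nu> / \<nu>) \<le> Gamma \<nu> * F"
      by (rule has_integral_le[OF low int le])
    moreover have "b powr \<nu> = t0 powr \<nu> * w powr (2 * \<nu>)"
    proof -
      have "w\<^sup>2 = w powr 2" using w by simp
      then have "(w\<^sup>2) powr \<nu> = w powr (2 * \<nu>)" by (simp only: powr_powr)
      then show ?thesis unfolding b_def using t0 w by (simp add: powr_mult)
    qed
    ultimately have "exp (- t0) / 2 * (t0 powr \<nu> * w powr (2 * \<nu>) / \<nu>) / Gamma \<nu> \<le> F"
      using G by (simp only: pos_divide_le_eq mult.commute)
    then show ?thesis by (simp add: m_def F_def pt_def)
  qed
  show ?thesis using m main by blast
qed

section \<open>The Matern family on a grid\<close>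

text \<open>Each term is at most twice an arctan increment over a unit interval around its node;
  spacing at least 1 keeps these intervals from overlapping, so the increments are bounded by the
  total variation pi.\<close>

lemma sum_inverse_square_grid_le:
  fixes u L :: real
  assumes L: "L \<ge> 1"
  shows "(\<Sum>k<m. 1 / (1 + (u - L * real k)\<^sup>2)) \<le> 2 * pi"
proof -
  have step: "1 / (1 + t\<^sup>2) \<le> 2 * (arctan (t + 1 / 2) - arctan (t - 1 / 2))" for t :: real
  proof -
    obtain s where s: "t - 1 / 2 < s" "s < t + 1 / 2"
      "arctan (t + 1 / 2) - arctan (t - 1 / 2) = (t + 1 / 2 - (t - 1 / 2)) * inverse (1 + s\<^sup>2)"
      using MVT2[of "t - 1/2" "t + 1/2" arctan "\<lambda>s. inverse (1 + s\<^sup>2)"] DERIV_arctan by auto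
    have "\<bar>s - t\<bar> \<le> \<bar>1 / 2\<bar>" using s(1,2) unfolding abs_le_iff by auto
    then have "(s - t)\<^sup>2 \<le> (1 / 2)\<^sup>2" unfolding abs_le_square_iff .
    moreover have "0 \<le> (2 * t - s)\<^sup>2" by simp
    ultimately have "1 + s\<^sup>2 \<le> 2 * (1 + t\<^sup>2)" by (simp add: power2_eq_square algebra_simps)
    moreover have "0 < 1 + t\<^sup>2" "0 < 1 + s\<^sup>2" by (simp_all add: add_pos_nonneg)
    ultimately have "1 / (1 + t\<^sup>2) \<le> 2 / (1 + s\<^sup>2)"
      by (subst frac_le_eq) (auto simp: divide_nonpos_pos mult_pos_pos)
    then have "1 / (1 + t\<^sup>2) \<le> 2 * inverse (1 + s\<^sup>2)" by (simp only: divide_inverse)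
    then show ?thesis using s(3) by simp
  qed
  have "(\<Sum>k<m. 1 / (1 + (u - L * real k)\<^sup>2))
      \<le> 2 * (arctan (u + 1 / 2) - arctan (u - L * real m + 1 / 2))"
  proof (induction m)
    case (Suc m)
    have "arctan (u - L * real (Suc m) + 1 / 2) \<le> arctan (u - L * real m - 1 / 2)"
      using L by (intro arctan_monotone') (simp add: algebra_simps)
    then show ?case using Suc step[of "u - L * real m"] by (simp add: algebra_simps)
  qed simp
  also have "\<dots> \<le> 2 * pi"
    using arctan_ubound[of "u + 1/2"] arctan_lbound[of "u - L * real m + 1/2"] by simp
  finally show ?thesis .
qed

lemma exists_large_value_of_weighted_sum:
  fixes c F :: "nat \<Rightarrow> real"
  assumes "W > 0" and "S \<ge> (\<Sum>b\<le>n. \<bar>c b\<bar>)" and S: "S > 0" and "W \<le> (\<Sum>b\<le>n. c b * F b)"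
  shows "\<exists>b\<le>n. W / (2 * S) \<le> \<bar>F b\<bar>"
proof (rule ccontr)
  assume "\<not> ?thesis"
  then have small: "\<bar>F b\<bar> \<le> W / (2 * S)" if "b \<le> n" for b
    using that by (meson le_cases)
  have "c b * F b \<le> \<bar>c b\<bar> * (W / (2 * S))" if "b \<le> n" for b
    using small[OF that] abs_ge_self[of "c b * F b"] mult_left_mono[of "\<bar>F b\<bar>" "W / (2 * S)" "\<bar>c b\<bar>"]
    by (simp add: abs_mult)
  then have "(\<Sum>b\<le>n. c b * F b) \<le> (\<Sum>b\<le>n. \<bar>c b\<bar>) * (W / (2 * S))"
    unfolding sum_distrib_right by (intro sum_mono) auto
  also have "\<dots> \<le> S * (W / (2 * S))" using assms by (intro mult_right_mono) auto
  also have "\<dots> < W" using assms by simp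
  finally show False using assms by simp
qed

text \<open>The squared norm \<open>E j\<close> of a stencil is also the weighted sum of its values
  at its own nodes. Read one way, the bound on the values bounds the norm; read the other way, the
  lower bound on the norm forces a large value at a node, which lies in the cube. This yields a peak
  without any explicit evaluation of the stencil.\<close>

lemma matern_hard_family:
  fixes \<nu> l \<Psi> :: real
  assumes \<nu>: "\<nu> > 0" and l: "l > 0" and \<Psi>: "\<Psi> > 0"
  shows "\<exists>\<delta> V c w\<^sub>0. \<delta> > 0 \<and> V > 0 \<and> c > 0 \<and> 0 < w\<^sub>0 \<and> (\<forall>w. 0 < w \<longrightarrow> w \<le> w\<^sub>0 \<longrightarrow>
    (\<exists>J f. hard_family (k_matern \<nu> l :: real ^ 'd \<Rightarrow> real ^ 'd \<Rightarrow> real) \<Psi>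
        (\<delta> * w powr \<nu>) (V * w powr (2 * \<nu>)) J f \<and> c * (1 / w) ^ CARD('d) \<le> real (card J)))"
proof -
  define d where "d = CARD('d)"
  \<comment> \<open>q - nu >= 1 gives the decay used in \<open>far\<close>, and 2 (q - nu) >= d
    makes the squares summable over a d-dimensional grid.\<close>
  define q where "q = nat \<lceil>\<nu>\<rceil> + d + 1"
  have q: "\<nu> < real q" "1 \<le> real q - \<nu>" "real d \<le> 2 * (real q - \<nu>)"
  proof -
    have "\<nu> \<le> real (nat \<lceil>\<nu>\<rceil>)" by linarith
    then show "\<nu> < real q" "1 \<le> real q - \<nu>" "real d \<le> 2 * (real q - \<nu>)" by (simp_all add: q_def)
  qed
  define n where "n = 2 * q"
  have n: "n > 0" by (simp add: n_def q_def)
  obtain c C where c0: "\<bar>c 0\<bar> = (1::real)" and C: "C > (0::real)"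
    and bound: "\<forall>i w. \<forall>p x :: real ^ 'd. w > 0 \<longrightarrow>
    \<bar>\<Sum>a\<le>n. c a * k_matern \<nu> l (p + (real a * w) *\<^sub>R axis i 1) x\<bar>
      \<le> C * w powr (2 * \<nu>) * (w\<^sup>2 / (w\<^sup>2 + (norm (p - x))\<^sup>2)) powr (real q - \<nu>)"
    using matern_stencil_bound[OF \<nu> q(1) l, folded n_def] by (elim exE conjE)
  obtain m where m: "m > 0" and lower: "\<forall>i w. \<forall>p :: real ^ 'd. 0 < w \<longrightarrow> w \<le> 1 \<longrightarrow>
    m * w powr (2 * \<nu>) \<le> (\<Sum>a\<le>n. \<Sum>b\<le>n. c a * c b *
      k_matern \<nu> l (p + (real a * w) *\<^sub>R axis i 1) (p + (real b * w) *\<^sub>R axis i 1))"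
    using matern_stencil_norm_lower[where c=c and n=n, OF \<nu> l c0] by (elim exE conjE)
  define S where "S = (\<Sum>a\<le>n. \<bar>c a\<bar>)"
  have "\<bar>c 0\<bar> \<le> S" unfolding S_def by (rule member_le_sum) auto
  then have S: "S > 0" using c0 by simp
  \<comment> \<open>Scales the norm bound to exactly \<open>\<Psi>\<close>; \<open>\<mu>\<close> is
    the resulting guaranteed peak in units of \<open>w powr \<nu>\<close>.\<close>
  define B where "B = \<Psi> / sqrt (S * C)"
  have B: "B > 0" "B\<^sup>2 * (S * C) = \<Psi>\<^sup>2" using \<Psi> S C by (auto simp: B_def power_divide)
  define \<mu> where "\<mu> = B * (m / (2 * S))"
  have \<mu>: "\<mu> > 0" using B m S by (simp add: \<mu>_def)
  \<comment> \<open>Grid spacing in units of w, large enough that half a spacing away from its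
    centre a bump is at most half of its guaranteed peak.\<close>
  define L where "L = 1 + 8 * B * C / \<mu>"
  have L: "L \<ge> 1" "8 * B * C / \<mu> \<le> L" using B C \<mu> by (auto simp: L_def)
  define w0 where "w0 = min (1 / (2 * real n)) (1 / (4 * L))"
  have w0: "w0 > 0" "w0 \<le> 1" "w0 \<le> 1 / (2 * real n)" "w0 \<le> 1 / (4 * L)"
    using n L by (auto simp: w0_def min_le_iff_disj)
  define V where "V = B\<^sup>2 * C\<^sup>2 * (2 * pi) ^ d"
  have V: "V > 0" using B C by (simp add: V_def)
  define i0 :: 'd where "i0 = undefined"
  have main: "\<exists>J f. hard_family (k_matern \<nu> l :: real ^ 'd \<Rightarrow> real ^ 'd \<Rightarrow> real) \<Psi>
        (\<mu> / 2 * w powr \<nu>) (V * w powr (2 * \<nu>)) J f \<and> (1 / (4 * L)) ^ d * (1 / w) ^ CARD('d) \<le> real (card J)"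
    if w: "0 < w" "w \<le> w0" for w
  proof -
    have w1: "w \<le> 1" using w w0 by linarith
    have wn: "real n * w \<le> 1 / 2"
    proof -
      have "w \<le> 1 / (2 * real n)" using w w0 by linarith
      then show ?thesis using n by (simp add: field_simps)
    qed
    have wL: "1 \<le> 1 / (4 * L * w)"
    proof -
      have "w \<le> 1 / (4 * L)" using w w0 by linarith
      then show ?thesis using L w by (simp add: field_simps)
    qed
    \<comment> \<open>The grid fills only [0, 1/2] in each coordinate; the other half is room for
      the stencil nodes, which extend by at most n w <= 1/2 along the axis
      \<open>i0\<close>.\<close>
    define M where "M = nat \<lfloor>1 / (2 * L * w)\<rfloor>"
    have M: "real M \<le> 1 / (2 * L * w)" "1 / (2 * L * w) - 1 \<le> real M"
      using L w by (auto simp: M_def)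
    have M4: "1 / (4 * L * w) \<le> real M"
    proof -
      have "1 / (2 * L * w) = 2 * (1 / (4 * L * w))" by simp
      then show ?thesis using M(2) wL by linarith
    qed
    define J :: "('d \<Rightarrow> nat) set" where "J = PiE UNIV (\<lambda>_. {..<M})"
    have finJ: "finite J" unfolding J_def by (intro finite_PiE) auto
    have cardJ: "card J = M ^ d" unfolding J_def d_def by (subst card_PiE) auto
    define p :: "('d \<Rightarrow> nat) \<Rightarrow> real ^ 'd" where "p = (\<lambda>j. \<chi> i. L * w * real (j i))"
    define pt where "pt = (\<lambda>j a. p j + (real a * w) *\<^sub>R axis i0 1)"
    define F where "F = (\<lambda>j x. \<Sum>a\<le>n. c a * k_matern \<nu> l (pt j a) x)"
    define \<rho> where "\<rho> = (\<lambda>j x. w\<^sup>2 / (w\<^sup>2 + (norm (p j - x))\<^sup>2))"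
    define W where "W = w powr (2 * \<nu>)"
    have W: "W > 0" using w by (simp add: W_def)
    have \<rho>: "0 < \<rho> j x" "\<rho> j x \<le> 1" for j x
      using w by (auto simp: \<rho>_def divide_le_eq_1 add_pos_nonneg)
    have Fb: "\<bar>F j x\<bar> \<le> C * W * \<rho> j x powr (real q - \<nu>)" for j x
      using bound[rule_format, OF w(1), of "p j" i0 x] by (simp add: F_def pt_def W_def \<rho>_def)
    have \<rho>1: "\<rho> j x powr (real q - \<nu>) \<le> 1" for j x
      using \<rho>[of j x] q by (intro powr_le1) auto
    have Fb1: "\<bar>F j x\<bar> \<le> C * W" for j x
      using Fb[of j x] \<rho>1[of j x] C W by (meson mult_left_le mult_pos_pos less_imp_le order_trans)
    define E where "E = (\<lambda>j. \<Sum>a\<le>n. \<Sum>b\<le>n. c a * c b * k_matern \<nu> l (pt j a) (pt j b))"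
    have E: "E j = (\<Sum>b\<le>n. c b * F j (pt j b))" for j
      unfolding E_def F_def sum_distrib_left
      by (subst sum.swap) (simp add: mult.left_commute mult.assoc)
    have Elow: "m * W \<le> E j" for j
      using lower[rule_format, OF w(1) w1, of "p j" i0] by (simp add: E_def pt_def W_def)
    have Eup: "E j \<le> S * (C * W)" for j
    proof -
      have "c b * F j (pt j b) \<le> \<bar>c b\<bar> * (C * W)" for b
        using abs_ge_self[of "c b * F j (pt j b)"] mult_left_mono[OF Fb1[of j "pt j b"], of "\<bar>c b\<bar>"]
        by (simp add: abs_mult)
      then show ?thesis unfolding E S_def sum_distrib_right by (intro sum_mono)
    qed
    \<comment> \<open>The stencil may be negative at its large node; \<open>\<sigma>\<close> flips
      it.\<close>
    have "\<exists>b \<sigma>. b \<le> n \<and> \<sigma>\<^sup>2 = 1 \<and> m * W / (2 * S) \<le> \<sigma> * F j (pt j b)" for j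
    proof -
      have "\<exists>b\<le>n. m * W / (2 * S) \<le> \<bar>F j (pt j b)\<bar>"
        by (rule exists_large_value_of_weighted_sum[where c=c])
           (use m W S Elow[of j] in \<open>simp_all add: E S_def\<close>)
      then obtain b where b: "b \<le> n" "m * W / (2 * S) \<le> \<bar>F j (pt j b)\<bar>" by blast
      show ?thesis
      proof (cases "F j (pt j b) \<ge> 0")
        case True
        then show ?thesis using b by (intro exI[of _ b] exI[of _ 1]) auto
      next
        case False
        then show ?thesis using b by (intro exI[of _ b] exI[of _ "-1"]) auto
      qed
    qed
    then obtain b \<sigma> where b: "\<And>j. b j \<le> n" and \<sigma>: "\<And>j. (\<sigma> j)\<^sup>2 = 1"
      and peak: "\<And>j. m * W / (2 * S) \<le> \<sigma> j * F j (pt j (b j))" by metis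
    define A where "A = B * w powr (- \<nu>)"
    have A: "A > 0" using B w by (simp add: A_def)
    have AW: "A * W = B * w powr \<nu>"
      using w by (simp add: A_def W_def powr_add[symmetric])
    have A2W: "A\<^sup>2 * W = B\<^sup>2"
    proof -
      have "A\<^sup>2 * W = A * (A * W)" by (simp add: power2_eq_square)
      also have "\<dots> = B\<^sup>2 * (w powr (- \<nu>) * w powr \<nu>)" unfolding AW by (simp add: A_def power2_eq_square)
      also have "\<dots> = B\<^sup>2" using w by (simp add: powr_add[symmetric])
      finally show ?thesis .
    qed
    define f where "f = (\<lambda>j x. A * \<sigma> j * F j x)"
    have abs\<sigma>: "\<bar>\<sigma> j\<bar> = 1" for j using \<sigma>[of j] by (metis abs_1 power2_eq_1_iff abs_minus_cancel)
    have fabs: "\<bar>f j x\<bar> \<le> B * C * w powr \<nu> * \<rho> j x powr (real q - \<nu>)" for j x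
    proof -
      have "\<bar>f j x\<bar> = A * \<bar>F j x\<bar>" using A by (simp add: f_def abs_mult abs\<sigma>)
      also have "\<dots> \<le> A * (C * W * \<rho> j x powr (real q - \<nu>))" using A Fb by (intro mult_left_mono) auto
      also have "\<dots> = (A * W) * C * \<rho> j x powr (real q - \<nu>)" by simp
      finally show ?thesis unfolding AW by (simp add: ac_simps)
    qed
    have fle: "f j x \<le> B * C * w powr \<nu>" for j x
    proof -
      have "B * C * w powr \<nu> * \<rho> j x powr (real q - \<nu>) \<le> B * C * w powr \<nu>"
        using \<rho>1 B C by (intro mult_left_le) auto
      then show ?thesis using fabs[of j x] by linarith
    qed
    have bdd: "bdd_above (f j ` unit_cube)" for j
      using fle by (intro bdd_aboveI[of _ "B * C * w powr \<nu>"]) auto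
    have pt_cube: "pt j a \<in> unit_cube" if "j \<in> J" "a \<le> n" for j a
    proof -
      have "0 \<le> pt j a $ i \<and> pt j a $ i \<le> 1" for i
      proof -
        have jM: "real (j i) \<le> real M" using that(1) by (auto simp: J_def PiE_iff less_imp_le)
        have "L * w * real (j i) \<le> L * w * (1 / (2 * L * w))"
          using jM M(1) L w by (intro mult_left_mono) auto
        also have "\<dots> = 1 / 2" using L w by simp
        finally have 1: "L * w * real (j i) \<le> 1 / 2" .
        have "real a * w \<le> real n * w" using that(2) w by (intro mult_right_mono) auto
        then have 2: "real a * w \<le> 1 / 2" using wn by linarith
        have "0 \<le> L * w * real (j i)" "0 \<le> real a * w" using L w by auto
        with 1 2 show ?thesis by (auto simp: pt_def p_def axis_def)
      qed
      then show ?thesis by (simp add: unit_cube_def)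
    qed
    have sup: "\<mu> * w powr \<nu> \<le> (SUP z\<in>unit_cube. f j z)" if j: "j \<in> J" for j
    proof -
      have "\<mu> * w powr \<nu> = A * (m * W / (2 * S))"
        using AW by (simp add: \<mu>_def algebra_simps)
      also have "\<dots> \<le> A * (\<sigma> j * F j (pt j (b j)))" using A peak by (intro mult_left_mono) auto
      also have "\<dots> = f j (pt j (b j))" by (simp add: f_def)
      also have "\<dots> \<le> (SUP z\<in>unit_cube. f j z)" by (rule cSUP_upper[OF pt_cube[OF j b] bdd])
      finally show ?thesis .
    qed
    have rkhs: "rkhs_ball (k_matern \<nu> l) unit_cube \<Psi> (f j)" if j: "j \<in> J" for j
    proof -
      have feq: "f j = (\<lambda>x. \<Sum>a\<in>{..n}. (A * \<sigma> j * c a) * k_matern \<nu> l (pt j a) x)"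
        by (simp add: f_def F_def sum_distrib_left mult.assoc)
      have "(\<Sum>a\<in>{..n}. \<Sum>b\<in>{..n}. (A * \<sigma> j * c a) * (A * \<sigma> j * c b) * k_matern \<nu> l (pt j a) (pt j b))
          = (A\<^sup>2 * (\<sigma> j)\<^sup>2) * E j"
        unfolding E_def sum_distrib_left by (intro sum.cong refl) (simp add: power2_eq_square ac_simps)
      also have "\<dots> \<le> A\<^sup>2 * (S * (C * W))" using Eup \<sigma> by (simp add: mult_left_mono)
      also have "\<dots> = (A\<^sup>2 * W) * (S * C)" by simp
      also have "\<dots> = \<Psi>\<^sup>2" unfolding A2W by (rule B)
      finally show ?thesis unfolding feq
        by (intro rkhs_ball_finite_combination) (use pt_cube[OF j] \<Psi> in auto)
    qed
    have far: "f j x \<le> \<mu> / 2 * w powr \<nu>" if "L * w / 2 \<le> norm (p j - x)" for j x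
    proof -
      have "(L * w / 2)\<^sup>2 \<le> (norm (p j - x))\<^sup>2" using that L w by (intro power_mono) auto
      then have "w\<^sup>2 * (L\<^sup>2 / 4) \<le> w\<^sup>2 + (norm (p j - x))\<^sup>2" using w by (simp add: power_mult_distrib power_divide field_simps add_increasing)
      moreover have "L \<le> L\<^sup>2" using L by (simp add: power2_eq_square)
      then have "w\<^sup>2 * (L / 4) \<le> w\<^sup>2 * (L\<^sup>2 / 4)" by (intro mult_left_mono) auto
      ultimately have "w\<^sup>2 * (L / 4) \<le> w\<^sup>2 + (norm (p j - x))\<^sup>2" by linarith
      then have "\<rho> j x \<le> w\<^sup>2 / (w\<^sup>2 * (L / 4))"
        unfolding \<rho>_def using w L by (intro divide_left_mono) (auto intro!: mult_pos_pos add_pos_nonneg)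
      also have "\<dots> = 4 / L" using w by simp
      finally have r4: "\<rho> j x \<le> 4 / L" .
      have "\<rho> j x powr (real q - \<nu>) \<le> \<rho> j x powr 1" using \<rho>[of j x] q by (intro powr_mono') auto
      then have r5: "\<rho> j x powr (real q - \<nu>) \<le> 4 / L" using r4 \<rho>[of j x] by simp
      have "f j x \<le> B * C * w powr \<nu> * \<rho> j x powr (real q - \<nu>)" using fabs[of j x] by linarith
      also have "\<dots> \<le> B * C * w powr \<nu> * (4 / L)" using r5 B C by (intro mult_left_mono) auto
      also have "\<dots> = (4 * B * C / L) * w powr \<nu>" by simp
      also have "\<dots> \<le> \<mu> / 2 * w powr \<nu>"
      proof (intro mult_right_mono)
        have "8 * B * C \<le> \<mu> * L" using L(2) \<mu> by (simp add: field_simps)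
        then show "4 * B * C / L \<le> \<mu> / 2" using L by (simp add: field_simps)
      qed simp
      finally show ?thesis .
    qed
    have sep: "\<mu> / 2 * w powr \<nu> \<le> ((SUP z\<in>unit_cube. f j z) - f j x) + ((SUP z\<in>unit_cube. f j' z) - f j' x)"
      if jj: "j \<in> J" "j' \<in> J" "x \<in> unit_cube" "j \<noteq> j'" for j j' x
    proof -
      \<comment> \<open>Distinct centres are at least L w apart, so x is at distance at least L w /
        2 from one of them, and that member alone provides the gap.\<close>
      obtain i where i: "j i \<noteq> j' i" using jj(4) by auto
      have "1 \<le> \<bar>real (j i) - real (j' i)\<bar>" using i by linarith
      then have "L * w * 1 \<le> L * w * \<bar>real (j i) - real (j' i)\<bar>" using L w by (intro mult_left_mono) auto
      also have "\<dots> = \<bar>(p j - p j') $ i\<bar>"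
        using L w by (simp add: p_def abs_mult right_diff_distrib[symmetric])
      also have "\<dots> \<le> norm (p j - p j')" by (rule component_le_norm_cart)
      also have "\<dots> \<le> norm (p j - x) + norm (p j' - x)"
        using norm_triangle_ineq4[of "p j - x" "p j' - x"] by simp
      finally have "L * w / 2 \<le> norm (p j - x) \<or> L * w / 2 \<le> norm (p j' - x)" by linarith
      moreover have "f j x \<le> (SUP z\<in>unit_cube. f j z)" "f j' x \<le> (SUP z\<in>unit_cube. f j' z)"
        by (rule cSUP_upper[OF jj(3) bdd])+
      moreover have "\<mu> * w powr \<nu> = \<mu> / 2 * w powr \<nu> + \<mu> / 2 * w powr \<nu>" by simp
      ultimately show ?thesis using sup[OF jj(1)] sup[OF jj(2)] far[of j x] far[of j' x] by linarith
    qed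
    have sq: "(\<Sum>j\<in>J. (f j x)\<^sup>2) \<le> V * w powr (2 * \<nu>)" if "x \<in> unit_cube" for x
    proof -
      define u where "u = (\<lambda>i. x $ i / w)"
      \<comment> \<open>Bounding the radial decay by a product over coordinates makes the sum over
        the grid factor into one-dimensional sums.\<close>
      have "(f j x)\<^sup>2 \<le> B\<^sup>2 * C\<^sup>2 * W * (\<Prod>i\<in>UNIV. 1 / (1 + (u i - L * real (j i))\<^sup>2))" for j
      proof -
        have "(f j x)\<^sup>2 \<le> (B * C * w powr \<nu> * \<rho> j x powr (real q - \<nu>))\<^sup>2"
          using fabs[of j x] B C by (intro abs_le_square_iff[THEN iffD1]) auto
        also have "\<dots> = B\<^sup>2 * C\<^sup>2 * W * (\<rho> j x powr (real q - \<nu>))\<^sup>2"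
        proof -
          have "(w powr \<nu>)\<^sup>2 = W" by (simp add: W_def power2_eq_square powr_add[symmetric])
          then show ?thesis by (simp add: power_mult_distrib)
        qed
        also have "\<dots> \<le> B\<^sup>2 * C\<^sup>2 * W * (\<Prod>i\<in>UNIV. 1 / (1 + (u i - L * real (j i))\<^sup>2))"
        proof (intro mult_left_mono)
          have "(\<rho> j x powr (real q - \<nu>))\<^sup>2 = \<rho> j x powr (2 * (real q - \<nu>))"
            by (simp add: power2_eq_square powr_add[symmetric])
          also have "\<dots> \<le> \<rho> j x powr (real d)" using \<rho>[of j x] q by (intro powr_mono') auto
          also have "\<dots> = \<rho> j x ^ d" using \<rho>[of j x] by (simp add: powr_realpow)
          also have "\<dots> = (\<Prod>i\<in>(UNIV :: 'd set). \<rho> j x)" by (simp add: d_def)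
          also have "\<dots> \<le> (\<Prod>i\<in>UNIV. 1 / (1 + (u i - L * real (j i))\<^sup>2))"
          proof (intro prod_mono conjI)
            fix i
            show "0 \<le> \<rho> j x" using \<rho>[of j x] by simp
            have "\<bar>(p j - x) $ i\<bar>\<^sup>2 \<le> (norm (p j - x))\<^sup>2" by (intro power_mono component_le_norm_cart) auto
            moreover have "(p j - x) $ i = - (w * (u i - L * real (j i)))"
              using w by (simp add: p_def u_def algebra_simps)
            ultimately have "w\<^sup>2 * (u i - L * real (j i))\<^sup>2 \<le> (norm (p j - x))\<^sup>2"
              by (simp add: power_mult_distrib)
            then have "\<rho> j x \<le> w\<^sup>2 / (w\<^sup>2 * (1 + (u i - L * real (j i))\<^sup>2))"
              unfolding \<rho>_def using w
              by (intro divide_left_mono) (auto simp: distrib_left intro!: mult_pos_pos add_pos_nonneg)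
            also have "\<dots> = 1 / (1 + (u i - L * real (j i))\<^sup>2)" using w by simp
            finally show "\<rho> j x \<le> 1 / (1 + (u i - L * real (j i))\<^sup>2)" .
          qed
          finally show "(\<rho> j x powr (real q - \<nu>))\<^sup>2 \<le> (\<Prod>i\<in>UNIV. 1 / (1 + (u i - L * real (j i))\<^sup>2))" .
        qed (use W in auto)
        finally show ?thesis .
      qed
      then have "(\<Sum>j\<in>J. (f j x)\<^sup>2)
          \<le> (\<Sum>j\<in>J. B\<^sup>2 * C\<^sup>2 * W * (\<Prod>i\<in>UNIV. 1 / (1 + (u i - L * real (j i))\<^sup>2)))"
        by (rule sum_mono)
      also have "\<dots> = B\<^sup>2 * C\<^sup>2 * W * (\<Prod>i\<in>UNIV. \<Sum>k<M. 1 / (1 + (u i - L * real k)\<^sup>2))"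
        unfolding sum_distrib_left[symmetric] J_def by (subst prod_sum_PiE) auto
      also have "\<dots> \<le> B\<^sup>2 * C\<^sup>2 * W * (\<Prod>i\<in>(UNIV :: 'd set). 2 * pi)"
        using W by (intro mult_left_mono prod_mono conjI sum_inverse_square_grid_le L sum_nonneg) auto
      finally show ?thesis by (simp add: V_def W_def d_def ac_simps)
    qed
    have "hard_family (k_matern \<nu> l) \<Psi> (\<mu> / 2 * w powr \<nu>) (V * w powr (2 * \<nu>)) J f"
      unfolding hard_family_def by (intro conjI ballI impI finJ rkhs bdd sep sq)
    moreover have "(1 / (4 * L)) ^ d * (1 / w) ^ CARD('d) \<le> real (card J)"
    proof -
      have "(1 / (4 * L)) ^ d * (1 / w) ^ CARD('d) = (1 / (4 * L * w)) ^ d"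
        unfolding d_def power_mult_distrib[symmetric] by simp
      also have "\<dots> \<le> real M ^ d" using M4 L w by (intro power_mono) auto
      finally show ?thesis by (simp add: cardJ)
    qed
    ultimately show ?thesis by blast
  qed
  show ?thesis
    using main \<mu> V L w0(1)
    by (intro exI[of _ "\<mu> / 2"] exI[of _ V] exI[of _ "(1 / (4 * L)) ^ d"] exI[of _ w0] conjI allI impI) auto
qed

section \<open>Choice of the time grid\<close>

lemma geometric_exponent_Suc:
  fixes \<eta> :: real
  assumes "\<eta> \<noteq> 1"
  shows "(1 - \<eta> ^ Suc m) / (1 - \<eta>) = 1 + \<eta> * ((1 - \<eta> ^ m) / (1 - \<eta>))"
  using assms by (simp add: field_simps)

text \<open>The exponents obey e(m+1) = 1 + eta e(m), so A(m+1) * A(m) powr (- eta) equals the rate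
  for every m. The exponent of T in the rate is 1 / e(B), which places the last threshold at
  T.\<close>

lemma matern_regret_lower_bound:
  fixes l \<nu> \<Psi> R :: real and B :: nat
  assumes l: "l > 0" and \<nu>: "\<nu> > 0" and \<Psi>: "\<Psi> > 0" and R: "R > 0" and B: "B \<ge> 1"
  defines "\<eta> \<equiv> \<nu> / (2 * \<nu> + real CARD('d))"
  shows "batch_regret_lower_bound (k_matern \<nu> l :: real ^ 'd \<Rightarrow> real ^ 'd \<Rightarrow> real) unit_cube \<Psi> R B
       (\<lambda>T. real T powr ((1 - \<eta>) / (1 - \<eta> ^ B)))"
proof -
  define d where "d = CARD('d)"
  have d: "d \<ge> 1" by (simp add: d_def Suc_leI)
  have \<eta>: "0 < \<eta>" "\<eta> < 1" using \<nu> by (auto simp: \<eta>_def add_pos_nonneg)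
  have \<eta>B: "\<eta> ^ B < 1" using \<eta> B by (simp add: power_less_one_iff)
  obtain \<delta> V c w0 where hf0: "\<delta> > 0 \<and> V > 0 \<and> c > 0 \<and> 0 < w0 \<and> (\<forall>w. 0 < w \<longrightarrow> w \<le> w0 \<longrightarrow>
    (\<exists>J f. hard_family (k_matern \<nu> l :: real ^ 'd \<Rightarrow> real ^ 'd \<Rightarrow> real) \<Psi>
        (\<delta> * w powr \<nu>) (V * w powr (2 * \<nu>)) J f \<and> c * (1 / w) ^ CARD('d) \<le> real (card J)))"
    using matern_hard_family[OF \<nu> l \<Psi>] by (elim exE)
  have pos: "\<delta> > 0" "V > 0" "c > 0" "w0 > 0" using hf0 by simp_all
  have hf: "\<exists>J f. hard_family (k_matern \<nu> l :: real ^ 'd \<Rightarrow> real ^ 'd \<Rightarrow> real) \<Psi>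
        (\<delta> * w powr \<nu>) (V * w powr (2 * \<nu>)) J f \<and> c * (1 / w) ^ d \<le> real (card J)"
    if "0 < w" "w \<le> w0" for w
    using hf0 that unfolding d_def by simp
  define DR where "DR = exp (1 / R\<^sup>2) / R\<^sup>2"
  have DR: "DR > 0" using R by (simp add: DR_def)
  \<comment> \<open>One constant factor for all widths, small enough for the range of
    \<open>matern_hard_family\<close>, for sums of squares at most 1 and for the cardinality
    condition, uniformly in \<open>m\<close> and \<open>T\<close>.\<close>
  have "eventually (\<lambda>\<kappa>. \<kappa> > 0 \<and> \<kappa> \<le> w0 \<and> \<kappa> \<le> 1 \<and> V * \<kappa> powr (2 * \<nu>) \<le> 1 \<and>
      4 * \<kappa> ^ d + 4 * DR * V * \<kappa> powr (2 * \<nu> + d) < c) (at_right 0)"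
  proof (intro eventually_conj)
    show "eventually (\<lambda>\<kappa>::real. \<kappa> > 0) (at_right 0)" by (simp add: eventually_at_filter)
    show "eventually (\<lambda>\<kappa>. \<kappa> \<le> w0) (at_right 0)" "eventually (\<lambda>\<kappa>::real. \<kappa> \<le> 1) (at_right 0)"
      using pos by (auto simp: eventually_at_right_field intro: exI[of _ w0] exI[of _ 1])
    have "((\<lambda>\<kappa>::real. \<kappa>) \<longlongrightarrow> 0) (at_right 0)" by (rule tendsto_ident_at)
    then have p: "((\<lambda>\<kappa>::real. \<kappa> powr e) \<longlongrightarrow> 0) (at_right 0)" if "e > 0" for e
      using tendsto_zero_powrI[OF _ tendsto_const[of e] _ that, of "\<lambda>\<kappa>. \<kappa>" "at_right 0"]
      by (simp add: eventually_at_filter)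
    have "((\<lambda>\<kappa>. V * \<kappa> powr (2 * \<nu>)) \<longlongrightarrow> V * 0) (at_right 0)"
      using \<nu> by (intro tendsto_mult tendsto_const p) auto
    from order_tendstoD(2)[OF this, of 1]
    show "eventually (\<lambda>\<kappa>. V * \<kappa> powr (2 * \<nu>) \<le> 1) (at_right 0)"
      by (auto elim: eventually_mono)
    have "((\<lambda>\<kappa>. 4 * \<kappa> ^ d + 4 * DR * V * \<kappa> powr (2 * \<nu> + d)) \<longlongrightarrow> 4 * 0 ^ d + 4 * DR * V * 0) (at_right 0)"
      using \<nu> by (intro tendsto_add tendsto_mult tendsto_const tendsto_power tendsto_ident_at p) auto
    from order_tendstoD(2)[OF this, of c]
    show "eventually (\<lambda>\<kappa>. 4 * \<kappa> ^ d + 4 * DR * V * \<kappa> powr (2 * \<nu> + d) < c) (at_right 0)"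
      using d pos by (simp add: power_0_left)
  qed
  then obtain \<kappa> where \<kappa>: "\<kappa> > 0" "\<kappa> \<le> w0" "\<kappa> \<le> 1" "V * \<kappa> powr (2 * \<nu>) \<le> 1"
      "4 * \<kappa> ^ d + 4 * DR * V * \<kappa> powr (2 * \<nu> + d) < c"
    using eventually_happens'[OF trivial_limit_at_right_real] by blast
  define e where "e = (\<lambda>m. (1 - \<eta> ^ m) / (1 - \<eta>))"
  have e_nonneg: "0 \<le> e m" for m using \<eta> by (simp add: e_def power_le_one)
  show ?thesis
  proof (rule batch_regret_lower_boundI[where ?T0.0=1 and c="\<delta> * \<kappa> powr \<nu> / 2", OF R B])
    show "\<delta> * \<kappa> powr \<nu> / 2 > 0" using pos \<kappa> by simp
    fix T :: nat assume T: "T \<ge> 1"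
    define \<rho> where "\<rho> = real T powr ((1 - \<eta>) / (1 - \<eta> ^ B))"
    have \<rho>: "\<rho> \<ge> 1" using T \<eta> \<eta>B by (simp add: \<rho>_def ge_one_powr_ge_zero)
    define A where "A = (\<lambda>m. \<rho> powr e m)"
    have A1: "A m \<ge> 1" for m using \<rho> e_nonneg by (simp add: A_def ge_one_powr_ge_zero)
    \<comment> \<open>No data precede the first batch, so its threshold is 0, whereas its width is
      computed from A 0 = 1.\<close>
    define a where "a = (\<lambda>m. if m = 0 then 0 else A m)"
    \<comment> \<open>Since eta / nu = 1 / (2 nu + d), the product A m * w m powr (2 nu + d) is
      constant: information and number of members balance.\<close>
    define w where "w = (\<lambda>m. \<kappa> * A m powr (- \<eta> / \<nu>))"
    have w: "0 < w m" "w m \<le> \<kappa>" for m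
    proof -
      show "0 < w m" using \<kappa> A1[of m] by (simp add: w_def)
      have "A m powr (- \<eta> / \<nu>) \<le> A m powr 0" using A1[of m] \<eta> \<nu> by (intro powr_mono) auto
      then show "w m \<le> \<kappa>" using \<kappa> A1[of m] by (simp add: w_def mult_left_le)
    qed
    have wpow: "w m powr x = \<kappa> powr x * A m powr (- \<eta> * x / \<nu>)" for m x
      using \<kappa> A1[of m] by (simp add: w_def powr_mult powr_powr)
    have aB: "a B \<le> real T"
    proof -
      have "(1 - \<eta>) / (1 - \<eta> ^ B) * e B = 1" using \<eta> \<eta>B by (simp add: e_def)
      then show ?thesis using B T by (simp add: a_def A_def \<rho>_def powr_powr)
    qed
    have step: "2 * (\<delta> * \<kappa> powr \<nu> / 2 * \<rho>) \<le> a (Suc m) * (\<delta> * w m powr \<nu>)" for m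
    proof -
      have es: "e (Suc m) = 1 + \<eta> * e m" unfolding e_def using \<eta> by (intro geometric_exponent_Suc) auto
      have "A (Suc m) * A m powr (- \<eta>) = \<rho> powr (e (Suc m) + - (\<eta> * e m))"
        using \<rho> by (simp add: A_def powr_powr powr_add[symmetric] mult.commute)
      also have "\<dots> = \<rho>" using \<rho> by (simp add: es)
      finally have "A (Suc m) * A m powr (- \<eta>) = \<rho>" .
      moreover have "w m powr \<nu> = \<kappa> powr \<nu> * A m powr (- \<eta>)" using \<nu> by (simp add: wpow)
      ultimately have "a (Suc m) * (\<delta> * w m powr \<nu>) = \<delta> * \<kappa> powr \<nu> * \<rho>" by (simp add: a_def mult_ac)
      moreover have "2 * (\<delta> * \<kappa> powr \<nu> / 2 * \<rho>) = \<delta> * \<kappa> powr \<nu> * \<rho>" by simp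
      ultimately show ?thesis by (simp only: order_refl)
    qed
    have V1: "V * w m powr (2 * \<nu>) \<le> 1" for m
    proof -
      have "w m powr (2 * \<nu>) \<le> \<kappa> powr (2 * \<nu>)" using w[of m] \<nu> by (intro powr_mono2) auto
      then have "V * w m powr (2 * \<nu>) \<le> V * \<kappa> powr (2 * \<nu>)" using pos by simp
      then show ?thesis using \<kappa>(4) by linarith
    qed
    have card: "4 * (1 + a m * (DR * (V * w m powr (2 * \<nu>)))) < c * (1 / w m) ^ d" for m
    proof -
      have "A m * w m powr (2 * \<nu> + d) = \<kappa> powr (2 * \<nu> + d)"
      proof -
        have "- \<eta> * (2 * \<nu> + d) / \<nu> = - 1" using \<nu> by (simp add: \<eta>_def d_def field_simps add_nonneg_eq_0_iff)
        then show ?thesis using A1[of m] by (simp add: wpow powr_minus)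
      qed
      moreover have "w m powr (2 * \<nu> + d) = w m powr (2 * \<nu>) * w m ^ d"
        using w[of m] by (simp add: powr_add powr_realpow)
      ultimately have eq: "A m * (w m powr (2 * \<nu>) * w m ^ d) = \<kappa> powr (2 * \<nu> + d)" by simp
      have "a m \<le> A m" using A1[of 0] by (cases "m = 0") (auto simp: a_def)
      then have "4 * (1 + a m * (DR * (V * w m powr (2 * \<nu>)))) * w m ^ d
          \<le> 4 * (1 + A m * (DR * (V * w m powr (2 * \<nu>)))) * w m ^ d"
        using w[of m] DR pos by (intro mult_right_mono mult_left_mono add_left_mono) auto
      also have "\<dots> = 4 * w m ^ d + 4 * DR * V * (A m * (w m powr (2 * \<nu>) * w m ^ d))"
        by (simp add: algebra_simps)
      also have "\<dots> \<le> 4 * \<kappa> ^ d + 4 * DR * V * \<kappa> powr (2 * \<nu> + d)"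
        unfolding eq using w[of m] by (intro add_right_mono mult_left_mono power_mono) auto
      also have "\<dots> < c" by (rule \<kappa>(5))
      finally have "4 * (1 + a m * (DR * (V * w m powr (2 * \<nu>)))) < c / w m ^ d"
        by (simp only: pos_less_divide_eq[OF zero_less_power[OF w(1)]])
      then show ?thesis by (simp only: power_one_over times_divide_eq_right mult_1_right)
    qed
    show "\<exists>a \<delta>' V'. a 0 = 0 \<and> a B \<le> real T \<and>
      (\<forall>m<B. 0 \<le> V' m \<and> V' m \<le> 1 \<and> 0 \<le> \<delta>' m \<and>
         2 * (\<delta> * \<kappa> powr \<nu> / 2 * real T powr ((1 - \<eta>) / (1 - \<eta> ^ B))) \<le> a (Suc m) * \<delta>' m \<and>
         (\<exists>J f. hard_family (k_matern \<nu> l :: real ^ 'd \<Rightarrow> real ^ 'd \<Rightarrow> real) \<Psi> (\<delta>' m) (V' m) J f \<and>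
            4 * (1 + a m * (exp (1 / R\<^sup>2) / R\<^sup>2 * V' m)) < real (card J)))"
    proof (rule exI[of _ a], rule exI[of _ "\<lambda>m. \<delta> * w m powr \<nu>"],
        rule exI[of _ "\<lambda>m. V * w m powr (2 * \<nu>)"], intro conjI allI impI)
      fix m
      have "w m \<le> w0" using w[of m] \<kappa> by linarith
      then obtain J f where "hard_family (k_matern \<nu> l :: real ^ 'd \<Rightarrow> real ^ 'd \<Rightarrow> real) \<Psi>
        (\<delta> * w m powr \<nu>) (V * w m powr (2 * \<nu>)) J f" and J: "c * (1 / w m) ^ d \<le> real (card J)"
        using hf[OF w(1)] by blast
      moreover have "4 * (1 + a m * (exp (1 / R\<^sup>2) / R\<^sup>2 * (V * w m powr (2 * \<nu>)))) < real (card J)"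
        using less_le_trans[OF card J] by (simp add: DR_def)
      ultimately show "\<exists>J f. hard_family (k_matern \<nu> l :: real ^ 'd \<Rightarrow> real ^ 'd \<Rightarrow> real) \<Psi>
          (\<delta> * w m powr \<nu>) (V * w m powr (2 * \<nu>)) J f \<and>
          4 * (1 + a m * (exp (1 / R\<^sup>2) / R\<^sup>2 * (V * w m powr (2 * \<nu>)))) < real (card J)" by blast
    qed (use step V1 aB pos in \<open>simp_all add: a_def \<rho>_def\<close>)
  qed
qed


section \<open>The time grid for the SE kernel\<close>

text \<open>With y = ln T the logarithm of the left side is - y / 4 plus terms of order sqrt y * ln
  y. It compares the amplitude of the later batches with the norm cost of sqrt (ln T) bumps per
  coordinate.\<close>

lemma se_scale_condition:
  fixes l \<Psi> :: real and d :: nat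
  assumes l: "l > 0" and \<Psi>: "\<Psi> > 0"
  shows "eventually (\<lambda>T. ln T powr (d / 2) * T powr (- 1 / 4) *
    (2 * exp (1 / (2 * l\<^sup>2)) * (16 * sqrt (ln T) * l\<^sup>2 + 1) powr (4 * sqrt (ln T))) ^ d \<le> \<Psi>) at_top"
proof -
  define K where "K = 2 * exp (1 / (2 * l\<^sup>2))"
  define a where "a = 16 * l\<^sup>2"
  define r where "r = real d"
  have K: "K > 0" and a: "a > 0" and r: "r \<ge> 0" using l by (auto simp: K_def a_def r_def)
  have "((\<lambda>y::real. exp (r / 2 * ln y - y / 4 + r * ln K + r * (4 * sqrt y * ln (a * sqrt y + 1)))) \<longlongrightarrow> 0) at_top"
    using a by real_asymp
  from filterlim_compose[OF this ln_at_top]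
  have "((\<lambda>T::real. exp (r / 2 * ln (ln T) - ln T / 4 + r * ln K + r * (4 * sqrt (ln T) * ln (a * sqrt (ln T) + 1)))) \<longlongrightarrow> 0) at_top" .
  from order_tendstoD(2)[OF this \<Psi>] eventually_gt_at_top[of "1::real"]
  show ?thesis
  proof eventually_elim
    case (elim T)
    have pos: "a * sqrt (ln T) + 1 > 0" using a elim by (intro add_nonneg_pos mult_nonneg_nonneg) auto
    have 1: "ln T powr (d / 2) = exp (r / 2 * ln (ln T))" using elim by (simp add: powr_def r_def)
    have 2: "T powr (- 1 / 4) = exp (- ln T / 4)" using elim by (simp add: powr_def)
    have 3: "K ^ d = exp (r * ln K)" using K by (simp add: r_def powr_realpow[symmetric] powr_def)
    have 4: "((a * sqrt (ln T) + 1) powr (4 * sqrt (ln T))) ^ d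
        = exp (r * (4 * sqrt (ln T) * ln (a * sqrt (ln T) + 1)))"
      using pos by (simp add: r_def powr_def exp_of_nat_mult[symmetric])
    have "ln T powr (d / 2) * T powr (- 1 / 4) * (K * (a * sqrt (ln T) + 1) powr (4 * sqrt (ln T))) ^ d
       = exp (r / 2 * ln (ln T) - ln T / 4 + r * ln K + r * (4 * sqrt (ln T) * ln (a * sqrt (ln T) + 1)))"
      unfolding power_mult_distrib 1 2 3 4 exp_add[symmetric] mult.assoc[symmetric]
      by (simp add: mult_exp_exp)
    with elim show ?case by (simp add: K_def a_def mult.commute mult.left_commute)
  qed
qed

text \<open>The families after the first batch have size of order \<open>\<Lambda> powr h\<close>,
  against which the amplitudes balance A m * (eps m)^2. The logarithmic factor of \<open>A\<close>
  is forced by A(m+1) * eps(m) being a multiple of the rate, and the logarithm in the rate is the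
  one that cancels it at m = B.\<close>

lemma se_regret_lower_bound:
  fixes l \<Psi> R :: real and B :: nat
  assumes l: "l > 0" and \<Psi>: "\<Psi> > 0" and R: "R > 0" and B: "B \<ge> 1"
  defines "\<eta> \<equiv> 1 / 2 :: real"
  shows "batch_regret_lower_bound (k_SE l :: real ^ 'd \<Rightarrow> real ^ 'd \<Rightarrow> real) unit_cube \<Psi> R B
       (\<lambda>T. real T powr ((1 - \<eta>) / (1 - \<eta> ^ B))
          * ln (real T) powr (real CARD('d) * (\<eta> - \<eta> ^ B) / (2 * (1 - \<eta> ^ B))))"
proof -
  define d where "d = CARD('d)"
  have d: "d \<ge> 1" by (simp add: d_def Suc_leI)
  have \<eta>: "0 < \<eta>" "\<eta> < 1" by (auto simp: \<eta>_def)
  have \<eta>B: "\<eta> ^ B < 1" using \<eta> B by (simp add: power_less_one_iff)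
  define P where "P = (\<lambda>N :: nat. (2 * exp (1 / (2 * l\<^sup>2)) * (16 * real N * l\<^sup>2 + 1) ^ (4*N)) ^ d)"
  have P: "P N > 0" for N unfolding P_def by (intro zero_less_power mult_pos_pos add_nonneg_pos) auto
  obtain c where c: "c > 0" and hf0: "\<forall>N>0. \<forall>\<epsilon>>0.
    \<epsilon> * (2 * exp (1 / (2 * l\<^sup>2)) * (16 * real N * l\<^sup>2 + 1) ^ (4*N)) ^ CARD('d) \<le> \<Psi> \<longrightarrow>
    (\<exists>J f. hard_family (k_SE l :: real ^ 'd \<Rightarrow> real ^ 'd \<Rightarrow> real) \<Psi> (\<epsilon> / 2) (\<epsilon>\<^sup>2) J f \<and>
      (c * real N) ^ CARD('d) \<le> real (card J))"
    using se_hard_family[OF l \<Psi>] by (elim exE conjE)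
  have hf: "\<exists>J f. hard_family (k_SE l :: real ^ 'd \<Rightarrow> real ^ 'd \<Rightarrow> real) \<Psi> (\<epsilon> / 2) (\<epsilon>\<^sup>2) J f \<and>
      (c * real N) ^ d \<le> real (card J)" if "N > 0" "\<epsilon> > 0" "\<epsilon> * P N \<le> \<Psi>" for N \<epsilon>
    by (rule hf0[rule_format, OF that(1,2) that(3)[unfolded P_def d_def], folded d_def])
  define DR where "DR = exp (1 / R\<^sup>2) / R\<^sup>2"
  have DR: "DR > 0" using R by (simp add: DR_def)
  \<comment> \<open>For the first batch more than 4 members suffice, so a fixed number of bumps and
    a constant amplitude will do.\<close>
  obtain N0 :: nat where N0: "5 / c < real N0" using reals_Archimedean2 by blast
  have N0c: "5 < c * real N0" using N0 c by (simp add: field_simps)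
  have N0pos: "N0 > 0" using N0c c by (cases N0) auto
  have cN0: "5 \<le> (c * real N0) ^ d"
    using self_le_power[of "c * real N0" d] N0c d by linarith
  define g where "g = (c / 2) ^ d"
  have g: "g > 0" using c by (simp add: g_def)
  \<comment> \<open>The three bounds give amplitudes at most 1, the norm constraint for
    \<open>N0\<close> bumps, and for later batches information of at most half the family
    size.\<close>
  define \<kappa> where "\<kappa> = min 1 (min (\<Psi> / P N0) (sqrt (g / (8 * DR))))"
  have \<kappa>: "\<kappa> > 0" "\<kappa> \<le> 1" "\<kappa> * P N0 \<le> \<Psi>" "8 * DR * \<kappa>\<^sup>2 \<le> g"
  proof -
    show "\<kappa> > 0" using \<Psi> P g DR by (simp add: \<kappa>_def)
    then have "\<kappa>\<^sup>2 \<le> (sqrt (g / (8 * DR)))\<^sup>2" by (intro power_mono) (auto simp: \<kappa>_def)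
    then show "8 * DR * \<kappa>\<^sup>2 \<le> g" using g DR by (simp add: field_simps)
    have "\<kappa> \<le> \<Psi> / P N0" by (simp add: \<kappa>_def)
    then show "\<kappa> * P N0 \<le> \<Psi>" using P[of N0] by (simp add: field_simps)
  qed (simp add: \<kappa>_def)
  define h where "h = real d / 2"
  have h: "h > 0" using d by (simp add: h_def)
  \<comment> \<open>In order: rounding sqrt (ln T) down loses at most a factor 2; the summand 4 fits
    into half of the family size; amplitudes stay at most 1, via
    \<open>\<Lambda> powr h \<le> \<rho>\<close>; the norm constraint holds after the first
    batch.\<close>
  define good where "good = (\<lambda>T. ln T \<ge> 4 \<and> 8 / g < ln T powr h \<and> ln T powr h \<le> T powr (1 / 2) \<and>
    ln T powr h * T powr (- 1 / 4) *
    (2 * exp (1 / (2 * l\<^sup>2)) * (16 * sqrt (ln T) * l\<^sup>2 + 1) powr (4 * sqrt (ln T))) ^ d \<le> \<Psi>)"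
  have "eventually good at_top"
    unfolding good_def
  proof (intro eventually_conj)
    show "eventually (\<lambda>T::real. ln T \<ge> 4) at_top" by real_asymp
    have "filterlim (\<lambda>T::real. ln T powr h) at_top at_top"
      using h by real_asymp
    then show "eventually (\<lambda>T::real. 8 / g < ln T powr h) at_top"
      by (simp add: filterlim_at_top_dense)
    show "eventually (\<lambda>T::real. ln T powr h \<le> T powr (1 / 2)) at_top"
      using h by real_asymp
  qed (unfold h_def, rule se_scale_condition[OF l \<Psi>])
  then have "eventually (\<lambda>T :: nat. good (real T)) sequentially"
    by (rule eventually_compose_filterlim[OF _ filterlim_real_sequentially])
  then obtain T1 where T1: "\<And>T :: nat. T \<ge> T1 \<Longrightarrow> good (real T)"
    unfolding eventually_sequentially by blast
  define e where "e = (\<lambda>m. (1 - \<eta> ^ m) / (1 - \<eta>))"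
  have e_Suc: "e (Suc m) = 1 + e m / 2" for m
    unfolding e_def using \<eta> by (subst geometric_exponent_Suc) (auto simp: \<eta>_def)
  have e_ge: "0 \<le> e m" for m using \<eta> by (simp add: e_def power_le_one)
  have e_le: "e m \<le> 2" for m by (simp add: e_def \<eta>_def)
  show ?thesis
  proof (rule batch_regret_lower_boundI[where ?T0.0="max T1 1" and c="\<kappa> / 4", OF R B])
    show "\<kappa> / 4 > 0" using \<kappa> by simp
    fix T :: nat assume TT: "T \<ge> max T1 1"
    define \<Lambda> where "\<Lambda> = ln (real T)"
    have T: "real T \<ge> 1" using TT by simp
    have \<Lambda>: "\<Lambda> \<ge> 4" "8 / g < \<Lambda> powr h" "\<Lambda> powr h \<le> real T powr (1 / 2)" and small: "\<Lambda> powr h * real T powr (- 1 / 4) *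
      (2 * exp (1 / (2 * l\<^sup>2)) * (16 * sqrt \<Lambda> * l\<^sup>2 + 1) powr (4 * sqrt \<Lambda>)) ^ d \<le> \<Psi>"
      using T1[of T] TT by (auto simp: \<Lambda>_def good_def)
    define \<rho> where "\<rho> = real T powr ((1 - \<eta>) / (1 - \<eta> ^ B)) * \<Lambda> powr (real CARD('d) * (\<eta> - \<eta> ^ B) / (2 * (1 - \<eta> ^ B)))"
    have \<rho>T: "real T powr (1 / 2) \<le> \<rho>"
    proof -
      have x1: "1 / 2 \<le> (1 - \<eta>) / (1 - \<eta> ^ B)" using \<eta>B by (simp add: \<eta>_def field_simps)
      have "\<eta> ^ B \<le> \<eta> ^ 1" using \<eta> B by (intro power_decreasing) auto
      then have x2: "0 \<le> real CARD('d) * (\<eta> - \<eta> ^ B) / (2 * (1 - \<eta> ^ B))"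
        using \<eta>B by (intro divide_nonneg_pos mult_nonneg_nonneg) auto
      have "real T powr (1 / 2) * 1 \<le> \<rho>"
        unfolding \<rho>_def using T x1 x2 \<Lambda> by (intro mult_mono powr_mono ge_one_powr_ge_zero) auto
      then show ?thesis by simp
    qed
    have \<rho>: "\<rho> \<ge> 1" using \<rho>T T ge_one_powr_ge_zero[of "real T" "1/2"] by linarith
    define A where "A = (\<lambda>m. \<rho> powr e m * \<Lambda> powr (h * (1 - e m)))"
    have A: "A m > 0" for m using \<rho> \<Lambda> by (simp add: A_def)
    have A0: "A 0 = \<Lambda> powr h" using \<rho> by (simp add: A_def e_def)
    have A_Suc: "A (Suc m) * \<Lambda> powr (h / 2) * A m powr (- 1 / 2) = \<rho>" for m
    proof -
      have "A (Suc m) * \<Lambda> powr (h / 2) * A m powr (- 1 / 2)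
          = (\<rho> powr e (Suc m) * \<rho> powr (e m * (- 1 / 2))) *
            (\<Lambda> powr (h * (1 - e (Suc m))) * \<Lambda> powr (h / 2) * \<Lambda> powr (h * (1 - e m) * (- 1 / 2)))"
        using \<rho> \<Lambda> by (simp add: A_def powr_mult powr_powr)
      also have "\<dots> = \<rho> powr 1 * \<Lambda> powr 0"
      proof -
        have 1: "e (Suc m) + e m * (- 1 / 2) = 1" by (simp add: e_Suc)
        have 2: "h * (1 - e (Suc m)) + h / 2 + h * (1 - e m) * (- 1 / 2) = 0" by (simp add: e_Suc algebra_simps)
        show ?thesis unfolding powr_add[symmetric] 1 2 ..
      qed
      finally show ?thesis using \<rho> \<Lambda> by simp
    qed
    define a where "a = (\<lambda>m. if m = 0 then 0 else A m)"
    define \<epsilon> where "\<epsilon> = (\<lambda>m. \<kappa> * (\<Lambda> powr (h / 2) * A m powr (- 1 / 2)))"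
    have \<epsilon>: "\<epsilon> m > 0" for m using \<kappa> \<Lambda> A[of m] by (simp add: \<epsilon>_def)
    have A\<epsilon>: "A m * (\<epsilon> m)\<^sup>2 = \<kappa>\<^sup>2 * \<Lambda> powr h" for m
    proof -
      have "(\<Lambda> powr (h / 2))\<^sup>2 = \<Lambda> powr h" by (simp add: power2_eq_square powr_add[symmetric])
      moreover have "(A m powr (- 1 / 2))\<^sup>2 = A m powr (- 1 / 2 + - 1 / 2)"
        by (simp only: power2_eq_square powr_add)
      then have "A m * (A m powr (- 1 / 2))\<^sup>2 = 1"
        using A[of m] by (simp add: powr_minus)
      ultimately show ?thesis by (simp add: \<epsilon>_def power_mult_distrib ac_simps)
    qed
    have \<epsilon>0: "\<epsilon> 0 = \<kappa>"
      using \<Lambda> by (simp add: \<epsilon>_def A0 powr_powr powr_add[symmetric])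
    have \<rho>\<Lambda>: "\<Lambda> powr h \<le> \<rho>" using \<Lambda>(3) \<rho>T by linarith
    have A_ge: "\<Lambda> powr h \<le> A m" for m
    proof -
      have "\<Lambda> powr h * 1 \<le> \<Lambda> powr h * (\<rho> / \<Lambda> powr h) powr e m"
        using \<rho>\<Lambda> \<Lambda> e_ge by (intro mult_left_mono ge_one_powr_ge_zero) auto
      also have "(\<rho> / \<Lambda> powr h) powr e m = \<rho> powr e m / \<Lambda> powr (h * e m)"
        using \<rho> \<Lambda> by (simp add: powr_divide powr_powr)
      also have "\<Lambda> powr h * (\<rho> powr e m / \<Lambda> powr (h * e m)) = A m"
        by (simp add: A_def right_diff_distrib powr_diff)
      finally show ?thesis by simp
    qed
    \<comment> \<open>From the second batch on the exponent \<open>e m\<close> is at least 1, so the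
      threshold is at least sqrt T up to logarithms. This is what makes the amplitude polynomially
      small in T.\<close>
    have A_low: "real T powr (1 / 2) * \<Lambda> powr (- h) \<le> A m" if "m > 0" for m
    proof -
      obtain m' where m': "m = Suc m'" using \<open>m > 0\<close> by (cases m) auto
      have em: "1 \<le> e m" using e_ge[of m'] by (simp add: m' e_Suc)
      have "real T powr (1 / 2) \<le> \<rho> powr 1" using \<rho>T \<rho> by simp
      also have "\<dots> \<le> \<rho> powr e m" using \<rho> em by (intro powr_mono) auto
      finally have 1: "real T powr (1 / 2) \<le> \<rho> powr e m" .
      have "h * e m \<le> h * 2" using h e_le[of m] by (intro mult_left_mono) auto
      then have "\<Lambda> powr (- h) \<le> \<Lambda> powr (h * (1 - e m))"
        using \<Lambda> by (intro powr_mono) (auto simp: algebra_simps)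
      with 1 show ?thesis unfolding A_def by (intro mult_mono) auto
    qed
    have \<epsilon>1: "\<epsilon> m \<le> 1" for m
    proof -
      have "A m powr (- 1 / 2) \<le> (\<Lambda> powr h) powr (- 1 / 2)"
        using A_ge[of m] \<Lambda> by (intro powr_mono2') auto
      also have "\<dots> = \<Lambda> powr (- (h / 2))" by (simp add: powr_powr)
      finally have "\<epsilon> m \<le> \<kappa> * (\<Lambda> powr (h / 2) * \<Lambda> powr (- (h / 2)))"
        unfolding \<epsilon>_def using \<kappa> by (intro mult_left_mono) auto
      also have "\<dots> = \<kappa>" using \<Lambda> by (simp add: powr_add[symmetric])
      finally show ?thesis using \<kappa> by simp
    qed
    have \<epsilon>T: "\<epsilon> m \<le> \<Lambda> powr h * real T powr (- 1 / 4)" if "m > 0" for m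
    proof -
      have "A m powr (- 1 / 2) \<le> (real T powr (1 / 2) * \<Lambda> powr (- h)) powr (- 1 / 2)"
        using A_low[OF that] T \<Lambda> by (intro powr_mono2') auto
      also have "\<dots> = real T powr (- 1 / 4) * \<Lambda> powr (h / 2)"
        using T \<Lambda> by (simp add: powr_mult powr_powr)
      finally have "\<epsilon> m \<le> 1 * (\<Lambda> powr (h / 2) * (real T powr (- 1 / 4) * \<Lambda> powr (h / 2)))"
        unfolding \<epsilon>_def using \<kappa> by (intro mult_mono mult_left_mono) auto
      also have "\<dots> = (\<Lambda> powr (h / 2) * \<Lambda> powr (h / 2)) * real T powr (- 1 / 4)" by simp
      also have "\<dots> = \<Lambda> powr h * real T powr (- 1 / 4)" by (simp add: powr_add[symmetric])
      finally show ?thesis .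
    qed
    define N where "N = nat \<lfloor>sqrt \<Lambda>\<rfloor>"
    have s2: "2 \<le> sqrt \<Lambda>" using \<Lambda>(1) by (intro real_le_rsqrt) auto
    have N: "real N \<le> sqrt \<Lambda>" "sqrt \<Lambda> / 2 \<le> real N"
      using s2 unfolding N_def by linarith+
    have "0 < real N" using N s2 by linarith
    then have Npos: "N > 0" by simp
    have PN: "P N \<le> (2 * exp (1 / (2 * l\<^sup>2)) * (16 * sqrt \<Lambda> * l\<^sup>2 + 1) powr (4 * sqrt \<Lambda>)) ^ d"
    proof -
      have "16 * real N * l\<^sup>2 \<le> 16 * sqrt \<Lambda> * l\<^sup>2" using N by (intro mult_right_mono) auto
      then have "(16 * real N * l\<^sup>2 + 1) ^ (4*N) \<le> (16 * sqrt \<Lambda> * l\<^sup>2 + 1) ^ (4*N)"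
        by (intro power_mono) auto
      also have "\<dots> = (16 * sqrt \<Lambda> * l\<^sup>2 + 1) powr (real (4*N))"
        using \<Lambda>(1) by (subst powr_realpow) (auto intro!: add_nonneg_pos mult_nonneg_nonneg)
      also have "\<dots> \<le> (16 * sqrt \<Lambda> * l\<^sup>2 + 1) powr (4 * sqrt \<Lambda>)"
        using N \<Lambda>(1) by (intro powr_mono) auto
      finally show ?thesis unfolding P_def by (intro power_mono mult_left_mono) auto
    qed
    have cardN: "g * \<Lambda> powr h \<le> (c * real N) ^ d"
    proof -
      have "\<Lambda> powr h = (\<Lambda> powr (1 / 2)) powr real d" by (simp add: powr_powr h_def)
      also have "\<dots> = sqrt \<Lambda> ^ d" using \<Lambda> by (simp add: powr_half_sqrt powr_realpow)
      finally have "g * \<Lambda> powr h = (c * (sqrt \<Lambda> / 2)) ^ d"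
        by (simp add: g_def power_mult_distrib power_divide)
      also have "\<dots> \<le> (c * real N) ^ d" using N c \<Lambda>(1) by (intro power_mono mult_left_mono) auto
      finally show ?thesis .
    qed
    have fam: "\<exists>J f. hard_family (k_SE l :: real ^ 'd \<Rightarrow> real ^ 'd \<Rightarrow> real) \<Psi> (\<epsilon> m / 2) ((\<epsilon> m)\<^sup>2) J f \<and>
            4 * (1 + a m * (DR * (\<epsilon> m)\<^sup>2)) < real (card J)" for m
    proof (cases "m = 0")
      case True
      have "\<kappa> * P N0 \<le> \<Psi>" by (rule \<kappa>(3))
      from hf[OF N0pos \<kappa>(1) this] obtain J f where
        "hard_family (k_SE l :: real ^ 'd \<Rightarrow> real ^ 'd \<Rightarrow> real) \<Psi> (\<kappa> / 2) (\<kappa>\<^sup>2) J f" "(c * real N0) ^ d \<le> real (card J)"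
        by blast
      then show ?thesis using True cN0 by (intro exI[of _ J] exI[of _ f]) (simp add: \<epsilon>0 a_def)
    next
      case False
      have "\<epsilon> m * P N \<le> (\<Lambda> powr h * real T powr (- 1 / 4)) *
          (2 * exp (1 / (2 * l\<^sup>2)) * (16 * sqrt \<Lambda> * l\<^sup>2 + 1) powr (4 * sqrt \<Lambda>)) ^ d"
        using \<epsilon>T[of m] False PN P[of N] by (intro mult_mono) auto
      also have "\<dots> \<le> \<Psi>" by (rule small)
      finally have "\<epsilon> m * P N \<le> \<Psi>" .
      from hf[OF Npos \<epsilon> this] obtain J f where
        J: "hard_family (k_SE l :: real ^ 'd \<Rightarrow> real ^ 'd \<Rightarrow> real) \<Psi> (\<epsilon> m / 2) ((\<epsilon> m)\<^sup>2) J f" "(c * real N) ^ d \<le> real (card J)"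
        by blast
      have "4 * (1 + a m * (DR * (\<epsilon> m)\<^sup>2)) = 4 + 4 * DR * (A m * (\<epsilon> m)\<^sup>2)"
        using False by (simp add: a_def)
      also have "\<dots> = 4 + (8 * DR * \<kappa>\<^sup>2) * \<Lambda> powr h / 2" unfolding A\<epsilon> by simp
      also have "\<dots> \<le> 4 + g * \<Lambda> powr h / 2"
        using \<kappa>(4) by (intro add_left_mono divide_right_mono mult_right_mono) auto
      also have "\<dots> < g * \<Lambda> powr h" using \<Lambda>(2) g by (simp add: field_simps)
      also have "\<dots> \<le> real (card J)" using cardN J(2) by linarith
      finally show ?thesis using J(1) by blast
    qed
    have aB: "a B \<le> real T"
    proof -
      have e1: "(1 - \<eta>) / (1 - \<eta> ^ B) * e B = 1" using \<eta> \<eta>B by (simp add: e_def)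
      have e2: "real CARD('d) * (\<eta> - \<eta> ^ B) / (2 * (1 - \<eta> ^ B)) * e B + h * (1 - e B) = 0"
      proof -
        define X where "X = 1 - \<eta> ^ B"
        have X: "X > 0" using \<eta>B by (simp add: X_def)
        have eB: "e B = 2 * X" by (simp add: e_def X_def \<eta>_def)
        have "real CARD('d) * (\<eta> - \<eta> ^ B) / (2 * X) * (2 * X) = real d * (\<eta> - \<eta> ^ B)"
          using X by (simp add: d_def)
        moreover have "real d * (\<eta> - \<eta> ^ B) + h * (1 - 2 * X) = 0"
          by (simp add: h_def X_def \<eta>_def algebra_simps)
        ultimately show ?thesis unfolding eB X_def[symmetric] by simp
      qed
      have "A B = real T powr ((1 - \<eta>) / (1 - \<eta> ^ B) * e B) *
          \<Lambda> powr (real CARD('d) * (\<eta> - \<eta> ^ B) / (2 * (1 - \<eta> ^ B)) * e B + h * (1 - e B))"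
        unfolding A_def \<rho>_def powr_add using T \<Lambda> by (simp add: powr_mult powr_powr)
      also have "\<dots> = real T" unfolding e1 e2 using T \<Lambda> by simp
      finally show ?thesis using B by (simp add: a_def)
    qed
    have step: "2 * (\<kappa> / 4 * \<rho>) \<le> a (Suc m) * (\<epsilon> m / 2)" for m
    proof -
      have "a (Suc m) * (\<epsilon> m / 2) = \<kappa> / 2 * (A (Suc m) * \<Lambda> powr (h / 2) * A m powr (- 1 / 2))"
        by (simp add: a_def \<epsilon>_def)
      also have "\<dots> = 2 * (\<kappa> / 4 * \<rho>)" unfolding A_Suc by simp
      finally show ?thesis by (simp only: order_refl)
    qed
    show "\<exists>a \<delta> V. a 0 = 0 \<and> a B \<le> real T \<and>
      (\<forall>m<B. 0 \<le> V m \<and> V m \<le> 1 \<and> 0 \<le> \<delta> m \<and>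
         2 * (\<kappa> / 4 * (real T powr ((1 - \<eta>) / (1 - \<eta> ^ B))
          * ln (real T) powr (real CARD('d) * (\<eta> - \<eta> ^ B) / (2 * (1 - \<eta> ^ B))))) \<le> a (Suc m) * \<delta> m \<and>
         (\<exists>J f. hard_family (k_SE l :: real ^ 'd \<Rightarrow> real ^ 'd \<Rightarrow> real) \<Psi> (\<delta> m) (V m) J f \<and>
            4 * (1 + a m * (exp (1 / R\<^sup>2) / R\<^sup>2 * V m)) < real (card J)))"
      unfolding \<Lambda>_def[symmetric] \<rho>_def[symmetric] DR_def[symmetric]
    proof (rule exI[of _ a], rule exI[of _ "\<lambda>m. \<epsilon> m / 2"], rule exI[of _ "\<lambda>m. (\<epsilon> m)\<^sup>2"],
        intro conjI allI impI fam aB step)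
      show "a 0 = 0" by (simp add: a_def)
      fix m
      show "0 \<le> (\<epsilon> m)\<^sup>2" by simp
      show "(\<epsilon> m)\<^sup>2 \<le> 1" using \<epsilon>[of m] \<epsilon>1[of m] by (simp add: power_le_one)
      show "0 \<le> \<epsilon> m / 2" using \<epsilon>[of m] by simp
    qed
  qed
qed

theorem theorem3:
  fixes l \<nu> \<Psi> R :: real and B :: nat
  assumes "l > 0" and "\<nu> > 0" and "\<Psi> > 0" and "R > 0" and "B \<ge> 1"
  shows
    "batch_regret_lower_bound (k_SE l :: real ^ 'd \<Rightarrow> real ^ 'd \<Rightarrow> real) unit_cube \<Psi> R B
       (\<lambda>T. let \<eta> = 1 / 2 :: real in
          real T powr ((1 - \<eta>) / (1 - \<eta> ^ B))
          * ln (real T) powr (real CARD('d) * (\<eta> - \<eta> ^ B) / (2 * (1 - \<eta> ^ B))))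
     \<and> batch_regret_lower_bound (k_matern \<nu> l :: real ^ 'd \<Rightarrow> real ^ 'd \<Rightarrow> real) unit_cube \<Psi> R B
       (\<lambda>T. let \<eta> = \<nu> / (2 * \<nu> + real CARD('d)) in
          real T powr ((1 - \<eta>) / (1 - \<eta> ^ B)))"
  unfolding Let_def
  by (intro conjI se_regret_lower_bound matern_regret_lower_bound assms)

end
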